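(* Let $N\ge 1$ be an integer and let $(W^{1},\ldots,W^{N})$ be an $N$-dimensional Brownian motion on a probability space $(\Omega,\mathbb{P})$ equipped with a filtration $\mathscr{F}=\{\mathscr{F}_t,\ t\geq 0\}$. Let $V\in C^2(\mathbb{R})$ be a real-valued function such that, for some $\delta>0$, $$V(x)\geq (1+\delta)\log(x^2+1),\qquad x\in\mathbb{R},$$ and such that: (i) for every $R>0$ there is $K_R>0$ such that for all $x,y\in\mathbb{R}$ with $|x|,|y|\leq R$, $$(x-y)(V'(x)-V'(y))\geq -K_R|x-y|^2;$$ (ii) there is $\gamma>0$ such that $$-xV'(x)\leq \gamma(1+|x|^2),\qquad \forall\, x\in\mathbb{R}.$$ Then, for any $\beta\geq 1$ and any given $\lambda_N(0)=(\lambda_N^1(0),\ldots,\lambda_N^N(0))\in\triangle_N$, there exists a unique strong solution $(\lambda_N(t))_{t\geq 0}$ with infinite lifetime to the system of stochastic differential equations $$d\lambda_N^i(t)=\sqrt{\frac{2}{\beta N}}\,dW^i_t+\frac1N\sum_{j:\,j\neq i}\frac{1}{\lambda_N^i(t)-\lambda_N^j(t)}\,dt-\frac12 V'(\lambda_N^i(t))\,dt,\qquad i=1,\ldots,N,$$ with initial value $\lambda_N(0)$ and such that $\lambda_N(t)\in\triangle_N$ for all $t\geq 0$.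
   Context: $\triangle_N=\{(x_i)_{1\le i\le N}\in\mathbb{R}^N:\ x_1<x_2<\cdots<x_N\}$. *)

theory Defs
  imports "HOL-Probability.Probability"
begin

text \<open>
  Points of \<open>\<real>\<^sup>N\<close> are extensional functions on the index set \<open>{1..N}\<close>, so that the Borel space
  of \<open>\<real>\<^sup>N\<close> is a finite product measure space. Processes are indexed by \<open>real\<close>, but only
  times \<open>t \<ge> 0\<close> are ever constrained.
\<close>

abbreviation borel_vec :: "nat \<Rightarrow> (nat \<Rightarrow> real) measure" where
  "borel_vec N \<equiv> PiM {1..N} (\<lambda>_. borel)"

definition ordered_chamber :: "nat \<Rightarrow> (nat \<Rightarrow> real) set" where
  "ordered_chamber N =
     {x \<in> {1..N} \<rightarrow>\<^sub>E UNIV. \<forall>i\<in>{1..N}. \<forall>j\<in>{1..N}. i < j \<longrightarrow> x i < x j}"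

text \<open>
  The library locale \<open>filtration\<close> over the index type \<open>real\<close> would also constrain negative
  times and does not require the members to be sub-sigma-algebras of \<open>M\<close>.
\<close>

definition is_filtration :: "'a measure \<Rightarrow> (real \<Rightarrow> 'a measure) \<Rightarrow> bool" where
  "is_filtration M F \<longleftrightarrow>
     (\<forall>t\<ge>0. subalgebra M (F t)) \<and>
     (\<forall>s t. 0 \<le> s \<and> s \<le> t \<longrightarrow> sets (F s) \<subseteq> sets (F t))"

definition increment ::
  "nat \<Rightarrow> (real \<Rightarrow> 'a \<Rightarrow> nat \<Rightarrow> real) \<Rightarrow> real \<Rightarrow> real \<Rightarrow> 'a \<Rightarrow> nat \<Rightarrow> real" where
  "increment N W s t \<omega> = (\<lambda>i\<in>{1..N}. W t \<omega> i - W s \<omega> i)"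

text \<open>
  Standard \<open>N\<close>-dimensional Brownian motion relative to the filtration \<open>F\<close>. The product of the
  one-dimensional Gaussian laws is the normal law with mean 0 and covariance \<open>(t - s) I\<close>;
  the second argument of \<^const>\<open>normal_density\<close> is the standard deviation.
\<close>

definition brownian_motion ::
  "'a measure \<Rightarrow> (real \<Rightarrow> 'a measure) \<Rightarrow> nat \<Rightarrow> (real \<Rightarrow> 'a \<Rightarrow> nat \<Rightarrow> real) \<Rightarrow> bool" where
  "brownian_motion M F N W \<longleftrightarrow>
     (\<forall>t\<ge>0. W t \<in> measurable (F t) (borel_vec N)) \<and>
     (AE \<omega> in M. \<forall>i\<in>{1..N}. W 0 \<omega> i = 0) \<and>
     (AE \<omega> in M. \<forall>i\<in>{1..N}. continuous_on {0..} (\<lambda>t. W t \<omega> i)) \<and>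
     (\<forall>s t. 0 \<le> s \<and> s < t \<longrightarrow>
        distr M (borel_vec N) (increment N W s t) =
          PiM {1..N} (\<lambda>_. density lborel (\<lambda>x. ennreal (normal_density 0 (sqrt (t - s)) x))) \<and>
        prob_space.indep_set M (sets (F s))
          (sets (vimage_algebra (space M) (increment N W s t) (borel_vec N))))"

definition natural_filtration ::
  "'a measure \<Rightarrow> nat \<Rightarrow> (real \<Rightarrow> 'a \<Rightarrow> nat \<Rightarrow> real) \<Rightarrow> real \<Rightarrow> 'a measure" where
  "natural_filtration M N W t =
     sigma (space M) {W s -` A \<inter> space M | s A. 0 \<le> s \<and> s \<le> t \<and> A \<in> sets (borel_vec N)}"

text \<open>
  Null sets of the completion are arbitrary subsets of \<open>M\<close>-null sets, so \<open>M\<close> itself need not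
  be complete.
\<close>

definition augmentation :: "'a measure \<Rightarrow> (real \<Rightarrow> 'a measure) \<Rightarrow> real \<Rightarrow> 'a measure" where
  "augmentation M F t = sigma (space M) (sets (F t) \<union> null_sets (completion M))"

definition dyson_drift :: "nat \<Rightarrow> (real \<Rightarrow> real) \<Rightarrow> (nat \<Rightarrow> real) \<Rightarrow> nat \<Rightarrow> real" where
  "dyson_drift N V x i =
     1 / real N * (\<Sum>j\<in>{1..N} - {i}. 1 / (x i - x j)) - 1 / 2 * deriv V (x i)"

text \<open>
  \<open>X\<close> is a \<open>G\<close>-adapted solution on the whole of \<open>[0, \<infinity>)\<close>, driven by \<open>W\<close>, started at \<open>x\<^sub>0\<close> and
  staying in the chamber. Path properties hold almost surely, with one exceptional set for all
  times. As the diffusion coefficient is constant, its stochastic integral is that constant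
  times the increment of \<open>W\<close>. In the chamber no denominator of the drift vanishes.
\<close>

definition dyson_solution ::
  "'a measure \<Rightarrow> (real \<Rightarrow> 'a measure) \<Rightarrow> nat \<Rightarrow> (real \<Rightarrow> 'a \<Rightarrow> nat \<Rightarrow> real) \<Rightarrow>
   (real \<Rightarrow> real) \<Rightarrow> real \<Rightarrow> (nat \<Rightarrow> real) \<Rightarrow> (real \<Rightarrow> 'a \<Rightarrow> nat \<Rightarrow> real) \<Rightarrow> bool" where
  "dyson_solution M G N W V \<beta> x\<^sub>0 X \<longleftrightarrow>
     (\<forall>t\<ge>0. X t \<in> measurable (G t) (borel_vec N)) \<and>
     (AE \<omega> in M. X 0 \<omega> = x\<^sub>0) \<and>
     (AE \<omega> in M. \<forall>i\<in>{1..N}. continuous_on {0..} (\<lambda>t. X t \<omega> i)) \<and>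
     (AE \<omega> in M. \<forall>t\<ge>0. X t \<omega> \<in> ordered_chamber N) \<and>
     (AE \<omega> in M. \<forall>i\<in>{1..N}. \<forall>t\<ge>0.
        set_integrable lborel {0..t} (\<lambda>s. dyson_drift N V (X s \<omega>) i) \<and>
        X t \<omega> i = X 0 \<omega> i + sqrt (2 / (\<beta> * real N)) * (W t \<omega> i - W 0 \<omega> i)
          + (LINT s:{0..t}|lborel. dyson_drift N V (X s \<omega>) i))"

text \<open>
  The initial value is deterministic, hence strong solutions are those adapted to the augmented
  filtration of the driving Brownian motion alone.
\<close>

definition strong_dyson_solution ::
  "'a measure \<Rightarrow> nat \<Rightarrow> (real \<Rightarrow> 'a \<Rightarrow> nat \<Rightarrow> real) \<Rightarrow>
   (real \<Rightarrow> real) \<Rightarrow> real \<Rightarrow> (nat \<Rightarrow> real) \<Rightarrow> (real \<Rightarrow> 'a \<Rightarrow> nat \<Rightarrow> real) \<Rightarrow> bool" where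
  "strong_dyson_solution M N W V \<beta> x\<^sub>0 X \<longleftrightarrow>
     dyson_solution M (augmentation M (natural_filtration M N W)) N W V \<beta> x\<^sub>0 X"

end

theory Submission
  imports Defs
begin

text \<open>
  The noise is additive, so that the equation is an ordinary differential equation driven by a
  fixed continuous path, and uniqueness in the chamber is Gronwall's lemma. For existence the
  drift is truncated at level \<open>r\<close> (gaps below \<open>1 / r\<close>, positions beyond \<open>r\<close>), which makes it
  bounded and Lipschitz. The repulsion is monotone; comparing with the reference points
  \<open>l i + noise i\<close>, which stay far apart for large \<open>l\<close>, gives a bound on the truncated solutions
  that is pathwise and uniform in \<open>r\<close>. Collisions are excluded by the supermartingale argument
  for \<open>- (\<Sum>i<j. ln (x j - x i))\<close>, whose drift is bounded above on bounded sets because \<open>\<beta> \<ge> 1\<close>.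
  Instead of Ito's formula, a one-sided Taylor estimate is summed over a time grid whose mesh
  tends to \<open>0\<close>.
\<close>

section \<open>Picard iteration\<close>

text \<open>A strong solution has to be adapted, so the truncated equations are solved by Picard
  iteration, whose iterates are adapted one by one, and the process is the limit over integer
  levels. Levels can be compared because their drifts coincide wherever gaps and positions respect
  both cutoffs. The non-explosion bound depends on the path, whereas the probability estimate needs
  a fixed bound: the estimate is therefore stated for fixed \<open>R\<close> and \<open>T\<close>,
  used for all integers, and each path selects its own pair afterwards. For paths bounded by
  \<open>R\<close> up to time \<open>T\<close>, a gap below \<open>2 / r\<close> is confined to an
  event of probability at most \<open>c / ln (r / 2)\<close> with \<open>c\<close> independent of
  \<open>r\<close>; one level without such a gap is enough, since its truncation is then invisible.
  The grid is refined at fixed \<open>r\<close>. Given the past, a Brownian increment over a step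
  \<open>h\<close> has mean \<open>0\<close> and variance \<open>h\<close>, which reproduces the
  generator, and an absolute third moment of order \<open>h * sqrt h\<close>, so the remainders of
  the \<open>T / h\<close> steps add up to a quantity that vanishes with \<open>h\<close>.\<close>

lemma geometric_cauchy_limit:
  fixes a :: "nat \<Rightarrow> real"
  assumes "\<And>k. \<bar>a (Suc k) - a k\<bar> \<le> K / 2 ^ k"
  shows "a \<longlonglongrightarrow> lim a" "\<bar>a k - lim a\<bar> \<le> 2 * K / 2 ^ k"
proof -
  have K: "K \<ge> 0" using assms[of 0] by simp
  \<comment> \<open>The subtracted tail makes the geometric increments telescope exactly, so that
    the induction on \<open>n\<close> closes.\<close>
  have step: "\<bar>a (k + n) - a k\<bar> \<le> 2 * K / 2 ^ k - 2 * K / 2 ^ (k + n)" for k n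
  proof (induction n)
    case (Suc n)
    have "K / 2 ^ (k + n) = 2 * K / 2 ^ (k + n) - 2 * K / 2 ^ Suc (k + n)"
      by (simp add: field_simps)
    then show ?case using Suc assms[of "k + n"] by simp
  qed simp
  have step': "\<bar>a (k + n) - a k\<bar> \<le> 2 * K / 2 ^ k" for k n
    using step[of k n] K by (smt (verit) divide_nonneg_pos zero_less_power)
  have "(\<lambda>k. 2 * K / 2 ^ k) \<longlonglongrightarrow> 0"
    using tendsto_mult[OF tendsto_const[of "2 * K"] LIMSEQ_power_zero[of "1/2 :: real"]]
    by (simp add: power_one_over field_simps)
  have "Cauchy a"
  proof (rule metric_CauchyI)
    fix e :: real assume "e > 0"
    then obtain k where k: "2 * K / 2 ^ k < e / 2"
      using order_tendstoD(2)[OF \<open>(\<lambda>k. 2 * K / 2 ^ k) \<longlonglongrightarrow> 0\<close>, of "e / 2"]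
      by (auto simp: eventually_sequentially)
    have "dist (a n) (a k) < e / 2" if "n \<ge> k" for n
      using step'[of k "n - k"] that k by (simp add: dist_real_def)
    then show "\<exists>M. \<forall>m\<ge>M. \<forall>n\<ge>M. dist (a m) (a n) < e"
      by (metis dist_triangle_half_l)
  qed
  then show *: "a \<longlonglongrightarrow> lim a"
    by (simp add: Cauchy_convergent_iff convergent_LIMSEQ_iff)
  have "(\<lambda>n. \<bar>a k - a (n + k)\<bar>) \<longlonglongrightarrow> \<bar>a k - lim a\<bar>"
    by (intro tendsto_intros LIMSEQ_ignore_initial_segment *)
  then show "\<bar>a k - lim a\<bar> \<le> 2 * K / 2 ^ k"
    by (rule LIMSEQ_le_const2) (metis abs_minus_commute add.commute step')
qed

lemma continuous_on_Icc_upper_bound: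
  fixes u :: "real \<Rightarrow> real"
  assumes "continuous_on {a..b} u"
  obtains D where "\<forall>s\<in>{a..b}. u s \<le> D"
proof -
  have "bdd_above (u ` {a..b})"
    by (intro bounded_imp_bdd_above compact_imp_bounded compact_continuous_image assms) auto
  then show ?thesis using that by (auto simp: bdd_above_def)
qed

lemma half_power_tendsto_zero: "(\<lambda>k. c * (1 / 2) ^ k) \<longlonglongrightarrow> (0::real)"
  using tendsto_mult[OF tendsto_const[of c] LIMSEQ_power_zero[of "1 / 2 :: real"]] by simp

lemma integral_exp_le:
  fixes u :: "real \<Rightarrow> real"
  assumes "t \<ge> 0" "l > 0" "K \<ge> 0" "continuous_on {0..t} u"
    and "\<And>s. s \<in> {0..t} \<Longrightarrow> u s \<le> K * exp (l * s)"
  shows "integral {0..t} u \<le> K / l * exp (l * t)"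
proof -
  have "((\<lambda>s. K * exp (l * s)) has_integral (K / l * exp (l * t) - K / l * exp (l * 0))) {0..t}"
    using assms by (intro fundamental_theorem_of_calculus)
      (auto intro!: derivative_eq_intros simp: has_real_derivative_iff_has_vector_derivative[symmetric])
  moreover have "u integrable_on {0..t}"
    using assms by (intro integrable_continuous_interval)
  ultimately have "integral {0..t} u \<le> K / l * exp (l * t) - K / l * exp (l * 0)"
    using assms by (intro has_integral_le[OF integrable_integral]) auto
  moreover have "K / l * exp (l * 0) \<ge> 0" using assms by simp
  ultimately show ?thesis by linarith
qed

text \<open>States are functions on the whole index type, but the Lipschitz bound sees only the
  coordinates in \<open>I\<close>; values outside \<open>I\<close> cannot influence
  \<open>b x i\<close>. The bound \<open>B\<close> controls the first Picard step, from which the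
  geometric decay starts.\<close>

locale lipschitz_drift =
  fixes I :: "'i set" and b :: "('i \<Rightarrow> real) \<Rightarrow> 'i \<Rightarrow> real" and L B :: real
  assumes finite_I: "finite I" and L_nonneg: "L \<ge> 0"
    and lipschitz: "i \<in> I \<Longrightarrow> \<bar>b x i - b y i\<bar> \<le> L * (\<Sum>j\<in>I. \<bar>x j - y j\<bar>)"
    and bounded: "i \<in> I \<Longrightarrow> \<bar>b x i\<bar> \<le> B"
begin

definition solves :: "(real \<Rightarrow> 'i \<Rightarrow> real) \<Rightarrow> real \<Rightarrow> (real \<Rightarrow> 'i \<Rightarrow> real) \<Rightarrow> bool" where
  "solves w T x \<longleftrightarrow> (\<forall>i\<in>I. continuous_on {0..T} (\<lambda>t. x t i)) \<and>
     (\<forall>i\<in>I. \<forall>t\<in>{0..T}. x t i = w t i + integral {0..t} (\<lambda>s. b (x s) i))"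

primrec picard :: "(real \<Rightarrow> 'i \<Rightarrow> real) \<Rightarrow> nat \<Rightarrow> real \<Rightarrow> 'i \<Rightarrow> real" where
  "picard w 0 = w"
| "picard w (Suc k) = (\<lambda>t i. w t i + integral {0..t} (\<lambda>s. b (picard w k s) i))"

definition solution :: "(real \<Rightarrow> 'i \<Rightarrow> real) \<Rightarrow> real \<Rightarrow> 'i \<Rightarrow> real" where
  "solution w t i = lim (\<lambda>k. picard w k t i)"

lemma continuous_on_drift:
  assumes "\<And>j. j \<in> I \<Longrightarrow> continuous_on S (\<lambda>t. x t j)" "i \<in> I"
  shows "continuous_on S (\<lambda>t. b (x t) i)"
  unfolding continuous_on_def
proof
  fix t assume "t \<in> S"
  have "((\<lambda>s. L * (\<Sum>j\<in>I. \<bar>x s j - x t j\<bar>)) \<longlongrightarrow> L * (\<Sum>j\<in>I. \<bar>x t j - x t j\<bar>)) (at t within S)"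
    using assms(1) \<open>t \<in> S\<close> by (intro tendsto_intros) (auto simp: continuous_on_def)
  then have "((\<lambda>s. L * (\<Sum>j\<in>I. \<bar>x s j - x t j\<bar>)) \<longlongrightarrow> 0) (at t within S)"
    by simp
  then have "((\<lambda>s. b (x s) i - b (x t) i) \<longlongrightarrow> 0) (at t within S)"
    by (rule Lim_null_comparison[rotated]) (auto intro!: always_eventually lipschitz assms(2))
  then show "((\<lambda>s. b (x s) i) \<longlongrightarrow> b (x t) i) (at t within S)"
    by (simp add: LIM_zero_iff)
qed

text \<open>The exponent of the weight \<open>exp (rate * s)\<close> in a Bielecki norm. Summing the
  Lipschitz bound over \<open>I\<close> costs \<open>card I * L\<close>, the factor 2 turns this
  into a contraction by one half, and the added 1 keeps the rate positive when \<open>L\<close> is 0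
  or \<open>I\<close> is empty.\<close>

definition rate :: real where "rate = 2 * real (card I) * L + 1"

lemma rate_pos: "rate > 0"
  using L_nonneg by (simp add: rate_def add_nonneg_pos)

text \<open>Integrating \<open>exp (rate * s)\<close> gains the factor \<open>1 / rate\<close>. In
  the weighted norm the integral operator therefore halves distances on an interval of any length,
  and no short intervals have to be concatenated.\<close>

lemma contraction:
  assumes "t \<ge> 0" "K \<ge> 0"
    and x: "\<And>i. i \<in> I \<Longrightarrow> continuous_on {0..t} (\<lambda>s. x s i)"
    and y: "\<And>i. i \<in> I \<Longrightarrow> continuous_on {0..t} (\<lambda>s. y s i)"
    and le: "\<And>s. s \<in> {0..t} \<Longrightarrow> (\<Sum>j\<in>I. \<bar>x s j - y s j\<bar>) \<le> K * exp (rate * s)"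
  shows "(\<Sum>i\<in>I. \<bar>integral {0..t} (\<lambda>s. b (x s) i) - integral {0..t} (\<lambda>s. b (y s) i)\<bar>)
           \<le> K / 2 * exp (rate * t)"
proof -
  let ?J = "\<lambda>i. \<bar>integral {0..t} (\<lambda>s. b (x s) i) - integral {0..t} (\<lambda>s. b (y s) i)\<bar>"
  let ?u = "\<lambda>s. \<Sum>j\<in>I. \<bar>x s j - y s j\<bar>"
  have u: "continuous_on {0..t} ?u" by (intro continuous_intros x y)
  have "?J i
      \<le> L * integral {0..t} ?u" if i: "i \<in> I" for i
  proof -
    have cx: "(\<lambda>s. b (x s) i) integrable_on {0..t}" and cy: "(\<lambda>s. b (y s) i) integrable_on {0..t}"
      using i by (auto intro!: integrable_continuous_interval continuous_on_drift x y)
    have "norm (integral {0..t} (\<lambda>s. b (x s) i - b (y s) i)) \<le> integral {0..t} (\<lambda>s. L * ?u s)"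
    proof (rule integral_norm_bound_integral)
      show "(\<lambda>s. b (x s) i - b (y s) i) integrable_on {0..t}" by (rule integrable_diff[OF cx cy])
      show "(\<lambda>s. L * ?u s) integrable_on {0..t}"
        by (intro integrable_continuous_interval continuous_on_mult continuous_on_const u)
    qed (simp add: lipschitz[OF i])
    then show ?thesis by (simp add: integral_diff[OF cx cy])
  qed
  then have "(\<Sum>i\<in>I. ?J i)
      \<le> real (card I) * (L * integral {0..t} ?u)"
    using sum_bounded_above[of I "?J"]
    by simp
  also have "\<dots> \<le> real (card I) * (L * (K / rate * exp (rate * t)))"
    using assms u rate_pos L_nonneg by (intro mult_left_mono integral_exp_le) auto
  also have "\<dots> = (real (card I) * L / rate) * (K * exp (rate * t))"
    by simp
  also have "\<dots> \<le> 1 / 2 * (K * exp (rate * t))"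
    using assms rate_pos by (intro mult_right_mono) (auto simp: rate_def field_simps)
  finally show ?thesis by simp
qed

text \<open>The driving path cancels in the difference of two solutions, so each application of
  \<open>contraction\<close> halves the bound on it, starting from any bound \<open>K\<close>
  supplied by continuity.\<close>

theorem solves_unique:
  assumes x: "solves w T x" and y: "solves w T y" and t: "t \<in> {0..T}" and i: "i \<in> I"
  shows "x t i = y t i"
proof -
  let ?u = "\<lambda>s. \<Sum>j\<in>I. \<bar>x s j - y s j\<bar>"
  have cx: "\<And>i. i \<in> I \<Longrightarrow> continuous_on {0..T} (\<lambda>s. x s i)" and cy: "\<And>i. i \<in> I \<Longrightarrow> continuous_on {0..T} (\<lambda>s. y s i)"
    using x y by (auto simp: solves_def)
  have "continuous_on {0..T} ?u" by (intro continuous_intros cx cy)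
  then obtain K where "\<forall>s\<in>{0..T}. ?u s \<le> K" by (rule continuous_on_Icc_upper_bound)
  then have K: "?u s \<le> K" if "s \<in> {0..T}" for s using that by blast
  have K0: "K \<ge> 0" using K[OF t] order_trans[OF sum_nonneg] by (metis abs_ge_zero)
  have bound: "\<forall>s\<in>{0..T}. ?u s \<le> K / 2 ^ k * exp (rate * s)" for k
  proof (induction k)
    case 0
    show ?case
    proof
      fix s assume s: "s \<in> {0..T}"
      have "K * 1 \<le> K * exp (rate * s)" using K0 s rate_pos by (intro mult_left_mono) auto
      then show "?u s \<le> K / 2 ^ 0 * exp (rate * s)" using K[OF s] by simp
    qed
  next
    case (Suc k)
    show ?case
    proof
      fix s assume s: "s \<in> {0..T}"
      have "?u s = (\<Sum>i\<in>I. \<bar>integral {0..s} (\<lambda>s. b (x s) i) - integral {0..s} (\<lambda>s. b (y s) i)\<bar>)"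
        using x y s by (intro sum.cong refl) (auto simp: solves_def)
      also have "\<dots> \<le> K / 2 ^ k / 2 * exp (rate * s)"
        using s Suc K0
        by (intro contraction) (auto intro: continuous_on_subset[OF cx] continuous_on_subset[OF cy])
      finally show "?u s \<le> K / 2 ^ Suc k * exp (rate * s)" by (simp add: field_simps)
    qed
  qed
  note half_power_tendsto_zero[of "K * exp (rate * t)"]
  moreover have "?u t \<le> K * exp (rate * t) * (1 / 2) ^ k" for k
    using bound[of k] t by (simp add: power_one_over field_simps)
  ultimately have "?u t \<le> 0" by (intro LIMSEQ_le_const) auto
  then have "\<bar>x t i - y t i\<bar> \<le> 0"
    using i member_le_sum[of i I "\<lambda>j. \<bar>x t j - y t j\<bar>"] finite_I by auto
  then show ?thesis by simp
qed

context
  fixes w :: "real \<Rightarrow> 'i \<Rightarrow> real"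
  assumes w: "\<And>i. i \<in> I \<Longrightarrow> continuous_on {0..} (\<lambda>t. w t i)"
begin

lemma continuous_on_picard: "i \<in> I \<Longrightarrow> continuous_on {0..T} (\<lambda>t. picard w k t i)"
proof (induction k arbitrary: i)
  case 0
  then show ?case by (auto intro: continuous_on_subset[OF w])
next
  case (Suc k)
  have "continuous_on {0..T} (\<lambda>t. w t i)" by (rule continuous_on_subset[OF w]) (use Suc.prems in auto)
  with Suc show ?case
    by (auto intro!: continuous_intros indefinite_integral_continuous_1
          integrable_continuous_interval continuous_on_drift)
qed

lemma picard_step:
  assumes "t \<ge> 0"
  shows "(\<Sum>i\<in>I. \<bar>picard w (Suc k) t i - picard w k t i\<bar>)
    \<le> (real (card I) * \<bar>B\<bar> / rate) / 2 ^ k * exp (rate * t)"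
  using assms
proof (induction k arbitrary: t)
  case 0
  have "\<bar>picard w (Suc 0) t i - picard w 0 t i\<bar> \<le> \<bar>B\<bar> * t" if i: "i \<in> I" for i
  proof -
    have "norm (integral {0..t} (\<lambda>s. b (w s) i)) \<le> \<bar>B\<bar> * (t - 0)"
      by (rule integral_bound[OF 0])
        (auto intro!: continuous_on_drift i continuous_on_subset[OF w] intro: order_trans[OF bounded[OF i]])
    then show ?thesis by simp
  qed
  then have "(\<Sum>i\<in>I. \<bar>picard w (Suc 0) t i - picard w 0 t i\<bar>) \<le> real (card I) * (\<bar>B\<bar> * t)"
    using sum_bounded_above[of I "\<lambda>i. \<bar>picard w (Suc 0) t i - picard w 0 t i\<bar>" "\<bar>B\<bar> * t"] by simp
  \<comment> \<open>Linear growth in \<open>t\<close> is absorbed into the exponential weight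
    through \<open>rate * t \<le> exp (rate * t)\<close>; this is where the constant of the
    statement comes from.\<close>
  also have "\<dots> = (real (card I) * \<bar>B\<bar> / rate) * (rate * t)"
    using rate_pos by simp
  also have "\<dots> \<le> (real (card I) * \<bar>B\<bar> / rate) * exp (rate * t)"
    using rate_pos exp_ge_add_one_self[of "rate * t"] by (intro mult_left_mono) (linarith, auto)
  finally show ?case by simp
next
  case (Suc k)
  have "(\<Sum>i\<in>I. \<bar>picard w (Suc (Suc k)) t i - picard w (Suc k) t i\<bar>) =
    (\<Sum>i\<in>I. \<bar>integral {0..t} (\<lambda>s. b (picard w (Suc k) s) i) - integral {0..t} (\<lambda>s. b (picard w k s) i)\<bar>)"
    by simp
  also have "\<dots> \<le> (real (card I) * \<bar>B\<bar> / rate) / 2 ^ k / 2 * exp (rate * t)"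
    using Suc.prems rate_pos
    by (intro contraction continuous_on_picard Suc.IH) auto
  finally show ?case by (simp add: field_simps)
qed

lemma
  assumes "t \<ge> 0" "i \<in> I"
  shows picard_tendsto: "(\<lambda>k. picard w k t i) \<longlonglongrightarrow> solution w t i"
    and picard_error: "\<bar>picard w k t i - solution w t i\<bar>
          \<le> 2 * (real (card I) * \<bar>B\<bar> / rate * exp (rate * t)) / 2 ^ k"
proof -
  have *: "\<bar>picard w (Suc k) t i - picard w k t i\<bar> \<le> (real (card I) * \<bar>B\<bar> / rate * exp (rate * t)) / 2 ^ k" for k
  proof -
    have "\<bar>picard w (Suc k) t i - picard w k t i\<bar> \<le> (\<Sum>i\<in>I. \<bar>picard w (Suc k) t i - picard w k t i\<bar>)"
      using assms finite_I by (intro member_le_sum) auto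
    also note picard_step[OF assms(1), of k]
    finally show ?thesis by (simp add: field_simps)
  qed
  from geometric_cauchy_limit[OF *, folded solution_def]
  show "(\<lambda>k. picard w k t i) \<longlonglongrightarrow> solution w t i"
    "\<bar>picard w k t i - solution w t i\<bar> \<le> 2 * (real (card I) * \<bar>B\<bar> / rate * exp (rate * t)) / 2 ^ k"
    by auto
qed

lemma continuous_on_solution:
  assumes i: "i \<in> I"
  shows "continuous_on {0..T} (\<lambda>t. solution w t i)"
proof (rule uniform_limit_theorem)
  show "uniform_limit {0..T} (\<lambda>k t. picard w k t i) (\<lambda>t. solution w t i) sequentially"
  proof (rule uniform_limitI)
    fix e :: real assume "e > 0"
    let ?K = "2 * (real (card I) * \<bar>B\<bar> / rate * exp (rate * T))"
    have "\<forall>\<^sub>F k in sequentially. ?K * (1 / 2) ^ k < e"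
      by (rule order_tendstoD(2)[OF half_power_tendsto_zero \<open>e > 0\<close>])
    then show "\<forall>\<^sub>F k in sequentially. \<forall>t\<in>{0..T}. dist (picard w k t i) (solution w t i) < e"
    proof (eventually_elim, intro ballI)
      fix k t assume k: "?K * (1 / 2) ^ k < e" and t: "t \<in> {0..T}"
      have "\<bar>picard w k t i - solution w t i\<bar>
          \<le> 2 * (real (card I) * \<bar>B\<bar> / rate * exp (rate * t)) / 2 ^ k"
        using t i by (intro picard_error) auto
      also have "\<dots> \<le> ?K / 2 ^ k"
        using t rate_pos by (intro divide_right_mono mult_left_mono) auto
      also have "\<dots> < e" using k by (simp add: power_one_over field_simps)
      finally show "dist (picard w k t i) (solution w t i) < e" by (simp add: dist_real_def)
    qed
  qed
qed (auto intro!: always_eventually continuous_on_picard i)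

theorem solves_solution: "solves w T (solution w)"
  unfolding solves_def
proof (intro conjI ballI continuous_on_solution)
  fix i t assume i: "i \<in> I" and t: "t \<in> {0..T}"
  let ?J = "\<lambda>k i. integral {0..t} (\<lambda>s. b (picard w k s) i) - integral {0..t} (\<lambda>s. b (solution w s) i)"
  let ?K = "real (card I) * (2 * (real (card I) * \<bar>B\<bar> / rate))"
  have "(\<Sum>j\<in>I. \<bar>picard w k s j - solution w s j\<bar>) \<le> (?K / 2 ^ k) * exp (rate * s)" if "s \<in> {0..t}" for s k
  proof -
    have "(\<Sum>j\<in>I. \<bar>picard w k s j - solution w s j\<bar>)
        \<le> real (card I) * (2 * (real (card I) * \<bar>B\<bar> / rate * exp (rate * s)) / 2 ^ k)"
      using that by (intro sum_bounded_above picard_error) auto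
    then show ?thesis by (simp add: field_simps)
  qed
  \<comment> \<open>Contraction applied to an iterate and the limit itself lets the integral
    equation pass to the limit.\<close>
  then have *: "(\<Sum>i\<in>I. \<bar>?J k i\<bar>) \<le> (?K / 2 ^ k) / 2 * exp (rate * t)" for k
    using t rate_pos by (intro contraction continuous_on_picard continuous_on_solution) auto
  have "(\<lambda>k. ?J k i) \<longlonglongrightarrow> 0"
  proof (rule Lim_null_comparison[OF _ half_power_tendsto_zero], intro always_eventually allI)
    fix k
    have "\<bar>?J k i\<bar> \<le> (\<Sum>i\<in>I. \<bar>?J k i\<bar>)"
      using i finite_I by (intro member_le_sum[of i I "\<lambda>i. \<bar>?J k i\<bar>"]) auto
    also note *[of k]
    finally show "norm (?J k i) \<le> ?K / 2 * exp (rate * t) * (1 / 2) ^ k" by (simp add: power_one_over field_simps)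
  qed
  then have "(\<lambda>k. picard w (Suc k) t i) \<longlonglongrightarrow> w t i + integral {0..t} (\<lambda>s. b (solution w s) i)"
    by (auto intro!: tendsto_intros simp: LIM_zero_iff)
  moreover have "(\<lambda>k. picard w (Suc k) t i) \<longlonglongrightarrow> solution w t i"
    using t i by (intro LIMSEQ_Suc picard_tendsto) auto
  ultimately show "solution w t i = w t i + integral {0..t} (\<lambda>s. b (solution w s) i)"
    using LIMSEQ_unique by blast
qed

end

end

section \<open>Algebra of the log gas and non-explosion\<close>

definition pairs :: "nat \<Rightarrow> (nat \<times> nat) set" where
  "pairs N = {(i, j). i \<in> {1..N} \<and> j \<in> {1..N} \<and> i < j}"

lemma finite_pairs [simp]: "finite (pairs N)"
  by (rule finite_subset[of _ "{1..N} \<times> {1..N}"]) (auto simp: pairs_def)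

lemma card_pairs_le: "real (card (pairs N)) \<le> real N * real N"
proof -
  have "card (pairs N) \<le> card ({1..N} \<times> {1..N})"
    by (rule card_mono) (auto simp: pairs_def)
  then show ?thesis by (simp flip: of_nat_mult)
qed

lemma sum_offdiag_eq_sum_pairs:
  fixes g :: "nat \<Rightarrow> nat \<Rightarrow> real"
  shows "(\<Sum>i\<in>{1..N}. \<Sum>j\<in>{1..N} - {i}. g i j) = (\<Sum>(i, j)\<in>pairs N. g i j + g j i)"
proof -
  let ?Q = "(\<lambda>(i, j). (j, i)) ` pairs N"
  have "(\<Sum>i\<in>{1..N}. \<Sum>j\<in>{1..N} - {i}. g i j) = (\<Sum>(i, j)\<in>(SIGMA i:{1..N}. {1..N} - {i}). g i j)"
    by (rule sum.Sigma) auto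
  also have "(SIGMA i:{1..N}. {1..N} - {i}) = pairs N \<union> ?Q"
    by (auto simp: pairs_def image_iff)
  also have "(\<Sum>(i, j)\<in>pairs N \<union> ?Q. g i j) = (\<Sum>(i, j)\<in>pairs N. g i j) + (\<Sum>(i, j)\<in>?Q. g i j)"
    by (rule sum.union_disjoint) (simp_all, auto simp: pairs_def)
  also have "(\<Sum>(i, j)\<in>?Q. g i j) = (\<Sum>(i, j)\<in>pairs N. g j i)"
    by (subst sum.reindex) (auto simp: inj_on_def case_prod_unfold)
  finally show ?thesis by (simp add: sum.distrib case_prod_unfold)
qed

text \<open>Action equals reaction: antisymmetric forces tested against \<open>z\<close> see only
  the differences of \<open>z\<close>. This serves the exact repulsion in the generator and the
  truncated repulsion in the energy estimate.\<close>

lemma sum_antisym_eq_sum_pairs: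
  fixes r :: "nat \<Rightarrow> nat \<Rightarrow> real"
  assumes "\<And>i j. r i j = - r j i"
  shows "(\<Sum>i\<in>{1..N}. z i * (\<Sum>j\<in>{1..N} - {i}. r i j)) = (\<Sum>(i, j)\<in>pairs N. (z j - z i) * r j i)"
proof -
  have "z i * r i j + z j * r j i = (z j - z i) * r j i" for i j
    using assms[of i j] by (simp add: algebra_simps)
  then show ?thesis
    using sum_offdiag_eq_sum_pairs[of "\<lambda>i j. z i * r i j" N] by (simp add: sum_distrib_left)
qed

text \<open>
  The triples of distinct indices drop out of the sum of squares because
  \<open>1 / ((a - b) (a - c)) + 1 / ((b - c) (b - a)) + 1 / ((c - a) (c - b)) = 0\<close>. The junk value
  \<open>1 / 0 = 0\<close> takes care of coinciding indices.
\<close>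

lemma sum_square_coulomb:
  fixes x :: "nat \<Rightarrow> real"
  assumes "inj_on x {1..N}"
  shows "(\<Sum>i\<in>{1..N}. (\<Sum>j\<in>{1..N} - {i}. 1 / (x i - x j))\<^sup>2) = 2 * (\<Sum>(i, j)\<in>pairs N. 1 / (x j - x i)\<^sup>2)"
proof -
  let ?I = "{1..N}"
  define r where "r = (\<lambda>i j. 1 / (x i - x j))"
  have r_diag [simp]: "r i i = 0" for i by (simp add: r_def)
  have r_sym: "(r i j)\<^sup>2 = (r j i)\<^sup>2" for i j by (simp add: r_def power2_commute power_divide)
  have S: "(\<Sum>j\<in>?I - {i}. r i j) = (\<Sum>j\<in>?I. r i j)" if "i \<in> ?I" for i
    using that by (simp add: sum.remove)
  let ?T = "\<Sum>i\<in>?I. \<Sum>j\<in>?I. \<Sum>k\<in>?I. r i j * r i k"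
  have "(\<Sum>i\<in>?I. (\<Sum>j\<in>?I - {i}. r i j)\<^sup>2) = ?T"
    by (intro sum.cong refl) (simp only: S power2_eq_square sum_product)
  \<comment> \<open>Averaging over the cyclic rotations of \<open>(i, j, k)\<close> brings the
    summand into the form of the three-term identity, which can then be applied to each triple
    separately.\<close>
  moreover have "3 * ?T = 3 * (\<Sum>i\<in>?I. \<Sum>j\<in>?I. (r i j)\<^sup>2)"
  proof -
    have rot: "(\<Sum>i\<in>?I. \<Sum>j\<in>?I. \<Sum>k\<in>?I. g i j k) = (\<Sum>i\<in>?I. \<Sum>j\<in>?I. \<Sum>k\<in>?I. g j k i)"
      for g :: "nat \<Rightarrow> nat \<Rightarrow> nat \<Rightarrow> real"
    proof -
      have "(\<Sum>i\<in>?I. \<Sum>j\<in>?I. \<Sum>k\<in>?I. g j k i) = (\<Sum>j\<in>?I. \<Sum>i\<in>?I. \<Sum>k\<in>?I. g j k i)"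
        by (rule sum.swap)
      also have "\<dots> = (\<Sum>j\<in>?I. \<Sum>k\<in>?I. \<Sum>i\<in>?I. g j k i)"
        by (intro sum.cong refl sum.swap)
      finally show ?thesis by simp
    qed
    have dist: "r i j * r i k + r j k * r j i + r k i * r k j
        = (if k = j then (r i j)\<^sup>2 else 0) + (if i = k then (r j k)\<^sup>2 else 0) + (if j = i then (r k i)\<^sup>2 else 0)"
      if "i \<in> ?I" "j \<in> ?I" "k \<in> ?I" for i j k
    proof (cases "i = j \<or> j = k \<or> i = k")
      case True
      then show ?thesis by (auto simp: r_def power2_eq_square field_simps)
    next
      case False
      then have "x i - x j \<noteq> 0" "x j - x k \<noteq> 0" "x k - x i \<noteq> 0"
        using that assms by (auto dest: inj_onD)
      then have "1 / (x i - x j) * (1 / (x i - x k)) + 1 / (x j - x k) * (1 / (x j - x i))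
          + 1 / (x k - x i) * (1 / (x k - x j)) = 0"
        by (simp add: divide_simps) (simp add: algebra_simps)
      then show ?thesis using False by (simp add: r_def)
    qed
    have "3 * ?T = (\<Sum>i\<in>?I. \<Sum>j\<in>?I. \<Sum>k\<in>?I. r i j * r i k + r j k * r j i + r k i * r k j)"
      using rot[of "\<lambda>i j k. r i j * r i k"] rot[of "\<lambda>i j k. r j k * r j i"]
      by (simp add: sum.distrib)
    also have "\<dots> = (\<Sum>i\<in>?I. \<Sum>j\<in>?I. \<Sum>k\<in>?I.
        (if k = j then (r i j)\<^sup>2 else 0) + (if i = k then (r j k)\<^sup>2 else 0) + (if j = i then (r k i)\<^sup>2 else 0))"
      by (intro sum.cong refl dist)
    also have "\<dots> = 3 * (\<Sum>i\<in>?I. \<Sum>j\<in>?I. \<Sum>k\<in>?I. if k = j then (r i j)\<^sup>2 else 0)"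
      using rot[of "\<lambda>i j k. if k = j then (r i j)\<^sup>2 else 0"] rot[of "\<lambda>i j k. if i = k then (r j k)\<^sup>2 else 0"]
      by (simp only: sum.distrib)
    also have "\<dots> = 3 * (\<Sum>i\<in>?I. \<Sum>j\<in>?I. (r i j)\<^sup>2)"
      by (simp add: sum.delta)
    finally show ?thesis .
  qed
  moreover have "(\<Sum>i\<in>?I. \<Sum>j\<in>?I. (r i j)\<^sup>2) = (\<Sum>i\<in>?I. \<Sum>j\<in>?I - {i}. (r i j)\<^sup>2)"
  proof (rule sum.cong[OF refl])
    fix i assume "i \<in> ?I"
    then show "(\<Sum>j\<in>?I. (r i j)\<^sup>2) = (\<Sum>j\<in>?I - {i}. (r i j)\<^sup>2)"
      using sum.remove[of ?I i "\<lambda>j. (r i j)\<^sup>2"] by simp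
  qed
  moreover have "\<dots> = 2 * (\<Sum>(i, j)\<in>pairs N. (r j i)\<^sup>2)"
    unfolding sum_offdiag_eq_sum_pairs sum_distrib_left
    by (intro sum.cong refl) (auto simp: r_sym)
  ultimately show ?thesis by (simp add: r_def power_divide)
qed

text \<open>
  The generator of the Dyson process applied to \<open>- (\<Sum>i<j. ln (x j - x i))\<close>: the second-order
  term \<open>1 / (\<beta> N)\<close> is dominated by the repulsion \<open>1 / N\<close> exactly when \<open>\<beta> \<ge> 1\<close>.
\<close>

lemma generator_log_gap_le:
  assumes "N \<ge> 1" "\<beta> \<ge> 1" and x: "\<And>i j. (i, j) \<in> pairs N \<Longrightarrow> x i < x j"
    and K: "\<And>i j. (i, j) \<in> pairs N \<Longrightarrow> \<bar>deriv V (x j) - deriv V (x i)\<bar> \<le> K * (x j - x i)"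
  shows "(\<Sum>(i, j)\<in>pairs N. 2 / (\<beta> * real N) / (x j - x i)\<^sup>2
      - (dyson_drift N V x j - dyson_drift N V x i) / (x j - x i)) \<le> K / 2 * real (card (pairs N))"
proof -
  let ?S = "\<lambda>i. \<Sum>j\<in>{1..N} - {i}. 1 / (x i - x j)" and ?v = "deriv V"
  let ?Q = "\<Sum>(i, j)\<in>pairs N. 1 / (x j - x i)\<^sup>2"
  have inj: "inj_on x {1..N}"
  proof (rule linorder_inj_onI')
    fix i j assume "i \<in> {1..N}" "j \<in> {1..N}" "i < j"
    then show "x i \<noteq> x j" using x[of i j] by (auto simp: pairs_def)
  qed
  have asym: "1 / (x i - x j) = - (1 / (x j - x i))" for i j
    by (metis minus_diff_eq minus_divide_right)
  have "(\<Sum>(i, j)\<in>pairs N. (dyson_drift N V x j - dyson_drift N V x i) / (x j - x i))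
      = (\<Sum>i\<in>{1..N}. dyson_drift N V x i * ?S i)"
    using sum_antisym_eq_sum_pairs[of "\<lambda>i j. 1 / (x i - x j)" "dyson_drift N V x" N, OF asym] by simp
  also have "\<dots> = (\<Sum>i\<in>{1..N}. 1 / real N * (?S i)\<^sup>2 - 1 / 2 * (?v (x i) * ?S i))"
    by (intro sum.cong refl) (simp add: dyson_drift_def power2_eq_square algebra_simps)
  also have "\<dots> = 1 / real N * (\<Sum>i\<in>{1..N}. (?S i)\<^sup>2) - 1 / 2 * (\<Sum>i\<in>{1..N}. ?v (x i) * ?S i)"
    by (simp only: sum_subtractf sum_distrib_left)
  also have "(\<Sum>i\<in>{1..N}. ?v (x i) * ?S i) = (\<Sum>(i, j)\<in>pairs N. (?v (x j) - ?v (x i)) / (x j - x i))"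
    using sum_antisym_eq_sum_pairs[of "\<lambda>i j. 1 / (x i - x j)" "\<lambda>i. ?v (x i)" N, OF asym] by simp
  also note sum_square_coulomb[OF inj]
  finally have drift: "(\<Sum>(i, j)\<in>pairs N. (dyson_drift N V x j - dyson_drift N V x i) / (x j - x i))
      = 2 / real N * ?Q - 1 / 2 * (\<Sum>(i, j)\<in>pairs N. (?v (x j) - ?v (x i)) / (x j - x i))"
    by simp
  have "(\<Sum>(i, j)\<in>pairs N. (?v (x j) - ?v (x i)) / (x j - x i)) \<le> real (card (pairs N)) * K"
  proof (rule sum_bounded_above, clarify)
    fix i j assume ij: "(i, j) \<in> pairs N"
    show "(?v (x j) - ?v (x i)) / (x j - x i) \<le> K"
      using x[OF ij] K[OF ij] by (simp add: divide_le_eq)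
  qed
  moreover have "2 / (\<beta> * real N) * ?Q \<le> 2 / real N * ?Q"
    using assms(1,2) by (intro mult_right_mono sum_nonneg divide_left_mono) auto
  moreover have "(\<Sum>(i, j)\<in>pairs N. 2 / (\<beta> * real N) / (x j - x i)\<^sup>2
      - (dyson_drift N V x j - dyson_drift N V x i) / (x j - x i))
     = 2 / (\<beta> * real N) * ?Q - (\<Sum>(i, j)\<in>pairs N. (dyson_drift N V x j - dyson_drift N V x i) / (x j - x i))"
    by (simp add: sum_subtractf sum_distrib_left case_prod_unfold)
  ultimately show ?thesis using drift by (simp add: mult.commute)
qed

section \<open>Truncation of the drift\<close>

definition clip :: "real \<Rightarrow> real \<Rightarrow> real" where
  "clip r u = max (- r) (min r u)"

text \<open>The direction of the force is read off the indices, not the positions. The force thus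
  stays continuous when two particles meet or exchange their order, it remains antisymmetric, and it
  is nonincreasing in the signed gap.\<close>

definition repulsion :: "real \<Rightarrow> (nat \<Rightarrow> real) \<Rightarrow> nat \<Rightarrow> nat \<Rightarrow> real" where
  "repulsion r x i j =
     (if j < i then 1 / max (x i - x j) (1 / r) else if i < j then - (1 / max (x j - x i) (1 / r)) else 0)"

definition trunc_drift :: "nat \<Rightarrow> (real \<Rightarrow> real) \<Rightarrow> real \<Rightarrow> (nat \<Rightarrow> real) \<Rightarrow> nat \<Rightarrow> real" where
  "trunc_drift N V r x i =
     1 / real N * (\<Sum>j\<in>{1..N} - {i}. repulsion r x i j) - 1 / 2 * deriv V (clip r (x i))"

definition good_region :: "nat \<Rightarrow> real \<Rightarrow> (nat \<Rightarrow> real) \<Rightarrow> bool" where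
  "good_region N r x \<longleftrightarrow> (\<forall>i\<in>{1..N}. \<bar>x i\<bar> \<le> r) \<and> (\<forall>(i, j)\<in>pairs N. 1 / r \<le> x j - x i)"

lemma repulsion_antisym: "repulsion r x i j = - repulsion r x j i"
  by (simp add: repulsion_def)

lemma trunc_drift_eq_dyson_drift:
  assumes "good_region N r x" "i \<in> {1..N}"
  shows "trunc_drift N V r x i = dyson_drift N V x i"
proof -
  have "repulsion r x i j = 1 / (x i - x j)" if "j \<in> {1..N} - {i}" for j
  proof (cases "j < i")
    case True
    then have "1 / r \<le> x i - x j" using assms that by (auto simp: good_region_def pairs_def)
    then show ?thesis using True by (simp add: repulsion_def max_def)
  next
    case False
    then have "i < j" using that by auto
    then have "1 / r \<le> x j - x i" using assms that by (auto simp: good_region_def pairs_def)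
    then have "repulsion r x i j = - (1 / (x j - x i))" using \<open>i < j\<close> by (simp add: repulsion_def max_def)
    also have "\<dots> = 1 / (x i - x j)" by (metis minus_diff_eq minus_divide_right)
    finally show ?thesis .
  qed
  moreover have "\<bar>x i\<bar> \<le> r" using assms by (auto simp: good_region_def)
  then have "clip r (x i) = x i" by (auto simp: clip_def)
  ultimately show ?thesis by (simp add: trunc_drift_def dyson_drift_def)
qed

lemma inverse_max_lipschitz:
  fixes a c e :: real
  assumes "e > 0"
  shows "\<bar>1 / max a e - 1 / max c e\<bar> \<le> \<bar>a - c\<bar> / e\<^sup>2"
proof -
  have pos: "max a e > 0" "max c e > 0" using assms by auto
  have "\<bar>1 / max a e - 1 / max c e\<bar> = \<bar>max c e - max a e\<bar> / (max a e * max c e)"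
    using pos by (simp add: diff_frac_eq abs_mult)
  also have "\<dots> \<le> \<bar>a - c\<bar> / (e * e)"
    using assms by (intro frac_le mult_mono) auto
  finally show ?thesis by (simp add: power2_eq_square)
qed

text \<open>Each truncated repulsion is Lipschitz in its gap with constant \<open>r\<^sup>2\<close>,
  a gap involves two coordinates, and the prefactor \<open>1 / N\<close> pays for summing over the
  partners: this gives \<open>2 * r\<^sup>2\<close>. Clipping does not increase distances, so
  \<open>V'\<close> contributes \<open>K\<close>; its factor 1/2 is given away. The bound adds at
  most \<open>r\<close> from the repulsion to the size of \<open>V'\<close> on the interval of
  radius \<open>r\<close>.\<close>

lemma trunc_drift_lipschitz_drift:
  assumes r: "r > 0" and N: "N \<ge> 1"
    and K: "\<And>a b. \<bar>a\<bar> \<le> r \<Longrightarrow> \<bar>b\<bar> \<le> r \<Longrightarrow> \<bar>deriv V a - deriv V b\<bar> \<le> K * \<bar>a - b\<bar>" and "K \<ge> 0"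
  shows "lipschitz_drift {1..N} (trunc_drift N V r) (2 * r\<^sup>2 + K) (r + \<bar>deriv V 0\<bar> + K * r)"
proof
  have clip: "\<bar>clip r a\<bar> \<le> r" "\<bar>clip r a - clip r b\<bar> \<le> \<bar>a - b\<bar>" for a b :: real using r by (auto simp: clip_def)
  show "finite {1..N}" "2 * r\<^sup>2 + K \<ge> 0" using assms by auto
  fix i and x y :: "nat \<Rightarrow> real" assume i: "i \<in> {1..N}"
  let ?S = "\<Sum>j\<in>{1..N}. \<bar>x j - y j\<bar>"
  have S: "\<bar>x j - y j\<bar> \<le> ?S" if "j \<in> {1..N}" for j
    using that by (intro member_le_sum) auto
  have "\<bar>repulsion r x i j - repulsion r y i j\<bar> \<le> r\<^sup>2 * (2 * ?S)" if "j \<in> {1..N} - {i}" for j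
  proof -
    have "\<bar>repulsion r x i j - repulsion r y i j\<bar> \<le> \<bar>(x i - x j) - (y i - y j)\<bar> / (1 / r)\<^sup>2"
    proof (cases "j < i")
      case True
      then show ?thesis using inverse_max_lipschitz[of "1 / r" "x i - x j" "y i - y j"] r
        by (simp add: repulsion_def)
    next
      case False
      then show ?thesis using inverse_max_lipschitz[of "1 / r" "x j - x i" "y j - y i"] r that
        by (simp add: repulsion_def abs_minus_commute algebra_simps)
    qed
    also have "\<dots> = r\<^sup>2 * \<bar>(x i - x j) - (y i - y j)\<bar>" by (simp add: power_divide)
    also have "\<dots> \<le> r\<^sup>2 * (2 * ?S)" using S[OF i] S[of j] that by (intro mult_left_mono) auto
    finally show ?thesis .
  qed
  then have "(\<Sum>j\<in>{1..N} - {i}. \<bar>repulsion r x i j - repulsion r y i j\<bar>) \<le> real (card ({1..N} - {i})) * (r\<^sup>2 * (2 * ?S))"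
    by (rule sum_bounded_above)
  also have "\<dots> \<le> real N * (r\<^sup>2 * (2 * ?S))"
    using card_mono[of "{1..N}" "{1..N} - {i}"]
    by (intro mult_right_mono mult_nonneg_nonneg sum_nonneg) auto
  finally have sum: "\<bar>(\<Sum>j\<in>{1..N} - {i}. repulsion r x i j) - (\<Sum>j\<in>{1..N} - {i}. repulsion r y i j)\<bar> \<le> real N * (r\<^sup>2 * (2 * ?S))"
    unfolding sum_subtractf[symmetric] by (rule order_trans[OF sum_abs])
  have rep: "\<bar>1 / real N * (\<Sum>j\<in>{1..N} - {i}. repulsion r x i j) - 1 / real N * (\<Sum>j\<in>{1..N} - {i}. repulsion r y i j)\<bar> \<le> 2 * r\<^sup>2 * ?S"
    using sum N unfolding right_diff_distrib[symmetric] abs_mult by (simp add: field_simps)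
  have "\<bar>deriv V (clip r (x i)) - deriv V (clip r (y i))\<bar> \<le> K * \<bar>clip r (x i) - clip r (y i)\<bar>"
    by (intro K clip)
  also have "\<dots> \<le> K * ?S"
    using S[OF i] clip(2)[of "x i" "y i"] \<open>K \<ge> 0\<close> by (intro mult_left_mono) auto
  finally have "\<bar>deriv V (clip r (x i)) - deriv V (clip r (y i))\<bar> \<le> K * ?S" .
  then show "\<bar>trunc_drift N V r x i - trunc_drift N V r y i\<bar> \<le> (2 * r\<^sup>2 + K) * ?S"
    using rep unfolding trunc_drift_def distrib_right by linarith
next
  fix i x assume i: "i \<in> {1..N}"
  have "\<bar>repulsion r x i j\<bar> \<le> r" for j
  proof -
    have "\<bar>1 / max u (1 / r)\<bar> \<le> 1 / (1 / r)" for u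
      unfolding abs_divide abs_one using r by (intro frac_le) auto
    then show ?thesis using r by (auto simp: repulsion_def simp del: abs_divide)
  qed
  then have "(\<Sum>j\<in>{1..N} - {i}. \<bar>repulsion r x i j\<bar>) \<le> real (card ({1..N} - {i})) * r"
    by (intro sum_bounded_above)
  also have "\<dots> \<le> real N * r"
    using card_mono[of "{1..N}" "{1..N} - {i}"] r by (intro mult_right_mono) auto
  finally have "\<bar>\<Sum>j\<in>{1..N} - {i}. repulsion r x i j\<bar> \<le> real N * r"
    by (rule order_trans[OF sum_abs])
  then have rep: "\<bar>1 / real N * (\<Sum>j\<in>{1..N} - {i}. repulsion r x i j)\<bar> \<le> r"
    using N unfolding abs_mult by (simp add: field_simps)
  have "\<bar>deriv V (clip r (x i)) - deriv V 0\<bar> \<le> K * \<bar>clip r (x i) - 0\<bar>"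
    using r by (intro K) (auto simp: clip_def)
  also have "\<dots> \<le> K * r" using r \<open>K \<ge> 0\<close> by (intro mult_left_mono) (auto simp: clip_def)
  finally show "\<bar>trunc_drift N V r x i\<bar> \<le> r + \<bar>deriv V 0\<bar> + K * r"
    using rep unfolding trunc_drift_def by linarith
qed

section \<open>A priori bound uniform in the truncation level\<close>

lemma gronwall_differential:
  fixes e e' :: "real \<Rightarrow> real"
  assumes "C > 0" "T \<ge> 0" and cont: "continuous_on {0..T} e"
    and deriv: "\<And>t. 0 < t \<Longrightarrow> t < T \<Longrightarrow> (e has_real_derivative e' t) (at t)"
    and le: "\<And>t. 0 < t \<Longrightarrow> t < T \<Longrightarrow> e' t \<le> A + C * e t"
  shows "e T \<le> (e 0 + A / C) * exp (C * T) - A / C"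
proof -
  let ?h = "\<lambda>t. exp (- C * t) * (e t + A / C)"
  have "?h T \<le> ?h 0"
  proof (rule DERIV_nonpos_imp_decreasing_open[OF \<open>T \<ge> 0\<close>])
    fix t assume t: "0 < t" "t < T"
    have "(?h has_real_derivative exp (- C * t) * (e' t - (A + C * e t))) (at t)"
      using deriv[OF t] \<open>C > 0\<close> by (auto intro!: derivative_eq_intros simp: field_simps)
    moreover have "exp (- C * t) * (e' t - (A + C * e t)) \<le> 0"
      using le[OF t] by (intro mult_nonneg_nonpos) auto
    ultimately show "\<exists>y. (?h has_real_derivative y) (at t) \<and> y \<le> 0" by blast
  qed (intro continuous_intros cont)
  then have "exp (C * T) * (exp (- C * T) * (e T + A / C)) \<le> exp (C * T) * (e 0 + A / C)"
    by (intro mult_left_mono) auto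
  then show ?thesis
    by (simp add: mult.assoc[symmetric] exp_add[symmetric] mult.commute)
qed

text \<open>The growth condition controls \<open>- u * V' u\<close>, while the energy needs the
  product with \<open>x - y\<close>. For \<open>\<bar>x\<bar> \<le> Q\<close> the bound
  \<open>M\<close> on \<open>V'\<close> suffices, with \<open>\<bar>x - y\<bar> \<le> 2 * Q\<close>.
  Farther out \<open>y\<close> is no larger than \<open>x\<close>, so \<open>x - y\<close> is
  \<open>x\<close> times a factor between 0 and 2, which a one-sided bound survives; the other
  factor 2 in \<open>4 * \<gamma>\<close> comes from
  \<open>1 + u\<^sup>2 \<le> 2 * u\<^sup>2\<close> for \<open>\<bar>u\<bar> \<ge> 1\<close>.\<close>

lemma confinement_le:
  assumes v: "\<And>u. - u * deriv V u \<le> \<gamma> * (1 + \<bar>u\<bar>\<^sup>2)" and "\<gamma> > 0" "r \<ge> 1"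
    and Q: "\<bar>y\<bar> + 1 \<le> Q" and M: "\<And>u. \<bar>u\<bar> \<le> Q \<Longrightarrow> \<bar>deriv V u\<bar> \<le> M"
  shows "(x - y) * (- deriv V (clip r x)) \<le> 2 * Q * M + 4 * \<gamma> * x\<^sup>2"
proof (cases "\<bar>x\<bar> \<le> Q")
  case True
  then have "\<bar>clip r x\<bar> \<le> Q" using \<open>r \<ge> 1\<close> by (auto simp: clip_def)
  have "(x - y) * (- deriv V (clip r x)) \<le> \<bar>x - y\<bar> * \<bar>deriv V (clip r x)\<bar>"
    by (metis abs_ge_self abs_minus_cancel abs_mult)
  also have "\<dots> \<le> (2 * Q) * M"
    using M[OF \<open>\<bar>clip r x\<bar> \<le> Q\<close>] True Q by (intro mult_mono) auto
  finally have "(x - y) * (- deriv V (clip r x)) \<le> 2 * Q * M" .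
  moreover have "4 * \<gamma> * x\<^sup>2 \<ge> 0" using \<open>\<gamma> > 0\<close> by simp
  ultimately show ?thesis by linarith
next
  case False
  then have x: "\<bar>x\<bar> > 1" "\<bar>y\<bar> \<le> \<bar>x\<bar>" "x \<noteq> 0" using Q by auto
  have "\<bar>deriv V 0\<bar> \<le> M" using Q by (intro M) auto
  then have "M \<ge> 0" by linarith
  have *: "- x * deriv V (clip r x) \<le> 2 * \<gamma> * x\<^sup>2"
  proof (cases "\<bar>x\<bar> \<le> r")
    case True
    then have "clip r x = x" by (auto simp: clip_def)
    moreover have "1 \<le> x\<^sup>2" using x(1) by (metis abs_1 abs_le_square_iff less_imp_le one_power2)
    then have "\<gamma> * (1 + x\<^sup>2) \<le> \<gamma> * (2 * x\<^sup>2)" using \<open>\<gamma> > 0\<close> by (intro mult_left_mono) auto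
    ultimately show ?thesis using v[of x] by simp
  next
    case False
    \<comment> \<open>Beyond the cutoff the clipped point is still collinear with \<open>x\<close>,
      so the growth condition at distance \<open>r\<close> is rescaled by
      \<open>\<bar>x\<bar> / r\<close>; the result is again quadratic in \<open>x\<close>, without
      any dependence on \<open>r\<close>.\<close>
    then have c: "x = (\<bar>x\<bar> / r) * clip r x" "\<bar>clip r x\<bar> = r"
      using \<open>r \<ge> 1\<close> by (cases "x > 0"; simp add: clip_def min_def max_def)+
    have "- x * deriv V (clip r x) = (\<bar>x\<bar> / r) * (- clip r x * deriv V (clip r x))"
      by (subst (1) c(1)) simp
    also have "\<dots> \<le> (\<bar>x\<bar> / r) * (\<gamma> * (1 + r\<^sup>2))"
      using v[of "clip r x"] \<open>r \<ge> 1\<close> unfolding c(2) by (intro mult_left_mono) auto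
    also have "\<dots> \<le> (\<bar>x\<bar> / r) * (\<gamma> * (2 * r\<^sup>2))"
      using \<open>r \<ge> 1\<close> \<open>\<gamma> > 0\<close> by (intro mult_left_mono) auto
    also have "\<dots> = 2 * \<gamma> * (\<bar>x\<bar> * r)" using \<open>r \<ge> 1\<close> by (simp add: power2_eq_square)
    also have "\<dots> \<le> 2 * \<gamma> * (\<bar>x\<bar> * \<bar>x\<bar>)" using False \<open>\<gamma> > 0\<close> by (intro mult_left_mono) auto
    finally show ?thesis by (simp add: power2_eq_square)
  qed
  have q: "0 \<le> (x - y) / x" "(x - y) / x \<le> 2"
  proof -
    have "\<bar>y / x\<bar> \<le> 1" using x by (simp add: abs_divide)
    moreover have "(x - y) / x = 1 - y / x" using x by (simp add: diff_divide_distrib)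
    ultimately show "0 \<le> (x - y) / x" "(x - y) / x \<le> 2" by linarith+
  qed
  have "(x - y) * (- deriv V (clip r x)) = (x - y) / x * (- x * deriv V (clip r x))"
    using x by simp
  also have "\<dots> \<le> (x - y) / x * (2 * \<gamma> * x\<^sup>2)" by (rule mult_left_mono[OF * q(1)])
  also have "\<dots> \<le> 2 * (2 * \<gamma> * x\<^sup>2)" using q(2) \<open>\<gamma> > 0\<close> by (intro mult_right_mono) auto
  finally have "(x - y) * (- deriv V (clip r x)) \<le> 2 * (2 * \<gamma> * x\<^sup>2)" .
  moreover have "2 * Q * M \<ge> 0" using \<open>M \<ge> 0\<close> Q by simp
  ultimately show ?thesis by linarith
qed

text \<open>
  Monotonicity of the repulsion: comparing with an ordered reference point \<open>y\<close> of gaps at least \<open>1\<close>,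
  each pair contributes at most \<open>1\<close>, whatever the truncation level.
\<close>

lemma energy_drift_le:
  assumes v: "\<And>u. - u * deriv V u \<le> \<gamma> * (1 + \<bar>u\<bar>\<^sup>2)" and "\<gamma> > 0" "r \<ge> 1" "N \<ge> 1"
    and Q: "\<And>i. i \<in> {1..N} \<Longrightarrow> \<bar>y i\<bar> + 1 \<le> Q" and M: "\<And>u. \<bar>u\<bar> \<le> Q \<Longrightarrow> \<bar>deriv V u\<bar> \<le> M"
    and y: "\<And>i j. (i, j) \<in> pairs N \<Longrightarrow> y j - y i \<ge> 1"
  shows "(\<Sum>i\<in>{1..N}. 2 * (x i - y i) * trunc_drift N V r x i)
     \<le> (2 * real N + real N * (2 * Q * M + 8 * \<gamma> * Q\<^sup>2)) + 8 * \<gamma> * (\<Sum>i\<in>{1..N}. (x i - y i)\<^sup>2)"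
proof -
  have "(\<Sum>i\<in>{1..N}. (x i - y i) * (\<Sum>j\<in>{1..N} - {i}. repulsion r x i j))
      = (\<Sum>(i, j)\<in>pairs N. ((x j - y j) - (x i - y i)) * repulsion r x j i)"
    by (rule sum_antisym_eq_sum_pairs) (rule repulsion_antisym)
  also have "\<dots> \<le> real (card (pairs N)) * 1"
  proof (rule sum_bounded_above, clarify)
    fix i j assume ij: "(i, j) \<in> pairs N"
    let ?g = "x j - x i" and ?h = "y j - y i"
    have rep: "repulsion r x j i = 1 / max ?g (1 / r)" using ij by (auto simp: repulsion_def pairs_def)
    have h: "?h \<ge> 1" by (rule y[OF ij])
    have m: "max ?g (1 / r) > 0" using \<open>r \<ge> 1\<close> by (intro max.strict_coboundedI2) auto
    have "?g - ?h \<le> max ?g (1 / r)" using h by linarith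
    then have "(?g - ?h) / max ?g (1 / r) \<le> 1" using m by (simp add: divide_le_eq)
    then show "((x j - y j) - (x i - y i)) * repulsion r x j i \<le> 1"
      by (simp add: rep algebra_simps)
  qed
  also have "\<dots> \<le> real N * real N" using card_pairs_le by simp
  finally have rep: "(\<Sum>i\<in>{1..N}. (x i - y i) * (\<Sum>j\<in>{1..N} - {i}. repulsion r x i j)) \<le> real N * real N" .
  have "(x i - y i) * (- deriv V (clip r (x i))) \<le> (2 * Q * M + 8 * \<gamma> * Q\<^sup>2) + 8 * \<gamma> * (x i - y i)\<^sup>2"
    if i: "i \<in> {1..N}" for i
  proof -
    have "(x i - y i) * (- deriv V (clip r (x i))) \<le> 2 * Q * M + 4 * \<gamma> * (x i)\<^sup>2"
      by (rule confinement_le[OF v]) (use assms Q[OF i] in auto)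
    \<comment> \<open>The right side minus the left side is the square of
      \<open>x i - 2 * y i\<close>.\<close>
    moreover have "(x i)\<^sup>2 \<le> 2 * (x i - y i)\<^sup>2 + 2 * (y i)\<^sup>2"
      using zero_le_power2[of "x i - 2 * y i"] by (simp add: power2_eq_square algebra_simps)
    moreover have "(y i)\<^sup>2 \<le> Q\<^sup>2" using Q[OF i] by (intro power2_le_iff_abs_le[THEN iffD2]) auto
    ultimately have "(x i)\<^sup>2 \<le> 2 * (x i - y i)\<^sup>2 + 2 * Q\<^sup>2" by linarith
    then have "4 * \<gamma> * (x i)\<^sup>2 \<le> 4 * \<gamma> * (2 * (x i - y i)\<^sup>2 + 2 * Q\<^sup>2)"
      using \<open>\<gamma> > 0\<close> by (intro mult_left_mono) auto
    then show ?thesis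
      using \<open>(x i - y i) * (- deriv V (clip r (x i))) \<le> 2 * Q * M + 4 * \<gamma> * (x i)\<^sup>2\<close>
      by (simp add: algebra_simps)
  qed
  then have conf: "(\<Sum>i\<in>{1..N}. (x i - y i) * (- deriv V (clip r (x i))))
      \<le> (\<Sum>i\<in>{1..N}. (2 * Q * M + 8 * \<gamma> * Q\<^sup>2) + 8 * \<gamma> * (x i - y i)\<^sup>2)"
    by (intro sum_mono)
  have "(\<Sum>i\<in>{1..N}. 2 * (x i - y i) * trunc_drift N V r x i)
      = (\<Sum>i\<in>{1..N}. 2 / real N * ((x i - y i) * (\<Sum>j\<in>{1..N} - {i}. repulsion r x i j))
          + (x i - y i) * (- deriv V (clip r (x i))))"
  proof -
    have "2 * z * (1 / real N * S - 1 / 2 * u) = 2 / real N * (z * S) + z * (- u)" for z S u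
      by (simp add: algebra_simps)
    then show ?thesis unfolding trunc_drift_def by (intro sum.cong refl)
  qed
  also have "\<dots> = 2 / real N * (\<Sum>i\<in>{1..N}. (x i - y i) * (\<Sum>j\<in>{1..N} - {i}. repulsion r x i j))
      + (\<Sum>i\<in>{1..N}. (x i - y i) * (- deriv V (clip r (x i))))"
    by (simp only: sum.distrib sum_distrib_left)
  also have "\<dots> \<le> 2 / real N * (real N * real N)
      + (\<Sum>i\<in>{1..N}. (2 * Q * M + 8 * \<gamma> * Q\<^sup>2) + 8 * \<gamma> * (x i - y i)\<^sup>2)"
    by (intro add_mono mult_left_mono rep conf) auto
  also have "\<dots> = (2 * real N + real N * (2 * Q * M + 8 * \<gamma> * Q\<^sup>2)) + 8 * \<gamma> * (\<Sum>i\<in>{1..N}. (x i - y i)\<^sup>2)"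
    by (simp add: sum.distrib sum_distrib_left)
  finally show ?thesis .
qed

abbreviation trunc_solves ::
  "nat \<Rightarrow> (real \<Rightarrow> real) \<Rightarrow> real \<Rightarrow> (real \<Rightarrow> nat \<Rightarrow> real) \<Rightarrow> real \<Rightarrow> (real \<Rightarrow> nat \<Rightarrow> real) \<Rightarrow> bool" where
  "trunc_solves N V r \<equiv> lipschitz_drift.solves {1..N} (trunc_drift N V r)"

abbreviation trunc_lipschitz :: "nat \<Rightarrow> (real \<Rightarrow> real) \<Rightarrow> real \<Rightarrow> real \<Rightarrow> real \<Rightarrow> bool" where
  "trunc_lipschitz N V r \<equiv> lipschitz_drift {1..N} (trunc_drift N V r)"

text \<open>\<open>R\<close> is chosen before the level \<open>r\<close> and the solution
  \<open>x\<close>. The reference \<open>y\<close> moves with the driving path, so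
  \<open>z = x - y\<close> is a time integral of the drift and differentiable although
  \<open>w\<close> is only continuous; Gronwall's lemma then applies to the squared norm of
  \<open>z\<close>.\<close>

theorem no_explosion:
  fixes w :: "real \<Rightarrow> nat \<Rightarrow> real"
  assumes v: "\<And>u. - u * deriv V u \<le> \<gamma> * (1 + \<bar>u\<bar>\<^sup>2)" and "\<gamma> > 0" "N \<ge> 1" "T \<ge> 0"
    and lip: "\<And>r. r > 0 \<Longrightarrow> \<exists>K\<ge>0. \<forall>a b. \<bar>a\<bar> \<le> r \<and> \<bar>b\<bar> \<le> r \<longrightarrow> \<bar>deriv V a - deriv V b\<bar> \<le> K * \<bar>a - b\<bar>"
    and w: "\<And>i. i \<in> {1..N} \<Longrightarrow> continuous_on {0..T} (\<lambda>t. w t i)"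
  shows "\<exists>R. \<forall>r x t i. r \<ge> 1 \<longrightarrow> trunc_solves N V r w T x \<longrightarrow>
           t \<in> {0..T} \<longrightarrow> i \<in> {1..N} \<longrightarrow> \<bar>x t i\<bar> \<le> R"
proof -
  let ?u = "\<lambda>s. \<Sum>j\<in>{1..N}. \<bar>w s j\<bar>"
  have "continuous_on {0..T} ?u" by (intro continuous_intros w)
  then obtain D where D: "\<forall>s\<in>{0..T}. ?u s \<le> D" by (rule continuous_on_Icc_upper_bound)
  have wD: "\<bar>w t i\<bar> \<le> D" if "t \<in> {0..T}" "i \<in> {1..N}" for t i
    using member_le_sum[of i "{1..N}" "\<lambda>j. \<bar>w t j\<bar>"] D that by force
  have "D \<ge> 0" using wD[of 0 1] \<open>T \<ge> 0\<close> \<open>N \<ge> 1\<close> by force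
  \<comment> \<open>Two coordinates of the driving path can together close a gap by at most
    \<open>2 * D\<close>, which leaves the reference points at mutual distance at least 1.\<close>
  define l where "l = 1 + 2 * D"
  define Q where "Q = l * real N + D + 1"
  have "l \<ge> 1" using \<open>D \<ge> 0\<close> by (simp add: l_def)
  have "Q > 0" using \<open>l \<ge> 1\<close> \<open>D \<ge> 0\<close> by (simp add: Q_def add_nonneg_pos)
  obtain K where K: "K \<ge> 0" "\<And>a b. \<bar>a\<bar> \<le> Q \<Longrightarrow> \<bar>b\<bar> \<le> Q \<Longrightarrow> \<bar>deriv V a - deriv V b\<bar> \<le> K * \<bar>a - b\<bar>"
    using lip[OF \<open>Q > 0\<close>] by blast
  define M where "M = \<bar>deriv V 0\<bar> + K * Q"
  have M: "\<bar>deriv V u\<bar> \<le> M" if "\<bar>u\<bar> \<le> Q" for u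
  proof -
    have "\<bar>deriv V u - deriv V 0\<bar> \<le> K * \<bar>u - 0\<bar>" using that \<open>Q > 0\<close> by (intro K) auto
    also have "\<dots> \<le> K * Q" using that K by (intro mult_left_mono) auto
    finally show ?thesis unfolding M_def by linarith
  qed
  define A where "A = 2 * real N + real N * (2 * Q * M + 8 * \<gamma> * Q\<^sup>2)"
  \<comment> \<open>At time 0 the solution equals \<open>w\<close>, so \<open>z 0 i\<close> is
    \<open>- l * real i\<close> and the initial energy does not depend on the path.\<close>
  define E where "E = ((\<Sum>i\<in>{1..N}. (l * real i)\<^sup>2) + A / (8 * \<gamma>)) * exp (8 * \<gamma> * T)"
  have "\<bar>deriv V 0\<bar> \<le> M" using \<open>Q > 0\<close> by (intro M) auto
  then have "M \<ge> 0" by linarith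
  then have "A \<ge> 0" using \<open>Q > 0\<close> \<open>\<gamma> > 0\<close> by (simp add: A_def)
  have "\<bar>x t i\<bar> \<le> sqrt E + Q"
    if r: "r \<ge> 1" and x: "trunc_solves N V r w T x" and t: "t \<in> {0..T}" and i: "i \<in> {1..N}"
    for r x t i
  proof -
    obtain K' where "K' \<ge> 0" "\<And>a b. \<bar>a\<bar> \<le> r \<Longrightarrow> \<bar>b\<bar> \<le> r \<Longrightarrow> \<bar>deriv V a - deriv V b\<bar> \<le> K' * \<bar>a - b\<bar>"
      using lip[of r] r by force
    then interpret lipschitz_drift "{1..N}" "trunc_drift N V r" "2 * r\<^sup>2 + K'" "r + \<bar>deriv V 0\<bar> + K' * r"
      using r \<open>N \<ge> 1\<close> by (intro trunc_drift_lipschitz_drift) auto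
    define y where "y s i = l * real i + w s i" for s i
    define z where "z s i = integral {0..s} (\<lambda>u. trunc_drift N V r (x u) i) - l * real i" for s i
    have cx: "continuous_on {0..T} (\<lambda>s. x s i)" if "i \<in> {1..N}" for i
      using x[unfolded solves_def] that by blast
    have cb: "continuous_on {0..T} (\<lambda>s. trunc_drift N V r (x s) i)" if "i \<in> {1..N}" for i
      using cx that by (rule continuous_on_drift)
    have xyz: "x s i - y s i = z s i" if "s \<in> {0..T}" "i \<in> {1..N}" for s i
      using x[unfolded solves_def] that by (simp add: y_def z_def)
    have ybd: "\<bar>y s i\<bar> + 1 \<le> Q" if "s \<in> {0..T}" "i \<in> {1..N}" for s i
    proof -
      have "l * real i \<le> l * real N" "0 \<le> l * real i" using that \<open>l \<ge> 1\<close> by auto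
      then show ?thesis using wD[OF that] by (simp add: y_def Q_def)
    qed
    have ygap: "y s j - y s i \<ge> 1" if "s \<in> {0..T}" "(i, j) \<in> pairs N" for s i j
    proof -
      have "l * 1 \<le> l * (real j - real i)" using that \<open>l \<ge> 1\<close> by (intro mult_left_mono) (auto simp: pairs_def)
      then show ?thesis using wD[of s i] wD[of s j] that
        by (auto simp: y_def l_def pairs_def algebra_simps)
    qed
    let ?e = "\<lambda>s. \<Sum>i\<in>{1..N}. (z s i)\<^sup>2"
    have e0: "?e 0 = (\<Sum>i\<in>{1..N}. (l * real i)\<^sup>2)" by (simp add: z_def)
    have "?e t \<le> (?e 0 + A / (8 * \<gamma>)) * exp (8 * \<gamma> * t) - A / (8 * \<gamma>)"
    proof (rule gronwall_differential)
      have cz: "continuous_on {0..t} (\<lambda>s. z s i)" if "i \<in> {1..N}" for i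
        unfolding z_def using t that
        by (intro continuous_intros indefinite_integral_continuous_1 integrable_continuous_interval
              continuous_on_subset[OF cb]) auto
      show "continuous_on {0..t} ?e" by (intro continuous_intros cz)
      fix s assume s: "0 < s" "s < t"
      have dz: "((\<lambda>s. z s i) has_real_derivative trunc_drift N V r (x s) i) (at s)" if "i \<in> {1..N}" for i
      proof -
        have "((\<lambda>s. integral {0..s} (\<lambda>u. trunc_drift N V r (x u) i)) has_real_derivative trunc_drift N V r (x s) i) (at s within {0..T})"
          using s t by (intro integral_has_real_derivative cb that) auto
        moreover have "at s within {0..T} = at s" using s t by (intro at_within_Icc_at) auto
        ultimately show ?thesis unfolding z_def by (auto intro!: derivative_eq_intros)
      qed
      show "(?e has_real_derivative (\<Sum>i\<in>{1..N}. 2 * z s i * trunc_drift N V r (x s) i)) (at s)"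
        by (auto intro!: derivative_eq_intros dz sum.cong)
      have sT: "s \<in> {0..T}" using s t by auto
      have "(\<Sum>i\<in>{1..N}. 2 * (x s i - y s i) * trunc_drift N V r (x s) i)
          \<le> A + 8 * \<gamma> * (\<Sum>i\<in>{1..N}. (x s i - y s i)\<^sup>2)"
        unfolding A_def
        by (rule energy_drift_le[OF v]) (use \<open>\<gamma> > 0\<close> r \<open>N \<ge> 1\<close> ybd[OF sT] ygap[OF sT] M in auto)
      then show "(\<Sum>i\<in>{1..N}. 2 * z s i * trunc_drift N V r (x s) i) \<le> A + 8 * \<gamma> * ?e s"
        by (simp only: xyz[OF sT] cong: sum.cong)
    qed (use t \<open>\<gamma> > 0\<close> in auto)
    also have "\<dots> \<le> (?e 0 + A / (8 * \<gamma>)) * exp (8 * \<gamma> * t)" using \<open>A \<ge> 0\<close> \<open>\<gamma> > 0\<close> by simp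
    also have "\<dots> \<le> E"
      unfolding E_def e0 using t \<open>\<gamma> > 0\<close> \<open>A \<ge> 0\<close> by (intro mult_left_mono add_nonneg_nonneg sum_nonneg) auto
    finally have "(z t i)\<^sup>2 \<le> E"
      using member_le_sum[of i "{1..N}" "\<lambda>i. (z t i)\<^sup>2"] i by auto
    then have "\<bar>z t i\<bar> \<le> sqrt E" by (rule real_le_rsqrt[of "\<bar>z t i\<bar>", simplified])
    then show ?thesis using xyz[OF t i] ybd[OF t i] by linarith
  qed
  then show ?thesis by blast
qed

section \<open>Gaussian increments\<close>

lemma borel_measurable_integral_path:
  fixes f :: "real \<Rightarrow> 'a \<Rightarrow> real"
  assumes t: "t \<ge> 0" and f: "\<And>s. s \<in> {0..t} \<Longrightarrow> f s \<in> borel_measurable G"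
    and cont: "\<And>\<omega>. \<omega> \<in> space G \<Longrightarrow> continuous_on {0..t} (\<lambda>s. f s \<omega>)"
  shows "(\<lambda>\<omega>. integral {0..t} (\<lambda>s. f s \<omega>)) \<in> borel_measurable G"
proof -
  \<comment> \<open>Clamping extends the time parameter to the whole line without ever evaluating
    \<open>f\<close> outside \<open>{0..t}\<close>, where nothing is known about its
    measurability.\<close>
  define clamp where "clamp s = max 0 (min t s)" for s
  have clamp: "clamp s \<in> {0..t}" for s using t by (auto simp: clamp_def)
  define h where "h n s = clamp (of_int \<lfloor>real (Suc n) * s\<rfloor> / real (Suc n))" for n s
  have h: "(\<lambda>n. h n s) \<longlonglongrightarrow> clamp s" for s
  proof -
    have "(\<lambda>n. of_int \<lfloor>real (Suc n) * s\<rfloor> / real (Suc n) - s) \<longlonglongrightarrow> 0"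
    proof (rule Lim_null_comparison[OF _ LIMSEQ_inverse_real_of_nat], intro always_eventually allI)
      fix n
      have "\<bar>of_int \<lfloor>real (Suc n) * s\<rfloor> - real (Suc n) * s\<bar> \<le> 1" by linarith
      then have "\<bar>(of_int \<lfloor>real (Suc n) * s\<rfloor> - real (Suc n) * s) / real (Suc n)\<bar> \<le> inverse (real (Suc n))"
        unfolding abs_divide by (simp add: divide_simps)
      moreover have "(of_int \<lfloor>real (Suc n) * s\<rfloor> - real (Suc n) * s) / real (Suc n)
          = of_int \<lfloor>real (Suc n) * s\<rfloor> / real (Suc n) - s"
        by (simp add: diff_divide_distrib)
      ultimately show "norm (of_int \<lfloor>real (Suc n) * s\<rfloor> / real (Suc n) - s) \<le> inverse (real (Suc n))"
        by (simp only: real_norm_def)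
    qed
    then have "(\<lambda>n. of_int \<lfloor>real (Suc n) * s\<rfloor> / real (Suc n)) \<longlonglongrightarrow> s" by (simp only: LIM_zero_iff)
    then show ?thesis unfolding h_def clamp_def by (intro tendsto_intros)
  qed
  \<comment> \<open>With time rounded to a grid, only countably many random variables are involved;
    continuity of the paths carries joint measurability to the limit.\<close>
  have joint_n: "(\<lambda>p. f (h n (snd p)) (fst p)) \<in> borel_measurable (G \<Otimes>\<^sub>M lborel)" for n
    unfolding h_def
  proof (rule measurable_compose_countable[where f="\<lambda>k p. f (clamp (of_int k / real (Suc n))) (fst p)"])
    fix k :: int
    show "(\<lambda>p. f (clamp (of_int k / real (Suc n))) (fst p)) \<in> borel_measurable (G \<Otimes>\<^sub>M lborel)"
      by (rule measurable_compose[OF measurable_fst f[OF clamp]])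
  qed measurable
  have joint: "(\<lambda>p. f (clamp (snd p)) (fst p)) \<in> borel_measurable (G \<Otimes>\<^sub>M lborel)"
  proof (rule borel_measurable_LIMSEQ_real[OF _ joint_n])
    fix p assume "p \<in> space (G \<Otimes>\<^sub>M (lborel :: real measure))"
    then have "fst p \<in> space G" by (auto simp: space_pair_measure)
    from continuous_on_tendsto_compose[OF cont[OF this] h[of "snd p"] clamp always_eventually]
    show "(\<lambda>n. f (h n (snd p)) (fst p)) \<longlonglongrightarrow> f (clamp (snd p)) (fst p)"
      using clamp by (auto simp: h_def)
  qed
  have "(\<lambda>\<omega>. \<integral>s. indicator {0..t} s * f (clamp s) \<omega> \<partial>lborel) \<in> borel_measurable G"
  proof (rule lborel.borel_measurable_lebesgue_integral)
    have "(\<lambda>p. indicator {0..t} (snd p) * f (clamp (snd p)) (fst p)) \<in> borel_measurable (G \<Otimes>\<^sub>M lborel)"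
      by (intro borel_measurable_times joint) measurable
    then show "(\<lambda>(\<omega>, s). indicator {0..t} s * f (clamp s) \<omega>) \<in> borel_measurable (G \<Otimes>\<^sub>M lborel)"
      by (simp add: case_prod_unfold)
  qed
  also have "?this \<longleftrightarrow> ?thesis"
  proof (rule measurable_cong)
    fix \<omega> assume "\<omega> \<in> space G"
    then have "integral {0..t} (\<lambda>s. f s \<omega>) = (LINT s:{0..t}|lborel. f s \<omega>)"
      by (intro set_borel_integral_eq_integral(2)[symmetric] borel_integrable_atLeastAtMost' cont)
    also have "\<dots> = (\<integral>s. indicator {0..t} s * f (clamp s) \<omega> \<partial>lborel)"
      unfolding set_lebesgue_integral_def
      by (intro Bochner_Integration.integral_cong refl) (auto simp: clamp_def split: split_indicator)
    finally show "(\<integral>s. indicator {0..t} s * f (clamp s) \<omega> \<partial>lborel) = integral {0..t} (\<lambda>s. f s \<omega>)" ..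
  qed
  finally show ?thesis .
qed

text \<open>
  The upper cutoff \<open>K\<close> only serves to make the potential bounded, hence integrable.
\<close>

definition log_clip :: "real \<Rightarrow> real \<Rightarrow> real \<Rightarrow> real" where
  "log_clip e K y = ln (max e (min y K))"

lemma log_clip_bounds:
  assumes "0 < e" "e \<le> K"
  shows "ln e \<le> log_clip e K y" "log_clip e K y \<le> ln K"
  using assms by (auto simp: log_clip_def)

lemma cube_add_le:
  fixes x y :: real
  assumes "x \<ge> 0" "y \<ge> 0"
  shows "(x + y) ^ 3 \<le> 4 * x ^ 3 + 4 * y ^ 3"
proof -
  have "4 * x ^ 3 + 4 * y ^ 3 - (x + y) ^ 3 = 3 * (x + y) * (x - y)\<^sup>2"
    by (simp add: power3_eq_cube power2_eq_square algebra_simps)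
  moreover have "3 * (x + y) * (x - y)\<^sup>2 \<ge> 0" using assms by simp
  ultimately show ?thesis by linarith
qed

text \<open>The derivative of \<open>ln (1 + u) - u + u\<^sup>2 / 2\<close> is
  \<open>u\<^sup>2 / (1 + u)\<close>, so the mean value theorem gives the remainder. The denominator
  \<open>1 + u\<close> keeps the estimate valid all the way down to \<open>- 1\<close>, where no
  constant multiple of the cube would do.\<close>

lemma ln_add_one_ge_quadratic:
  fixes u :: real
  assumes "- 1 < u"
  shows "u - u\<^sup>2 / 2 - \<bar>u\<bar> ^ 3 / (1 + u) \<le> ln (1 + u)"
proof -
  let ?h = "\<lambda>u::real. ln (1 + u) - u + u\<^sup>2 / 2"
  have deriv: "(?h has_real_derivative z\<^sup>2 / (1 + z)) (at z)" if "- 1 < z" for z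
  proof -
    have "1 / (1 + z) - 1 + z = z\<^sup>2 / (1 + z)" using that by (simp add: field_simps power2_eq_square)
    then show ?thesis using that by (auto intro!: derivative_eq_intros)
  qed
  consider "u = 0" | "u > 0" | "u < 0" by linarith
  then show ?thesis
  proof cases
    case 2
    obtain z where z: "0 < z" "z < u" "?h u - ?h 0 = (u - 0) * (z\<^sup>2 / (1 + z))"
      using MVT2[OF 2, of ?h "\<lambda>z. z\<^sup>2 / (1 + z)"] deriv by auto
    have "(u - 0) * (z\<^sup>2 / (1 + z)) \<ge> 0" using z 2 by simp
    moreover have "\<bar>u\<bar> ^ 3 / (1 + u) \<ge> 0" using 2 by simp
    ultimately show ?thesis using z(3) by simp
  next
    case 3
    obtain z where z: "u < z" "z < 0" "?h 0 - ?h u = (0 - u) * (z\<^sup>2 / (1 + z))"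
      using MVT2[OF 3, of ?h "\<lambda>z. z\<^sup>2 / (1 + z)"] deriv assms by auto
    have "z\<^sup>2 \<le> u\<^sup>2" using z(1,2) by (intro abs_le_square_iff[THEN iffD1]) auto
    then have "z\<^sup>2 / (1 + z) \<le> u\<^sup>2 / (1 + u)" using z assms by (intro frac_le) auto
    then have "(0 - u) * (z\<^sup>2 / (1 + z)) \<le> \<bar>u\<bar> * (u\<^sup>2 / (1 + u))"
      using 3 by (simp only: diff_0 abs_of_neg) (intro mult_left_mono, auto)
    also have "\<dots> = \<bar>u\<bar> ^ 3 / (1 + u)" by (simp add: power3_eq_cube power2_eq_square)
    finally show ?thesis using z(3) by simp
  qed simp
qed

text \<open>A Gaussian step is unbounded, so the expansion must hold for every \<open>d\<close>. The
  three summands of the constant belong to three cases: no clipping; a jump above \<open>K\<close>,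
  which forces \<open>d \<ge> 1\<close> and hence \<open>d \<le> d ^ 3\<close>; a fall below
  \<open>e\<close>, which forces \<open>\<bar>d\<bar> \<ge> e\<close> because \<open>x\<close>
  starts above \<open>2 * e\<close>. A lower bound is enough, since the potential is minus a sum of
  logarithms.\<close>

lemma log_clip_taylor:
  assumes e: "0 < e" and x: "2 * e \<le> x" "x + 1 \<le> K"
  shows "ln x + d / x - d\<^sup>2 / (2 * x\<^sup>2) - (1 / e ^ 3 + 1 / e + (ln K - ln e) / e ^ 3) * \<bar>d\<bar> ^ 3
           \<le> log_clip e K (x + d)" (is "_ - ?C * _ \<le> _")
proof -
  have pos: "x > 0" "K > 0" "e \<le> K" "ln e \<le> ln K" "ln x \<le> ln K" using assms by auto
  then have C: "?C \<ge> 1 / e ^ 3" "?C \<ge> 1 / e" "?C \<ge> (ln K - ln e) / e ^ 3" "?C \<ge> 0" using e by auto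
  consider "x + d > K" | "e \<le> x + d" "x + d \<le> K" | "x + d < e" by linarith
  then show ?thesis
  proof cases
    case 1
    then have d: "d \<ge> 1" using x by linarith
    have "d / x \<le> d / e" using assms d by (intro frac_le) auto
    also have "\<dots> \<le> 1 / e * d ^ 3" using d e power_increasing[of 1 3 d] by (simp add: divide_right_mono)
    also have "\<dots> \<le> ?C * \<bar>d\<bar> ^ 3" using C(2,4) d by (intro mult_mono) (simp_all only: abs_of_pos, auto)
    finally have "d / x \<le> ?C * \<bar>d\<bar> ^ 3" .
    moreover have "log_clip e K (x + d) = ln K" using 1 pos by (simp add: log_clip_def)
    moreover have "d\<^sup>2 / (2 * x\<^sup>2) \<ge> 0" by simp
    ultimately show ?thesis using pos by linarith
  next
    case 2
    let ?u = "d / x"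
    have u: "- 1 < ?u" using 2 e pos by (simp add: less_divide_eq)
    have "log_clip e K (x + d) = ln (x * (1 + ?u))" using 2 pos by (simp add: log_clip_def distrib_left)
    also have "\<dots> = ln x + ln (1 + ?u)" using pos u by (intro ln_mult_pos) auto
    finally have eq: "log_clip e K (x + d) = ln x + ln (1 + ?u)" .
    have "\<bar>?u\<bar> ^ 3 / (1 + ?u) = \<bar>d\<bar> ^ 3 / (x\<^sup>2 * (x + d))"
    proof -
      have "1 + ?u = (x + d) / x" using pos by (simp add: add_divide_distrib)
      then show ?thesis using pos by (simp add: abs_divide power_divide power3_eq_cube power2_eq_square)
    qed
    also have "\<dots> \<le> \<bar>d\<bar> ^ 3 / (e\<^sup>2 * e)"
      using 2 e x by (intro frac_le mult_mono power_mono) auto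
    also have "\<dots> = 1 / e ^ 3 * \<bar>d\<bar> ^ 3" by (simp add: power3_eq_cube power2_eq_square)
    also have "\<dots> \<le> ?C * \<bar>d\<bar> ^ 3" using C(1) by (intro mult_right_mono) auto
    finally have "\<bar>?u\<bar> ^ 3 / (1 + ?u) \<le> ?C * \<bar>d\<bar> ^ 3" .
    moreover have "?u\<^sup>2 / 2 = d\<^sup>2 / (2 * x\<^sup>2)" by (simp add: power_divide)
    ultimately show ?thesis using ln_add_one_ge_quadratic[OF u] unfolding eq by linarith
  next
    case 3
    then have d: "d \<le> - e" using x by linarith
    have "ln K - ln e = (ln K - ln e) / e ^ 3 * e ^ 3" using e by simp
    also have "\<dots> \<le> ?C * \<bar>d\<bar> ^ 3"
      using d e by (intro mult_mono[OF C(3) _ C(4)] power_mono) auto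
    finally have "ln K - ln e \<le> ?C * \<bar>d\<bar> ^ 3" .
    moreover have "log_clip e K (x + d) = ln e" using 3 pos by (simp add: log_clip_def)
    moreover have "d / x \<le> 0" using d e pos by (intro divide_nonpos_pos) auto
    moreover have "d\<^sup>2 / (2 * x\<^sup>2) \<ge> 0" by simp
    ultimately show ?thesis using pos by linarith
  qed
qed

section \<open>Moments and independence of Brownian increments\<close>

abbreviation gaussian :: "real \<Rightarrow> real measure" where
  "gaussian h \<equiv> density lborel (\<lambda>x. ennreal (normal_density 0 (sqrt h) x))"

lemma
  assumes h: "h > 0"
  shows prob_space_gaussian: "prob_space (gaussian h)"
    and gaussian_integrable_power: "integrable (gaussian h) (\<lambda>x. x ^ k)"
    and gaussian_integrable_abs_power: "integrable (gaussian h) (\<lambda>x. \<bar>x\<bar> ^ k)"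
    and gaussian_mean: "(\<integral>x. x \<partial>gaussian h) = 0"
    and gaussian_variance: "(\<integral>x. x\<^sup>2 \<partial>gaussian h) = h"
    and gaussian_abs_moment: "(\<integral>x. \<bar>x\<bar> \<partial>gaussian h) \<le> sqrt h"
    and gaussian_abs_third_moment: "(\<integral>x. \<bar>x\<bar> ^ 3 \<partial>gaussian h) \<le> 2 * sqrt h ^ 3"
proof -
  have s: "sqrt h > 0" using h by simp
  show "prob_space (gaussian h)" by (rule prob_space_normal_density[OF s])
  have int: "integral\<^sup>L (gaussian h) f = (\<integral>x. normal_density 0 (sqrt h) x * f x \<partial>lborel)"
    if "f \<in> borel_measurable borel" for f :: "real \<Rightarrow> real"
    by (rule integral_real_density) (use that in auto)
  have integrable: "integrable (gaussian h) f \<longleftrightarrow> integrable lborel (\<lambda>x. normal_density 0 (sqrt h) x * f x)"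
    if "f \<in> borel_measurable borel" for f :: "real \<Rightarrow> real"
    by (rule integrable_real_density) (use that in auto)
  have "integrable lborel (\<lambda>x. normal_density 0 (sqrt h) x * x ^ k)"
    using integrable_normal_moment[OF s, of 0 k] by (simp only: diff_zero)
  then show "integrable (gaussian h) (\<lambda>x. x ^ k)" by (subst integrable) auto
  have "integrable lborel (\<lambda>x. normal_density 0 (sqrt h) x * \<bar>x\<bar> ^ k)"
    using integrable_normal_moment_abs[OF s, of 0 k] by (simp only: diff_zero)
  then show "integrable (gaussian h) (\<lambda>x. \<bar>x\<bar> ^ k)" by (subst integrable) auto
  have "(\<integral>x. normal_density 0 (sqrt h) x * x \<partial>lborel) = 0"
    using integral_normal_moment_odd[OF s, of 0 0] by (simp only: diff_zero mult_0_right add_0 power_one_right)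
  then show "(\<integral>x. x \<partial>gaussian h) = 0" by (subst int) auto
  have "(\<integral>x. normal_density 0 (sqrt h) x * x\<^sup>2 \<partial>lborel) = fact 2 / ((2 / (sqrt h)\<^sup>2) ^ 1 * fact 1)"
    using integral_normal_moment_even[OF s, of 0 1] by (simp only: diff_zero mult_1_right)
  also have "\<dots> = h" using h by (simp add: fact_2)
  finally show "(\<integral>x. x\<^sup>2 \<partial>gaussian h) = h" by (subst int) auto
  have pi: "sqrt (2 / pi) \<le> 1" using pi_gt3 by simp
  have "(\<integral>x. normal_density 0 (sqrt h) x * \<bar>x\<bar> \<partial>lborel) = 2 ^ 0 * sqrt h * fact 0 * sqrt (2 / pi)"
    using integral_normal_moment_abs_odd[OF s, of 0 0] by (simp only: diff_zero mult_0_right add_0 power_one_right)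
  also have "\<dots> \<le> sqrt h * 1"
    using mult_left_mono[OF pi, of "sqrt h"] s by simp
  finally show "(\<integral>x. \<bar>x\<bar> \<partial>gaussian h) \<le> sqrt h" by (subst int) auto
  have "2 * 1 + 1 = (3::nat)" by simp
  then have "(\<integral>x. normal_density 0 (sqrt h) x * \<bar>x\<bar> ^ 3 \<partial>lborel) = 2 ^ 1 * sqrt h ^ 3 * fact 1 * sqrt (2 / pi)"
    using integral_normal_moment_abs_odd[OF s, of 0 1] by (simp only: diff_zero)
  also have "\<dots> \<le> 2 * sqrt h ^ 3"
    using mult_left_mono[OF pi, of "2 * sqrt h ^ 3"] s by simp
  finally show "(\<integral>x. \<bar>x\<bar> ^ 3 \<partial>gaussian h) \<le> 2 * sqrt h ^ 3" by (subst int) auto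
qed

text \<open>Continuity and the starting value are required on every path instead of almost every
  one, so that the truncated equation can be solved, and its solution is measurable, without
  exceptional sets. The almost sure setting is reduced to this one by
  \<open>continuous_brownian_version\<close>.\<close>

locale filtered_brownian = prob_space M
  for M :: "'a measure" +
  fixes G :: "real \<Rightarrow> 'a measure" and N :: nat and B :: "real \<Rightarrow> 'a \<Rightarrow> nat \<Rightarrow> real"
  assumes filtration: "is_filtration M G" and brownian: "brownian_motion M G N B"
    and continuous_paths: "\<omega> \<in> space M \<Longrightarrow> i \<in> {1..N} \<Longrightarrow> continuous_on {0..} (\<lambda>t. B t \<omega> i)"
    and start: "\<omega> \<in> space M \<Longrightarrow> i \<in> {1..N} \<Longrightarrow> B 0 \<omega> i = 0"
begin

lemma subalgebra_G: "t \<ge> 0 \<Longrightarrow> subalgebra M (G t)"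
  using filtration by (simp add: is_filtration_def)

lemma space_G: "t \<ge> 0 \<Longrightarrow> space (G t) = space M"
  using subalgebra_G by (simp add: subalgebra_def)

lemma measurable_G_mono: "0 \<le> s \<Longrightarrow> s \<le> t \<Longrightarrow> f \<in> measurable (G s) A \<Longrightarrow> f \<in> measurable (G t) A"
  by (rule measurable_from_subalg[of "G t" "G s"]) (use filtration in \<open>simp_all add: subalgebra_def is_filtration_def\<close>)

lemma B_measurable:
  assumes "t \<ge> 0" "i \<in> {1..N}"
  shows "(\<lambda>\<omega>. B t \<omega> i) \<in> borel_measurable (G t)"
proof (rule measurable_compose[where f="B t" and g="\<lambda>x. x i"])
  show "B t \<in> measurable (G t) (borel_vec N)" using brownian assms(1) by (simp add: brownian_motion_def)
  show "(\<lambda>x. x i) \<in> borel_measurable (borel_vec N)" using assms(2) by (rule measurable_component_singleton)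
qed

context
  fixes s t :: real
  assumes st: "0 \<le> s" "s < t"
begin

lemma increment_measurable: "increment N B s t \<in> measurable M (borel_vec N)"
  unfolding increment_def
proof (rule measurable_restrict)
  fix i assume i: "i \<in> {1..N}"
  have "(\<lambda>\<omega>. B t \<omega> i - B s \<omega> i) \<in> borel_measurable (G t)"
    using st i by (intro borel_measurable_diff B_measurable measurable_G_mono[of s t]) auto
  then show "(\<lambda>\<omega>. B t \<omega> i - B s \<omega> i) \<in> borel_measurable M"
    using st by (intro measurable_from_subalg[OF subalgebra_G]) auto
qed

lemma distr_increment: "distr M (borel_vec N) (increment N B s t) = PiM {1..N} (\<lambda>_. gaussian (t - s))"
  using brownian st by (simp add: brownian_motion_def)

lemma distr_increment_component:
  assumes i: "i \<in> {1..N}"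
  shows "distr M borel (\<lambda>\<omega>. increment N B s t \<omega> i) = gaussian (t - s)"
proof -
  have "distr (distr M (borel_vec N) (increment N B s t)) borel (\<lambda>x. x i) = distr M borel (\<lambda>\<omega>. increment N B s t \<omega> i)"
    using distr_distr[OF measurable_component_singleton[OF i, of "\<lambda>_. borel"] increment_measurable]
    by (simp only: comp_def)
  moreover have "distr (PiM {1..N} (\<lambda>_. gaussian (t - s))) (gaussian (t - s)) (\<lambda>x. x i) = gaussian (t - s)"
    using i st by (intro distr_PiM_component prob_space_gaussian) auto
  ultimately show ?thesis unfolding distr_increment by (metis distr_cong sets_density sets_lborel)
qed

lemma increment_component_measurable [measurable]:
  "i \<in> {1..N} \<Longrightarrow> (\<lambda>\<omega>. increment N B s t \<omega> i) \<in> borel_measurable M"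
  by (rule measurable_compose[OF increment_measurable measurable_component_singleton])

lemma integral_increment_component:
  fixes g :: "real \<Rightarrow> real"
  assumes i: "i \<in> {1..N}" and g: "g \<in> borel_measurable borel"
  shows "expectation (\<lambda>\<omega>. g (increment N B s t \<omega> i)) = (\<integral>x. g x \<partial>gaussian (t - s))"
    and "integrable M (\<lambda>\<omega>. g (increment N B s t \<omega> i)) \<longleftrightarrow> integrable (gaussian (t - s)) g"
  using integral_distr[OF increment_component_measurable[OF i] g]
    integrable_distr_eq[OF increment_component_measurable[OF i] g]
  unfolding distr_increment_component[OF i] by auto

lemma
  assumes ij: "i \<in> {1..N}" "j \<in> {1..N}" "i \<noteq> j"
  shows increment_product_integrable: "integrable M (\<lambda>\<omega>. increment N B s t \<omega> i * increment N B s t \<omega> j)"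
    and increment_uncorrelated: "expectation (\<lambda>\<omega>. increment N B s t \<omega> i * increment N B s t \<omega> j) = 0"
proof -
  \<comment> \<open>Padding with the constant 1 writes \<open>x i * x j\<close> as a product over
    all coordinates, to which the product formula for \<open>PiM\<close> applies.\<close>
  let ?\<nu> = "gaussian (t - s)" and ?f = "\<lambda>k x. if k \<in> {i, j} then x else (1::real)"
  have pos: "t - s > 0" using st by simp
  interpret \<nu>: prob_space ?\<nu> by (rule prob_space_gaussian[OF pos])
  interpret product_sigma_finite "\<lambda>_::nat. ?\<nu>" ..
  have f: "integrable ?\<nu> (?f k)" for k
    using gaussian_integrable_power[OF pos, of 1] by (cases "k \<in> {i, j}") auto
  have prod: "(\<Prod>k\<in>{1..N}. ?f k (x k)) = x i * x j" for x
  proof -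
    have "(\<Prod>k\<in>{1..N}. ?f k (x k)) = (\<Prod>k\<in>{1..N} \<inter> {i, j}. x k)"
      by (subst prod.inter_restrict) auto
    also have "{1..N} \<inter> {i, j} = {i, j}" using ij by auto
    finally show ?thesis using ij by simp
  qed
  have m: "(\<lambda>x. x i * x j) \<in> borel_measurable (borel_vec N)"
    using ij by measurable
  have int: "integrable (PiM {1..N} (\<lambda>_. ?\<nu>)) (\<lambda>x. x i * x j)"
    using product_integrable_prod[of "{1..N}" ?f, OF _ f] by (simp only: prod) simp
  have "(\<integral>x. x i * x j \<partial>PiM {1..N} (\<lambda>_. ?\<nu>)) = (\<Prod>k\<in>{1..N}. integral\<^sup>L ?\<nu> (?f k))"
    using product_integral_prod[of "{1..N}" ?f, OF _ f] by (simp only: prod) simp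
  also have "\<dots> = 0"
    using ij gaussian_mean[OF pos] by (intro prod_zero) (auto intro!: bexI[of _ i])
  finally have zero: "(\<integral>x. x i * x j \<partial>PiM {1..N} (\<lambda>_. ?\<nu>)) = 0" .
  show "integrable M (\<lambda>\<omega>. increment N B s t \<omega> i * increment N B s t \<omega> j)"
    using int integrable_distr_eq[OF increment_measurable m] unfolding distr_increment by simp
  show "expectation (\<lambda>\<omega>. increment N B s t \<omega> i * increment N B s t \<omega> j) = 0"
    using zero integral_distr[OF increment_measurable m] unfolding distr_increment by simp
qed

definition gap_increment :: "nat \<Rightarrow> nat \<Rightarrow> 'a \<Rightarrow> real" where
  "gap_increment i j \<omega> = increment N B s t \<omega> j - increment N B s t \<omega> i"

lemma gap_increment_measurable [measurable]:
  "(i, j) \<in> pairs N \<Longrightarrow> gap_increment i j \<in> borel_measurable M"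
  unfolding gap_increment_def by (intro borel_measurable_diff increment_component_measurable) (auto simp: pairs_def)

lemma gap_increment_moments:
  assumes ij: "(i, j) \<in> pairs N"
  shows "integrable M (gap_increment i j)"
    and "expectation (gap_increment i j) = 0"
    and "integrable M (\<lambda>\<omega>. (gap_increment i j \<omega>)\<^sup>2)"
    and "expectation (\<lambda>\<omega>. (gap_increment i j \<omega>)\<^sup>2) = 2 * (t - s)"
    and "expectation (\<lambda>\<omega>. \<bar>gap_increment i j \<omega>\<bar>) \<le> 2 * sqrt (t - s)"
    and "integrable M (\<lambda>\<omega>. \<bar>gap_increment i j \<omega>\<bar> ^ 3)"
    and "expectation (\<lambda>\<omega>. \<bar>gap_increment i j \<omega>\<bar> ^ 3) \<le> 16 * sqrt (t - s) ^ 3"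
proof -
  let ?q = "\<lambda>i \<omega>. increment N B s t \<omega> i"
  have pos: "t - s > 0" using st by simp
  have i: "i \<in> {1..N}" and j: "j \<in> {1..N}" and neq: "i \<noteq> j" using ij by (auto simp: pairs_def)
  note [measurable] = gap_increment_measurable[OF ij]
  have q1: "integrable M (?q k)" "expectation (?q k) = 0" if "k \<in> {1..N}" for k
    using integral_increment_component[OF that, of "\<lambda>x. x"] gaussian_integrable_power[OF pos, of 1] gaussian_mean[OF pos]
    by auto
  have q2: "integrable M (\<lambda>\<omega>. (?q k \<omega>)\<^sup>2)" "expectation (\<lambda>\<omega>. (?q k \<omega>)\<^sup>2) = t - s" if "k \<in> {1..N}" for k
    using integral_increment_component[OF that, of "\<lambda>x. x\<^sup>2"] gaussian_integrable_power[OF pos, of 2] gaussian_variance[OF pos]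
    by auto
  have qa: "integrable M (\<lambda>\<omega>. \<bar>?q k \<omega>\<bar>)" "expectation (\<lambda>\<omega>. \<bar>?q k \<omega>\<bar>) \<le> sqrt (t - s)" if "k \<in> {1..N}" for k
    using integral_increment_component[OF that, of "\<lambda>x. \<bar>x\<bar>"] gaussian_integrable_abs_power[OF pos, of 1] gaussian_abs_moment[OF pos]
    by auto
  have q3: "integrable M (\<lambda>\<omega>. \<bar>?q k \<omega>\<bar> ^ 3)" "expectation (\<lambda>\<omega>. \<bar>?q k \<omega>\<bar> ^ 3) \<le> 2 * sqrt (t - s) ^ 3" if "k \<in> {1..N}" for k
    using integral_increment_component[OF that, of "\<lambda>x. \<bar>x\<bar> ^ 3"] gaussian_integrable_abs_power[OF pos, of 3] gaussian_abs_third_moment[OF pos]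
    by auto
  show "integrable M (gap_increment i j)" "expectation (gap_increment i j) = 0"
    using q1[OF i] q1[OF j] unfolding gap_increment_def by auto
  have sq: "(gap_increment i j \<omega>)\<^sup>2 = (?q j \<omega>)\<^sup>2 + (?q i \<omega>)\<^sup>2 - 2 * (?q i \<omega> * ?q j \<omega>)" for \<omega>
    by (simp add: gap_increment_def power2_eq_square algebra_simps)
  note pr = increment_product_integrable[OF i j neq] increment_uncorrelated[OF i j neq]
  show "integrable M (\<lambda>\<omega>. (gap_increment i j \<omega>)\<^sup>2)"
    unfolding sq using q2[OF i] q2[OF j] pr by auto
  show "expectation (\<lambda>\<omega>. (gap_increment i j \<omega>)\<^sup>2) = 2 * (t - s)"
    unfolding sq using q2[OF i] q2[OF j] pr by simp
  have "expectation (\<lambda>\<omega>. \<bar>gap_increment i j \<omega>\<bar>) \<le> expectation (\<lambda>\<omega>. \<bar>?q j \<omega>\<bar> + \<bar>?q i \<omega>\<bar>)"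
    using qa[OF i] qa[OF j] q1[OF i] q1[OF j]
    by (intro integral_mono) (auto simp: gap_increment_def)
  then show "expectation (\<lambda>\<omega>. \<bar>gap_increment i j \<omega>\<bar>) \<le> 2 * sqrt (t - s)"
    using qa[OF i] qa[OF j] by simp
  \<comment> \<open>Each coordinate has absolute third moment at most
    \<open>2 * sqrt (t - s) ^ 3\<close>; with the factors 4 this yields the 16 of the
    statement.\<close>
  have cube: "\<bar>a - b\<bar> ^ 3 \<le> 4 * \<bar>a\<bar> ^ 3 + 4 * \<bar>b\<bar> ^ 3" for a b :: real
  proof -
    have "(\<bar>a\<bar> + \<bar>b\<bar>) ^ 3 \<le> 4 * \<bar>a\<bar> ^ 3 + 4 * \<bar>b\<bar> ^ 3" by (intro cube_add_le) auto
    moreover have "\<bar>a - b\<bar> ^ 3 \<le> (\<bar>a\<bar> + \<bar>b\<bar>) ^ 3" by (intro power_mono) auto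
    ultimately show ?thesis by linarith
  qed
  have cube_int: "integrable M (\<lambda>\<omega>. 4 * \<bar>?q j \<omega>\<bar> ^ 3 + 4 * \<bar>?q i \<omega>\<bar> ^ 3)"
    using q3[OF i] q3[OF j] by auto
  show third: "integrable M (\<lambda>\<omega>. \<bar>gap_increment i j \<omega>\<bar> ^ 3)"
  proof (rule Bochner_Integration.integrable_bound[OF cube_int])
    show "AE \<omega> in M. norm (\<bar>gap_increment i j \<omega>\<bar> ^ 3) \<le> norm (4 * \<bar>?q j \<omega>\<bar> ^ 3 + 4 * \<bar>?q i \<omega>\<bar> ^ 3)"
      unfolding gap_increment_def by (auto intro: order_trans[OF cube])
  qed measurable
  have "expectation (\<lambda>\<omega>. \<bar>gap_increment i j \<omega>\<bar> ^ 3) \<le> expectation (\<lambda>\<omega>. 4 * \<bar>?q j \<omega>\<bar> ^ 3 + 4 * \<bar>?q i \<omega>\<bar> ^ 3)"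
    by (intro integral_mono third cube_int) (auto simp: gap_increment_def intro: cube)
  then show "expectation (\<lambda>\<omega>. \<bar>gap_increment i j \<omega>\<bar> ^ 3) \<le> 16 * sqrt (t - s) ^ 3"
    using q3[OF i] q3[OF j] by simp
qed

text \<open>This takes the place of conditioning on \<open>G s\<close>: a bounded weight known at
  time \<open>s\<close> factors out. With \<open>g\<close> the identity it removes the first-order
  term of the expansion, with \<open>g\<close> the square it produces the quadratic
  variation.\<close>

lemma gap_increment_independent:
  fixes g :: "real \<Rightarrow> real"
  assumes ij: "(i, j) \<in> pairs N" and Y: "Y \<in> borel_measurable (G s)" and Yc: "\<And>\<omega>. \<omega> \<in> space M \<Longrightarrow> \<bar>Y \<omega>\<bar> \<le> c"
    and g: "g \<in> borel_measurable borel" and int: "integrable M (\<lambda>\<omega>. g (gap_increment i j \<omega>))"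
  shows "integrable M (\<lambda>\<omega>. Y \<omega> * g (gap_increment i j \<omega>))"
    and "expectation (\<lambda>\<omega>. Y \<omega> * g (gap_increment i j \<omega>)) = expectation Y * expectation (\<lambda>\<omega>. g (gap_increment i j \<omega>))"
proof -
  let ?Z = "\<lambda>\<omega>. g (gap_increment i j \<omega>)" and ?f = "\<lambda>x::nat \<Rightarrow> real. g (x j - x i)"
  let ?v = "vimage_algebra (space M) (increment N B s t) (borel_vec N)"
  have YM: "Y \<in> borel_measurable M" using st Y by (intro measurable_from_subalg[OF subalgebra_G]) auto
  have i: "i \<in> {1..N}" and j: "j \<in> {1..N}" using ij by (auto simp: pairs_def)
  have fm: "?f \<in> borel_measurable (borel_vec N)"
    by (rule measurable_compose[OF borel_measurable_diff[OF measurable_component_singleton[OF j] measurable_component_singleton[OF i]] g])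
  have Zf: "?Z = (\<lambda>\<omega>. ?f (increment N B s t \<omega>))" by (simp add: gap_increment_def)
  have ind: "indep_set (sets (G s)) (sets ?v)"
    using brownian st by (simp add: brownian_motion_def)
  have "indep_var borel Y borel ?Z"
    unfolding indep_var_eq
  proof (intro conjI)
    show "random_variable borel ?Z"
      unfolding Zf by (rule measurable_compose[OF increment_measurable fm])
    have 1: "sigma_sets (space M) {Y -` A \<inter> space M |A. A \<in> sets borel} \<subseteq> sets (G s)"
    proof -
      have "{Y -` A \<inter> space (G s) |A. A \<in> sets borel} \<subseteq> sets (G s)"
        using Y by (auto intro: measurable_sets)
      then show ?thesis using sets.sigma_sets_subset[of _ "G s"] space_G[of s] st by auto
    qed
    have 2: "sigma_sets (space M) {?Z -` A \<inter> space M |A. A \<in> sets borel}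
        \<subseteq> sets ?v"
    proof -
      have "?Z -` A \<inter> space M \<in> sets ?v"
        if A: "A \<in> sets borel" for A
      proof -
        have "?f -` A \<inter> space (borel_vec N) \<in> sets (borel_vec N)" using fm A by (rule measurable_sets)
        then have "increment N B s t -` (?f -` A \<inter> space (borel_vec N)) \<inter> space M
            \<in> sets ?v"
          by (rule in_vimage_algebra)
        also have "increment N B s t -` (?f -` A \<inter> space (borel_vec N)) \<inter> space M = ?Z -` A \<inter> space M"
          using measurable_space[OF increment_measurable] by (auto simp: Zf)
        finally show ?thesis .
      qed
      then show ?thesis
        using sets.sigma_sets_subset[of "{?Z -` A \<inter> space M |A. A \<in> sets borel}" ?v]
        by auto
    qed
    show "indep_set (sigma_sets (space M) {Y -` A \<inter> space M |A. A \<in> sets borel})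
        (sigma_sets (space M) {?Z -` A \<inter> space M |A. A \<in> sets borel})"
      using ind 1 2 unfolding indep_sets2_eq by blast
  qed (rule YM)
  moreover have "integrable M Y"
    using Yc YM by (intro integrable_const_bound[where B=c]) auto
  ultimately show "integrable M (\<lambda>\<omega>. Y \<omega> * ?Z \<omega>)" "expectation (\<lambda>\<omega>. Y \<omega> * ?Z \<omega>) = expectation Y * expectation ?Z"
    using int by (auto intro: indep_var_integrable indep_var_lebesgue_integral)
qed

end

end

section \<open>The truncated process\<close>

lemma integral_minus_left_value_le:
  fixes g :: "real \<Rightarrow> real"
  assumes "a \<le> b" and g: "continuous_on {a..b} g" and le: "\<And>s. s \<in> {a..b} \<Longrightarrow> \<bar>g s - g a\<bar> \<le> \<eta>"
  shows "\<bar>integral {a..b} g - (b - a) * g a\<bar> \<le> \<eta> * (b - a)"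
proof -
  have "integral {a..b} (\<lambda>s. g s - g a) = integral {a..b} g - (b - a) * g a"
    using \<open>a \<le> b\<close> by (subst integral_diff) (auto intro!: integrable_continuous_interval g)
  moreover have "norm (integral {a..b} (\<lambda>s. g s - g a)) \<le> \<eta> * (b - a)"
    using le by (intro integral_bound[OF \<open>a \<le> b\<close>] continuous_intros g) auto
  ultimately show ?thesis by simp
qed

text \<open>The absolute values stand inside the sum because the errors are charged to the potential
  step by step, where no cancellation between steps is available. Uniform continuity bounds the
  error of each step by \<open>\<eta>\<close> times its length.\<close>

lemma riemann_error_tendsto_zero:
  fixes g :: "real \<Rightarrow> real"
  assumes "T \<ge> 0" and g: "continuous_on {0..T} g"
  shows "(\<lambda>m. \<Sum>k<Suc m. \<bar>integral {real k * (T / real (Suc m))..real (Suc k) * (T / real (Suc m))} g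
            - T / real (Suc m) * g (real k * (T / real (Suc m)))\<bar>) \<longlonglongrightarrow> 0"
proof (rule LIMSEQ_I)
  fix \<epsilon> :: real assume \<epsilon>: "\<epsilon> > 0"
  \<comment> \<open>The \<open>T + 1\<close> avoids dividing by zero when \<open>T = 0\<close>; all
    that matters is \<open>\<eta> * T < \<epsilon>\<close>.\<close>
  define \<eta> where "\<eta> = \<epsilon> / (2 * (T + 1))"
  have \<eta>: "\<eta> > 0" using \<epsilon> \<open>T \<ge> 0\<close> by (simp add: \<eta>_def)
  have "T / (T + 1) < 1" using \<open>T \<ge> 0\<close> by simp
  then have "T / (T + 1) * (\<epsilon> / 2) < 1 * \<epsilon>" using \<epsilon> \<open>T \<ge> 0\<close> by (intro mult_strict_mono) auto
  then have T\<eta>: "\<eta> * T < \<epsilon>" by (simp add: \<eta>_def mult.commute)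
  have "uniformly_continuous_on {0..T} g" by (intro compact_uniformly_continuous g) auto
  then obtain \<delta> where \<delta>: "\<delta> > 0" "\<And>s u. s \<in> {0..T} \<Longrightarrow> u \<in> {0..T} \<Longrightarrow> dist u s < \<delta> \<Longrightarrow> dist (g u) (g s) < \<eta>"
    using \<eta> unfolding uniformly_continuous_on_def by meson
  obtain m0 where m0: "T / \<delta> < real m0" using reals_Archimedean2 by blast
  show "\<exists>m0. \<forall>m\<ge>m0. norm ((\<Sum>k<Suc m. \<bar>integral {real k * (T / real (Suc m))..real (Suc k) * (T / real (Suc m))} g
            - T / real (Suc m) * g (real k * (T / real (Suc m)))\<bar>) - 0) < \<epsilon>"
  proof (intro exI allI impI)
    fix m assume m: "m \<ge> m0"
    define h where "h = T / real (Suc m)"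
    have h0: "h \<ge> 0" using \<open>T \<ge> 0\<close> by (simp add: h_def)
    have "T / \<delta> < real (Suc m)" using m m0 by linarith
    then have h\<delta>: "h < \<delta>" using \<delta>(1) unfolding h_def by (simp add: field_simps)
    have Th: "real (Suc m) * h = T" by (simp add: h_def)
    have step: "\<bar>integral {real k * h..real (Suc k) * h} g - h * g (real k * h)\<bar> \<le> \<eta> * h" if k: "k < Suc m" for k
    proof -
      have "real (Suc k) * h \<le> real (Suc m) * h" using k h0 by (intro mult_right_mono) auto
      then have top: "real (Suc k) * h \<le> T" unfolding Th .
      have "0 \<le> real k * h" using h0 by simp
      have len: "real (Suc k) * h - real k * h = h" by (simp add: algebra_simps)
      have "\<bar>integral {real k * h..real (Suc k) * h} g - (real (Suc k) * h - real k * h) * g (real k * h)\<bar>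
          \<le> \<eta> * (real (Suc k) * h - real k * h)"
      proof (rule integral_minus_left_value_le)
        show "continuous_on {real k * h..real (Suc k) * h} g"
          using top \<open>0 \<le> real k * h\<close> by (intro continuous_on_subset[OF g]) auto
        fix s assume s: "s \<in> {real k * h..real (Suc k) * h}"
        have "0 \<le> s" using s \<open>0 \<le> real k * h\<close> by (meson atLeastAtMost_iff order_trans)
        then have "dist (g s) (g (real k * h)) < \<eta>"
          using s top len \<open>0 \<le> real k * h\<close> h\<delta> by (intro \<delta>(2)) (auto simp: dist_real_def)
        then show "\<bar>g s - g (real k * h)\<bar> \<le> \<eta>" by (simp add: dist_real_def)
      qed (use len h0 in linarith)
      then show ?thesis unfolding len .
    qed
    have "(\<Sum>k<Suc m. \<bar>integral {real k * h..real (Suc k) * h} g - h * g (real k * h)\<bar>) \<le> real (card {..<Suc m}) * (\<eta> * h)"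
      by (rule sum_bounded_above) (use step in auto)
    also have "\<dots> = \<eta> * T" using Th by (simp add: mult.left_commute)
    also have "\<dots> < \<epsilon>" by (rule T\<eta>)
    finally show "norm ((\<Sum>k<Suc m. \<bar>integral {real k * (T / real (Suc m))..real (Suc k) * (T / real (Suc m))} g
            - T / real (Suc m) * g (real k * (T / real (Suc m)))\<bar>) - 0) < \<epsilon>"
      unfolding h_def[symmetric] by (simp add: sum_nonneg)
  qed
qed

text \<open>One step for one pair: \<open>P\<close> is the Gaussian part of the gap increment,
  \<open>D\<close> the drift part, \<open>h * a\<close> the drift frozen at the left end and
  \<open>U\<close> the freezing error. The first three terms are the martingale term, the Ito
  correction and the drift; the parenthesis collects the freezing error, the cross term and square
  involving \<open>D\<close>, and the cubic remainder, with \<open>8 * e\<^sup>2\<close> arising as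
  twice the square of the minimal gap \<open>2 * e\<close>.\<close>

lemma log_gap_step:
  fixes D :: real
  assumes e: "0 < e" and g: "2 * e \<le> g" "g + 1 \<le> K" and "c \<ge> 0" "h \<ge> 0" "b \<ge> 0"
    and D: "\<bar>D\<bar> \<le> 2 * b * h" and U: "\<bar>D - h * a\<bar> \<le> U"
  shows "log_clip e K g - log_clip e K (g + (c * P + D))
     \<le> - (c * (P / g)) + c\<^sup>2 / 2 * (P\<^sup>2 / g\<^sup>2) - h * (a / g)
       + (U / (2 * e) + (4 * c * b * h * \<bar>P\<bar> + 4 * b\<^sup>2 * h\<^sup>2) / (8 * e\<^sup>2)
           + (1 / e ^ 3 + 1 / e + (ln K - ln e) / e ^ 3) * (4 * c ^ 3 * \<bar>P\<bar> ^ 3 + 32 * b ^ 3 * h ^ 3))"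
proof -
  let ?C = "1 / e ^ 3 + 1 / e + (ln K - ln e) / e ^ 3" and ?d = "c * P + D"
  have g0: "g > 0" using e g by linarith
  have lng: "log_clip e K g = ln g" using e g by (simp add: log_clip_def)
  have C: "?C \<ge> 0" using e g by (intro add_nonneg_nonneg divide_nonneg_nonneg) auto
  have "(h * a - D) / g \<le> \<bar>D - h * a\<bar> / g" using g0 by (intro divide_right_mono) auto
  also have "\<dots> \<le> U / (2 * e)" using U e g by (intro frac_le) auto
  finally have "- (?d / g) \<le> - (c * (P / g)) - h * (a / g) + U / (2 * e)"
    by (simp add: add_divide_distrib diff_divide_distrib)
  moreover have "?d\<^sup>2 / (2 * g\<^sup>2) \<le> c\<^sup>2 / 2 * (P\<^sup>2 / g\<^sup>2) + (4 * c * b * h * \<bar>P\<bar> + 4 * b\<^sup>2 * h\<^sup>2) / (8 * e\<^sup>2)"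
  proof -
    have "P * D \<le> \<bar>P\<bar> * \<bar>D\<bar>" by (metis abs_ge_self abs_mult)
    also have "\<dots> \<le> \<bar>P\<bar> * (2 * b * h)" using D by (intro mult_left_mono) auto
    finally have "2 * c * (P * D) \<le> 2 * c * (\<bar>P\<bar> * (2 * b * h))" using \<open>c \<ge> 0\<close> by (intro mult_left_mono) auto
    moreover have "D\<^sup>2 \<le> (2 * b * h)\<^sup>2"
      using D by (intro abs_le_square_iff[THEN iffD1]) auto
    ultimately have "?d\<^sup>2 \<le> c\<^sup>2 * P\<^sup>2 + (4 * c * b * h * \<bar>P\<bar> + 4 * b\<^sup>2 * h\<^sup>2)"
      by (simp add: power2_eq_square algebra_simps)
    then have "?d\<^sup>2 / (2 * g\<^sup>2) \<le> (c\<^sup>2 * P\<^sup>2 + (4 * c * b * h * \<bar>P\<bar> + 4 * b\<^sup>2 * h\<^sup>2)) / (2 * g\<^sup>2)"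
      by (intro divide_right_mono) auto
    also have "\<dots> = c\<^sup>2 / 2 * (P\<^sup>2 / g\<^sup>2) + (4 * c * b * h * \<bar>P\<bar> + 4 * b\<^sup>2 * h\<^sup>2) / (2 * g\<^sup>2)"
      by (simp add: add_divide_distrib)
    also have "(4 * c * b * h * \<bar>P\<bar> + 4 * b\<^sup>2 * h\<^sup>2) / (2 * g\<^sup>2) \<le> (4 * c * b * h * \<bar>P\<bar> + 4 * b\<^sup>2 * h\<^sup>2) / (8 * e\<^sup>2)"
    proof (rule divide_left_mono)
      have "(2 * e)\<^sup>2 \<le> g\<^sup>2" using e g by (intro power_mono) auto
      then show "8 * e\<^sup>2 \<le> 2 * g\<^sup>2" by (simp add: power_mult_distrib)
    qed (use assms g0 in auto)
    finally show ?thesis by simp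
  qed
  moreover have "?C * \<bar>?d\<bar> ^ 3 \<le> ?C * (4 * c ^ 3 * \<bar>P\<bar> ^ 3 + 32 * b ^ 3 * h ^ 3)"
  proof (rule mult_left_mono[OF _ C])
    have "\<bar>?d\<bar> \<le> c * \<bar>P\<bar> + 2 * b * h" using D \<open>c \<ge> 0\<close> by (intro order_trans[OF abs_triangle_ineq] add_mono) (auto simp: abs_mult)
    then have "\<bar>?d\<bar> ^ 3 \<le> (c * \<bar>P\<bar> + 2 * b * h) ^ 3" by (intro power_mono) auto
    also have "\<dots> \<le> 4 * (c * \<bar>P\<bar>) ^ 3 + 4 * (2 * b * h) ^ 3" using assms by (intro cube_add_le) auto
    finally show "\<bar>?d\<bar> ^ 3 \<le> 4 * c ^ 3 * \<bar>P\<bar> ^ 3 + 32 * b ^ 3 * h ^ 3" by (simp add: power_mult_distrib)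
  qed
  moreover have "ln g + ?d / g - ?d\<^sup>2 / (2 * g\<^sup>2) - ?C * \<bar>?d\<bar> ^ 3 \<le> log_clip e K (g + ?d)"
    using e g by (rule log_clip_taylor)
  ultimately show ?thesis unfolding lng by linarith
qed

lemma trunc_drift_measurable:
  assumes f: "\<And>j. j \<in> {1..N} \<Longrightarrow> (\<lambda>\<omega>. f \<omega> j) \<in> borel_measurable A"
    and V: "deriv V \<in> borel_measurable borel" and i: "i \<in> {1..N}"
  shows "(\<lambda>\<omega>. trunc_drift N V r (f \<omega>) i) \<in> borel_measurable A"
proof -
  have "(\<lambda>\<omega>. repulsion r (f \<omega>) i j) \<in> borel_measurable A" if "j \<in> {1..N} - {i}" for j
    using that i f[of j] f[of i] unfolding repulsion_def by (cases "j < i"; cases "i < j") auto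
  moreover have "(\<lambda>\<omega>. deriv V (clip r (f \<omega> i))) \<in> borel_measurable A"
    unfolding clip_def
    by (intro measurable_compose[OF _ V] borel_measurable_max borel_measurable_min borel_measurable_const f i)
  ultimately show ?thesis unfolding trunc_drift_def
    by (intro borel_measurable_diff borel_measurable_times borel_measurable_sum borel_measurable_const)
qed

text \<open>Continuity of \<open>V'\<close> serves measurability, the local Lipschitz bound serves
  both the truncated equation and the generator estimate, and the growth bound serves
  non-explosion.\<close>

locale dyson_setup = filtered_brownian M G N B
  for M :: "'a measure" and G N B +
  fixes V :: "real \<Rightarrow> real" and \<beta> \<gamma> :: real and x\<^sub>0 :: "nat \<Rightarrow> real"
  assumes N: "N \<ge> 1" and \<beta>: "\<beta> \<ge> 1" and \<gamma>: "\<gamma> > 0"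
    and x0: "(i, j) \<in> pairs N \<Longrightarrow> x\<^sub>0 i < x\<^sub>0 j"
    and continuous_V': "continuous_on UNIV (deriv V)"
    and lipschitz_V': "r > 0 \<Longrightarrow> \<exists>K\<ge>0. \<forall>a b. \<bar>a\<bar> \<le> r \<and> \<bar>b\<bar> \<le> r \<longrightarrow> \<bar>deriv V a - deriv V b\<bar> \<le> K * \<bar>a - b\<bar>"
    and confining: "- u * deriv V u \<le> \<gamma> * (1 + \<bar>u\<bar>\<^sup>2)"
begin

definition \<sigma> :: real where "\<sigma> = sqrt (2 / (\<beta> * real N))"

text \<open>The initial value belongs to the driving path, because \<open>solves\<close> carries no
  separate initial condition.\<close>

definition noise :: "'a \<Rightarrow> real \<Rightarrow> nat \<Rightarrow> real" where
  "noise \<omega> t i = x\<^sub>0 i + \<sigma> * B t \<omega> i"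

abbreviation drift :: "real \<Rightarrow> (nat \<Rightarrow> real) \<Rightarrow> nat \<Rightarrow> real" where
  "drift \<equiv> trunc_drift N V"

definition X :: "real \<Rightarrow> real \<Rightarrow> 'a \<Rightarrow> nat \<Rightarrow> real" where
  "X r t \<omega> = lipschitz_drift.solution (drift r) (noise \<omega>) t"

lemma \<sigma>_nonneg: "\<sigma> \<ge> 0" and \<sigma>_square: "\<sigma>\<^sup>2 = 2 / (\<beta> * real N)"
  using N \<beta> by (auto simp: \<sigma>_def)

lemma V'_measurable: "deriv V \<in> borel_measurable borel"
  using continuous_V' by (rule borel_measurable_continuous_onI)

lemma lipschitz_trunc_drift:
  assumes "r > 0"
  obtains L b where "trunc_lipschitz N V r L b" "b \<ge> 0"
proof -
  obtain K where "K \<ge> 0" "\<And>a b. \<bar>a\<bar> \<le> r \<Longrightarrow> \<bar>b\<bar> \<le> r \<Longrightarrow> \<bar>deriv V a - deriv V b\<bar> \<le> K * \<bar>a - b\<bar>"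
    using lipschitz_V'[OF assms] by blast
  then have "trunc_lipschitz N V r (2 * r\<^sup>2 + K) (r + \<bar>deriv V 0\<bar> + K * r)"
    by (intro trunc_drift_lipschitz_drift assms N)
  moreover have "r + \<bar>deriv V 0\<bar> + K * r \<ge> 0" using assms \<open>K \<ge> 0\<close> by simp
  ultimately show ?thesis by (rule that)
qed

lemma continuous_on_noise:
  "\<omega> \<in> space M \<Longrightarrow> i \<in> {1..N} \<Longrightarrow> continuous_on {0..} (\<lambda>t. noise \<omega> t i)"
  unfolding noise_def by (intro continuous_intros continuous_paths)

lemma X_solves:
  assumes "r > 0" "\<omega> \<in> space M"
  shows "trunc_solves N V r (noise \<omega>) T (\<lambda>t. X r t \<omega>)"
proof -
  obtain L b where "trunc_lipschitz N V r L b" using lipschitz_trunc_drift[OF assms(1)] .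
  then interpret lipschitz_drift "{1..N}" "drift r" L b .
  show ?thesis unfolding X_def by (rule solves_solution) (rule continuous_on_noise[OF assms(2)])
qed

lemma
  assumes "r > 0" "\<omega> \<in> space M" "i \<in> {1..N}"
  shows continuous_on_X: "continuous_on {0..T} (\<lambda>t. X r t \<omega> i)"
    and continuous_on_drift_X: "continuous_on {0..T} (\<lambda>t. drift r (X r t \<omega>) i)"
    and X_eq: "t \<ge> 0 \<Longrightarrow> X r t \<omega> i = noise \<omega> t i + integral {0..t} (\<lambda>s. drift r (X r s \<omega>) i)"
proof -
  obtain L b where "trunc_lipschitz N V r L b" using lipschitz_trunc_drift[OF assms(1)] .
  then interpret lipschitz_drift "{1..N}" "drift r" L b .
  note sol = X_solves[OF assms(1,2), unfolded solves_def]
  have *: "continuous_on {0..T} (\<lambda>t. X r t \<omega> i)" if "i \<in> {1..N}" for T i using sol[of T] that by blast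
  show "continuous_on {0..T} (\<lambda>t. X r t \<omega> i)" by (rule *[OF assms(3)])
  show "continuous_on {0..T} (\<lambda>t. drift r (X r t \<omega>) i)"
    by (rule continuous_on_drift) (use * assms in auto)
  show "X r t \<omega> i = noise \<omega> t i + integral {0..t} (\<lambda>s. drift r (X r s \<omega>) i)" if "t \<ge> 0"
    using sol[of t] assms that by force
qed

lemma X_0: "r > 0 \<Longrightarrow> \<omega> \<in> space M \<Longrightarrow> i \<in> {1..N} \<Longrightarrow> X r 0 \<omega> i = x\<^sub>0 i"
  using X_eq[of r \<omega> i 0] start by (simp add: noise_def)

text \<open>A Picard iterate at time \<open>t\<close> uses the noise up to \<open>t\<close> only,
  and it converges on every path, so adaptedness passes to the limit.\<close>

lemma X_measurable:
  assumes r: "r > 0" and t: "t \<ge> 0" and i: "i \<in> {1..N}"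
  shows "(\<lambda>\<omega>. X r t \<omega> i) \<in> borel_measurable (G t)"
proof -
  obtain L b where "trunc_lipschitz N V r L b" using lipschitz_trunc_drift[OF r] .
  then interpret lipschitz_drift "{1..N}" "drift r" L b .
  have noise: "(\<lambda>\<omega>. noise \<omega> t i) \<in> borel_measurable (G t)" if "t \<ge> 0" "i \<in> {1..N}" for t i
    unfolding noise_def using B_measurable[OF that] by measurable
  have picard: "(\<lambda>\<omega>. picard (noise \<omega>) k t i) \<in> borel_measurable (G t)" if "t \<ge> 0" "i \<in> {1..N}" for k t i
    using that
  proof (induction k arbitrary: t i)
    case (Suc k)
    have "(\<lambda>\<omega>. integral {0..t} (\<lambda>s. drift r (picard (noise \<omega>) k s) i)) \<in> borel_measurable (G t)"
    proof (rule borel_measurable_integral_path[OF Suc.prems(1)])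
      fix s assume s: "s \<in> {0..t}"
      have "(\<lambda>\<omega>. drift r (picard (noise \<omega>) k s) i) \<in> borel_measurable (G s)"
        using s by (intro trunc_drift_measurable V'_measurable Suc.IH Suc.prems) auto
      then show "(\<lambda>\<omega>. drift r (picard (noise \<omega>) k s) i) \<in> borel_measurable (G t)"
        using s by (intro measurable_G_mono[of s t]) auto
    next
      fix \<omega> assume "\<omega> \<in> space (G t)"
      then have \<omega>: "\<omega> \<in> space M" using space_G[OF Suc.prems(1)] by simp
      show "continuous_on {0..t} (\<lambda>s. drift r (picard (noise \<omega>) k s) i)"
        by (intro continuous_on_drift continuous_on_picard continuous_on_noise[OF \<omega>] Suc.prems)
    qed
    then show ?case using noise[OF Suc.prems] by simp
  qed (simp add: noise)
  show ?thesis
  proof (rule borel_measurable_LIMSEQ_real[OF _ picard[OF t i]])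
    fix \<omega> assume "\<omega> \<in> space (G t)"
    then have \<omega>: "\<omega> \<in> space M" using space_G[OF t] by simp
    show "(\<lambda>k. picard (noise \<omega>) k t i) \<longlonglongrightarrow> X r t \<omega> i"
      unfolding X_def by (rule picard_tendsto[OF continuous_on_noise[OF \<omega>] t i])
  qed
qed

lemma X_increment:
  assumes r: "r > 0" and \<omega>: "\<omega> \<in> space M" and i: "i \<in> {1..N}" and st: "0 \<le> s" "s \<le> t"
  shows "X r t \<omega> i - X r s \<omega> i - \<sigma> * (B t \<omega> i - B s \<omega> i)
     = integral {s..t} (\<lambda>u. drift r (X r u \<omega>) i)"
proof -
  have "integral {0..s} (\<lambda>u. drift r (X r u \<omega>) i) + integral {s..t} (\<lambda>u. drift r (X r u \<omega>) i)
      = integral {0..t} (\<lambda>u. drift r (X r u \<omega>) i)"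
    using st by (intro Henstock_Kurzweil_Integration.integral_combine integrable_continuous_interval
      continuous_on_drift_X[OF r \<omega> i])
  then show ?thesis
    using X_eq[OF r \<omega> i, of t] X_eq[OF r \<omega> i, of s] st by (simp add: noise_def algebra_simps)
qed

end

text \<open>Optional stopping in deterministic form: the condition on all \<open>l \<le> k\<close>
  freezes the sum at the first index where \<open>P\<close> fails, or at \<open>m\<close> if there
  is none before. For \<open>n = m\<close> it stays open whether \<open>P m\<close> holds.\<close>

lemma stopped_sum:
  fixes f :: "nat \<Rightarrow> real"
  shows "\<exists>n\<le>m. f 0 + (\<Sum>k<m. if \<forall>l\<le>k. P l then f (Suc k) - f k else 0) = f n \<and> (\<forall>l<n. P l) \<and> (n < m \<longrightarrow> \<not> P n)"
proof (induction m)
  case (Suc m)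
  then obtain n where n: "n \<le> m" "f 0 + (\<Sum>k<m. if \<forall>l\<le>k. P l then f (Suc k) - f k else 0) = f n"
    "\<forall>l<n. P l" "n < m \<longrightarrow> \<not> P n" by blast
  show ?case
  proof (cases "\<forall>l\<le>m. P l")
    case True
    then have "n = m" using n by (meson le_eq_less_or_eq)
    then show ?thesis using True n(2) by (intro exI[of _ "Suc m"]) (auto simp: less_Suc_eq_le)
  next
    case False
    then have "\<not> P n" using n by (metis le_eq_less_or_eq le_neq_implies_less)
    moreover have "\<not> (\<forall>l\<le>m. P l)" by (rule False)
    ultimately show ?thesis using n by (intro exI[of _ n]) (auto simp del: not_all)
  qed
qed auto

section \<open>The logarithmic potential over one grid step\<close>

context dyson_setup
begin

text \<open>With \<open>e = 1 / r\<close> the gaps are kept at twice the truncation level, so a step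
  that takes a gap below \<open>e\<close> must have size at least \<open>e\<close> and is paid for
  by the cubic remainder. In a safe state with \<open>R \<le> r\<close> the drift is not truncated,
  and for \<open>K = 2 * R + 1\<close> the logarithms are not clipped.\<close>

definition safe :: "real \<Rightarrow> real \<Rightarrow> (nat \<Rightarrow> real) \<Rightarrow> bool" where
  "safe e R x \<longleftrightarrow> (\<forall>i\<in>{1..N}. \<bar>x i\<bar> \<le> R) \<and> (\<forall>(i, j)\<in>pairs N. 2 * e \<le> x j - x i)"

definition potential :: "real \<Rightarrow> real \<Rightarrow> (nat \<Rightarrow> real) \<Rightarrow> real" where
  "potential e K x = - (\<Sum>(i, j)\<in>pairs N. log_clip e K (x j - x i))"

lemma pairsD: "(i, j) \<in> pairs N \<Longrightarrow> i \<in> {1..N}" "(i, j) \<in> pairs N \<Longrightarrow> j \<in> {1..N}"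
  by (auto simp: pairs_def)

lemma pairs_mem: "p \<in> pairs N \<Longrightarrow> fst p \<in> {1..N}" "p \<in> pairs N \<Longrightarrow> snd p \<in> {1..N}"
  by (auto simp: pairs_def)

lemma safe_measurable:
  assumes Z: "\<And>i. i \<in> {1..N} \<Longrightarrow> (\<lambda>\<omega>. Z \<omega> i) \<in> borel_measurable A"
  shows "{\<omega> \<in> space A. safe e R (Z \<omega>)} \<in> sets A"
proof -
  have "{\<omega> \<in> space A. \<forall>i\<in>{1..N}. \<bar>Z \<omega> i\<bar> \<le> R} \<in> sets A"
    by (intro sets.sets_Collect_finite_All borel_measurable_le borel_measurable_abs borel_measurable_const Z) auto
  moreover have "{\<omega> \<in> space A. \<forall>p\<in>pairs N. 2 * e \<le> Z \<omega> (snd p) - Z \<omega> (fst p)} \<in> sets A"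
    by (intro sets.sets_Collect_finite_All borel_measurable_le borel_measurable_diff borel_measurable_const Z
        pairs_mem finite_pairs)
  ultimately have "{\<omega> \<in> space A. (\<forall>i\<in>{1..N}. \<bar>Z \<omega> i\<bar> \<le> R) \<and> (\<forall>p\<in>pairs N. 2 * e \<le> Z \<omega> (snd p) - Z \<omega> (fst p))} \<in> sets A"
    by (intro sets.sets_Collect_conj)
  then show ?thesis unfolding safe_def by (simp add: case_prod_unfold)
qed

lemma potential_measurable:
  assumes Z: "\<And>i. i \<in> {1..N} \<Longrightarrow> (\<lambda>\<omega>. Z \<omega> i) \<in> borel_measurable A"
  shows "(\<lambda>\<omega>. potential e K (Z \<omega>)) \<in> borel_measurable A"
  unfolding potential_def log_clip_def case_prod_unfold
  by (intro borel_measurable_uminus borel_measurable_sum borel_measurable_ln borel_measurable_max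
      borel_measurable_min borel_measurable_diff borel_measurable_const Z) (auto simp: pairs_def)

lemma potential_bounded:
  assumes "0 < e" "e \<le> K"
  shows "\<bar>potential e K x\<bar> \<le> real (card (pairs N)) * (\<bar>ln e\<bar> + \<bar>ln K\<bar>)"
proof -
  have "\<bar>log_clip e K y\<bar> \<le> \<bar>ln e\<bar> + \<bar>ln K\<bar>" for y using log_clip_bounds[OF assms, of y] by linarith
  then show ?thesis unfolding potential_def abs_minus_cancel
    by (intro order_trans[OF sum_abs] sum_bounded_above) auto
qed

lemma X_measurable_M: "r > 0 \<Longrightarrow> t \<ge> 0 \<Longrightarrow> i \<in> {1..N} \<Longrightarrow> (\<lambda>\<omega>. X r t \<omega> i) \<in> borel_measurable M"
  by (rule measurable_from_subalg[OF subalgebra_G X_measurable])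

text \<open>Summing over all particles gives a single random variable that serves as
  \<open>U\<close> in \<open>log_gap_step\<close> for every pair.\<close>

definition drift_error :: "real \<Rightarrow> real \<Rightarrow> real \<Rightarrow> 'a \<Rightarrow> real" where
  "drift_error r s h \<omega> = (\<Sum>i\<in>{1..N}. \<bar>integral {s..s + h} (\<lambda>u. drift r (X r u \<omega>) i)
     - h * drift r (X r s \<omega>) i\<bar>)"

lemma
  assumes r: "r > 0" and b: "trunc_lipschitz N V r L b" and sh: "s \<ge> 0" "h \<ge> 0"
  shows drift_error_measurable: "drift_error r s h \<in> borel_measurable M"
    and drift_error_bounded: "\<omega> \<in> space M \<Longrightarrow> \<bar>drift_error r s h \<omega>\<bar> \<le> real N * (2 * b * h)"
    and drift_integral_bounded: "\<omega> \<in> space M \<Longrightarrow> i \<in> {1..N} \<Longrightarrow>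
      \<bar>integral {s..s + h} (\<lambda>u. drift r (X r u \<omega>) i)\<bar> \<le> b * h"
proof -
  interpret d: lipschitz_drift "{1..N}" "drift r" L b by (rule b)
  show *: "\<bar>integral {s..s + h} (\<lambda>u. drift r (X r u \<omega>) i)\<bar> \<le> b * h"
    if "\<omega> \<in> space M" "i \<in> {1..N}" for \<omega> i
  proof -
    have "norm (integral {s..s + h} (\<lambda>u. drift r (X r u \<omega>) i)) \<le> b * (s + h - s)"
      using sh d.bounded[OF that(2)]
      by (intro integral_bound continuous_on_subset[OF continuous_on_drift_X[OF r that, of "s + h"]]) auto
    then show ?thesis by simp
  qed
  show "\<bar>drift_error r s h \<omega>\<bar> \<le> real N * (2 * b * h)" if \<omega>: "\<omega> \<in> space M"
  proof -
    have "\<bar>\<bar>integral {s..s + h} (\<lambda>u. drift r (X r u \<omega>) i) - h * drift r (X r s \<omega>) i\<bar>\<bar> \<le> 2 * b * h"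
      if i: "i \<in> {1..N}" for i
    proof -
      have "\<bar>h * drift r (X r s \<omega>) i\<bar> \<le> h * b"
        using d.bounded[OF i, of "X r s \<omega>"] sh unfolding abs_mult by (intro mult_mono) auto
      then have "\<bar>h * drift r (X r s \<omega>) i\<bar> \<le> b * h" by (simp only: mult.commute)
      then show ?thesis using *[OF \<omega> i] unfolding abs_idempotent mult.assoc by linarith
    qed
    then have "\<bar>drift_error r s h \<omega>\<bar> \<le> real (card {1..N}) * (2 * b * h)"
      unfolding drift_error_def by (intro order_trans[OF sum_abs] sum_bounded_above)
    then show ?thesis by simp
  qed
  have BM: "(\<lambda>\<omega>. B t \<omega> i) \<in> borel_measurable M" if "t \<ge> 0" "i \<in> {1..N}" for t i
    using that by (intro measurable_from_subalg[OF subalgebra_G B_measurable])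
  \<comment> \<open>By \<open>X_increment\<close> the drift integral is an expression in the process
    and the Brownian motion at the two end points, which makes its measurability immediate.\<close>
  have "(\<lambda>\<omega>. \<Sum>i\<in>{1..N}. \<bar>X r (s + h) \<omega> i - X r s \<omega> i - \<sigma> * (B (s + h) \<omega> i - B s \<omega> i)
     - h * drift r (X r s \<omega>) i\<bar>) \<in> borel_measurable M"
    using sh by (intro borel_measurable_sum borel_measurable_abs borel_measurable_diff borel_measurable_times
        borel_measurable_const X_measurable_M r BM trunc_drift_measurable V'_measurable) auto
  also have "?this \<longleftrightarrow> drift_error r s h \<in> borel_measurable M"
    unfolding drift_error_def using sh
    by (intro measurable_cong sum.cong refl) (simp add: X_increment[OF r])
  finally show "drift_error r s h \<in> borel_measurable M" .
qed

text \<open>The expected deterministic error of \<open>log_gap_step\<close> per unit of time, after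
  inserting \<open>2 * sqrt h\<close> and \<open>16 * sqrt h ^ 3\<close> for the first and third
  absolute moments of the gap increment. Every term carries a positive power of
  \<open>h\<close>.\<close>

definition step_error :: "real \<Rightarrow> real \<Rightarrow> real \<Rightarrow> real \<Rightarrow> real" where
  "step_error e K b h = (8 * \<sigma> * b * sqrt h + 4 * b\<^sup>2 * h) / (8 * e\<^sup>2)
     + (1 / e ^ 3 + 1 / e + (ln K - ln e) / e ^ 3) * (64 * \<sigma> ^ 3 * sqrt h + 32 * b ^ 3 * h\<^sup>2)"

text \<open>The supermartingale inequality, with compensator \<open>C / 2\<close> per pair and
  errors that vanish after summation over the grid. \<open>A\<close> stands for the event that the
  process has not been stopped by time \<open>s\<close>; being known at that time, it may multiply
  the increment.\<close>

lemma potential_step: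
  assumes r: "r > 0" and R: "0 < R" "R \<le> r" and K: "K = 2 * R + 1" and rK: "1 / r \<le> K" and sh: "s \<ge> 0" "h > 0"
    and b: "trunc_lipschitz N V r L b" "b \<ge> 0"
    and C: "C \<ge> 0" "\<And>a b. \<bar>a\<bar> \<le> R \<Longrightarrow> \<bar>b\<bar> \<le> R \<Longrightarrow> \<bar>deriv V a - deriv V b\<bar> \<le> C * \<bar>a - b\<bar>"
    and A: "A \<in> sets (G s)" "\<And>\<omega>. \<omega> \<in> A \<Longrightarrow> safe (1 / r) R (X r s \<omega>)"
  shows "expectation (\<lambda>\<omega>. indicator A \<omega> * (potential (1 / r) K (X r (s + h) \<omega>) - potential (1 / r) K (X r s \<omega>)))
     \<le> real (card (pairs N)) * (h * (C / 2) + h * step_error (1 / r) K b h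
           + expectation (drift_error r s h) / (2 * (1 / r)))"
proof -
  define e where "e = 1 / r"
  have e: "e > 0" "e \<le> K" using r rK by (auto simp: e_def)
  define c3 where "c3 = 1 / e ^ 3 + 1 / e + (ln K - ln e) / e ^ 3"
  have c3: "c3 \<ge> 0" using e by (auto simp: c3_def intro!: add_nonneg_nonneg)
  define P where "P p = gap_increment s (s + h) (fst p) (snd p)" for p
  define g where "g p \<omega> = X r s \<omega> (snd p) - X r s \<omega> (fst p)" for p \<omega>
  define a where "a p \<omega> = drift r (X r s \<omega>) (snd p) - drift r (X r s \<omega>) (fst p)" for p \<omega>
  \<comment> \<open>Building the indicator of \<open>A\<close> into the weights makes them bounded,
    since gaps are at least \<open>2 * e\<close> on \<open>A\<close>, and keeps them known at time
    \<open>s\<close>, as \<open>gap_increment_independent\<close> demands.\<close>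
  define Y1 where "Y1 p \<omega> = indicator A \<omega> / g p \<omega>" for p \<omega>
  define Y2 where "Y2 p \<omega> = indicator A \<omega> / (g p \<omega>)\<^sup>2" for p \<omega>
  define Y3 where "Y3 p \<omega> = indicator A \<omega> * (a p \<omega> / g p \<omega>)" for p \<omega>
  define E where "E p \<omega> = drift_error r s h \<omega> / (2 * e)
      + (4 * \<sigma> * b * h * \<bar>P p \<omega>\<bar> + 4 * b\<^sup>2 * h\<^sup>2) / (8 * e\<^sup>2) + c3 * (4 * \<sigma> ^ 3 * \<bar>P p \<omega>\<bar> ^ 3 + 32 * b ^ 3 * h ^ 3)" for p \<omega>
  let ?Q = "\<lambda>p \<omega>. - \<sigma> * (Y1 p \<omega> * P p \<omega>) + \<sigma>\<^sup>2 / 2 * (Y2 p \<omega> * (P p \<omega>)\<^sup>2) - h * Y3 p \<omega> + E p \<omega>"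
  let ?D = "\<lambda>\<omega>. indicator A \<omega> * (potential e K (X r (s + h) \<omega>) - potential e K (X r s \<omega>))"
  interpret d: lipschitz_drift "{1..N}" "drift r" L b by (rule b)
  have sG: "space (G s) = space M" using sh by (intro space_G)
  have A_sub: "A \<subseteq> space M" using sets.sets_into_space[OF A(1)] sG by simp
  have st: "0 \<le> s" "s < s + h" using sh by auto
  have p1: "fst p \<in> {1..N}" and p2: "snd p \<in> {1..N}" and p3: "(fst p, snd p) \<in> pairs N" if "p \<in> pairs N" for p
    using that by (auto simp: pairs_def)
  note mom = gap_increment_moments[OF st p3, folded P_def]
  have gA: "2 * e \<le> g p \<omega>" if "\<omega> \<in> A" "p \<in> pairs N" for p \<omega>
    using A(2)[OF that(1)] that(2) by (auto simp: safe_def g_def e_def)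
  have gK: "g p \<omega> + 1 \<le> K" if "\<omega> \<in> A" "p \<in> pairs N" for p \<omega>
  proof -
    have "\<bar>X r s \<omega> (fst p)\<bar> \<le> R" "\<bar>X r s \<omega> (snd p)\<bar> \<le> R"
      using A(2)[OF that(1)] p1[OF that(2)] p2[OF that(2)] unfolding safe_def by blast+
    then show ?thesis by (auto simp: g_def K)
  qed
  have gm: "g p \<in> borel_measurable (G s)" and am: "a p \<in> borel_measurable (G s)" if "p \<in> pairs N" for p
    unfolding g_def a_def
    by (intro borel_measurable_diff X_measurable trunc_drift_measurable V'_measurable r sh p1 p2 that)+
  have indm: "(\<lambda>\<omega>. indicator A \<omega> :: real) \<in> borel_measurable (G s)"
    by (rule borel_measurable_indicator[OF A(1)])
  have Y1m: "Y1 p \<in> borel_measurable (G s)" and Y2m: "Y2 p \<in> borel_measurable (G s)" and Y3m: "Y3 p \<in> borel_measurable (G s)"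
    if "p \<in> pairs N" for p
    unfolding Y1_def Y2_def Y3_def
    by (intro borel_measurable_divide borel_measurable_times borel_measurable_power indm gm am that)+
  have toM: "f \<in> borel_measurable M" if "f \<in> borel_measurable (G s)" for f :: "'a \<Rightarrow> real"
    using that by (rule measurable_from_subalg[OF subalgebra_G[OF sh(1)]])
  have Y1b: "\<bar>Y1 p \<omega>\<bar> \<le> 1 / (2 * e)" and Y2b: "\<bar>Y2 p \<omega>\<bar> \<le> 1 / (2 * e)\<^sup>2" and Y3b: "\<bar>Y3 p \<omega>\<bar> \<le> 2 * b / (2 * e)"
    if p: "p \<in> pairs N" for p \<omega>
  proof -
    have "\<bar>a p \<omega>\<bar> \<le> 2 * b"
      using d.bounded[OF p1[OF p], of "X r s \<omega>"] d.bounded[OF p2[OF p], of "X r s \<omega>"] unfolding a_def by linarith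
    then have "\<bar>a p \<omega>\<bar> / \<bar>g p \<omega>\<bar> \<le> 2 * b / (2 * e)" if "\<omega> \<in> A"
      using gA[OF that p] e b(2) by (intro frac_le) auto
    then show "\<bar>Y3 p \<omega>\<bar> \<le> 2 * b / (2 * e)"
      using e b(2) by (auto simp: Y3_def abs_divide split: split_indicator)
    have "1 / \<bar>g p \<omega>\<bar> \<le> 1 / (2 * e)" "1 / (g p \<omega>)\<^sup>2 \<le> 1 / (2 * e)\<^sup>2" if "\<omega> \<in> A"
    proof -
      have g: "2 * e \<le> g p \<omega>" by (rule gA[OF that p])
      then have "(2 * e)\<^sup>2 \<le> (g p \<omega>)\<^sup>2" using e by (intro power_mono) auto
      then show "1 / (g p \<omega>)\<^sup>2 \<le> 1 / (2 * e)\<^sup>2" using e by (intro frac_le) auto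
      show "1 / \<bar>g p \<omega>\<bar> \<le> 1 / (2 * e)" using g e by (intro frac_le) auto
    qed
    then show "\<bar>Y1 p \<omega>\<bar> \<le> 1 / (2 * e)" "\<bar>Y2 p \<omega>\<bar> \<le> 1 / (2 * e)\<^sup>2"
      using e by (auto simp: Y1_def Y2_def abs_divide split: split_indicator)
  qed
  have int2: "integrable M (Y2 p)" and int3: "integrable M (Y3 p)" if "p \<in> pairs N" for p
    by (rule integrable_const_bound[OF AE_I2], simp only: real_norm_def, rule Y2b[OF that], rule toM[OF Y2m[OF that]],
        rule integrable_const_bound[OF AE_I2], simp only: real_norm_def, rule Y3b[OF that], rule toM[OF Y3m[OF that]])
  have int1P: "integrable M (\<lambda>\<omega>. Y1 p \<omega> * P p \<omega>)" "expectation (\<lambda>\<omega>. Y1 p \<omega> * P p \<omega>) = 0" if "p \<in> pairs N" for p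
    using gap_increment_independent[OF st p3[OF that] Y1m[OF that] Y1b[OF that], of "\<lambda>x. x"] mom(1,2)[OF that]
    unfolding P_def[symmetric] by auto
  have int2P: "integrable M (\<lambda>\<omega>. Y2 p \<omega> * (P p \<omega>)\<^sup>2)" "expectation (\<lambda>\<omega>. Y2 p \<omega> * (P p \<omega>)\<^sup>2) = expectation (Y2 p) * (2 * h)"
    if "p \<in> pairs N" for p
    using gap_increment_independent[OF st p3[OF that] Y2m[OF that] Y2b[OF that], of "\<lambda>x. x\<^sup>2"] mom(3,4)[OF that]
    unfolding P_def[symmetric] by auto
  have DE: "integrable M (drift_error r s h)"
    using drift_error_measurable[OF r b(1) sh(1)] drift_error_bounded[OF r b(1) sh(1)] sh(2)
    by (intro integrable_const_bound[where B="real N * (2 * b * h)"]) auto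
  have Pabs: "integrable M (\<lambda>\<omega>. \<bar>P p \<omega>\<bar>)" if "p \<in> pairs N" for p using mom(1)[OF that] by simp
  have Eint: "integrable M (E p)" if "p \<in> pairs N" for p
    unfolding E_def using DE Pabs[OF that] mom(6)[OF that] by auto
  have Eexp: "expectation (E p) \<le> expectation (drift_error r s h) / (2 * e) + h * step_error e K b h" if "p \<in> pairs N" for p
  proof -
    have "expectation (E p) = expectation (drift_error r s h) / (2 * e)
      + (4 * \<sigma> * b * h * expectation (\<lambda>\<omega>. \<bar>P p \<omega>\<bar>) + 4 * b\<^sup>2 * h\<^sup>2) / (8 * e\<^sup>2)
      + c3 * (4 * \<sigma> ^ 3 * expectation (\<lambda>\<omega>. \<bar>P p \<omega>\<bar> ^ 3) + 32 * b ^ 3 * h ^ 3)"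
      unfolding E_def using DE Pabs[OF that] mom(6)[OF that] by (simp add: prob_space)
    also have "\<dots> \<le> expectation (drift_error r s h) / (2 * e)
      + (4 * \<sigma> * b * h * (2 * sqrt h) + 4 * b\<^sup>2 * h\<^sup>2) / (8 * e\<^sup>2)
      + c3 * (4 * \<sigma> ^ 3 * (16 * sqrt h ^ 3) + 32 * b ^ 3 * h ^ 3)"
      using mom(5)[OF that] mom(7)[OF that] \<sigma>_nonneg b(2) sh c3
      by (intro add_mono divide_right_mono mult_left_mono order_refl mult_nonneg_nonneg) auto
    also have "\<dots> = expectation (drift_error r s h) / (2 * e) + h * step_error e K b h"
    proof -
      have sq: "sqrt h ^ 3 = h * sqrt h" using sh by (simp add: power3_eq_cube)
      have "(4 * \<sigma> * b * h * (2 * sqrt h) + 4 * b\<^sup>2 * h\<^sup>2) / (8 * e\<^sup>2) = h * ((8 * \<sigma> * b * sqrt h + 4 * b\<^sup>2 * h) / (8 * e\<^sup>2))"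
        by (simp add: power2_eq_square algebra_simps)
      moreover have "c3 * (4 * \<sigma> ^ 3 * (16 * sqrt h ^ 3) + 32 * b ^ 3 * h ^ 3)
          = h * (c3 * (64 * \<sigma> ^ 3 * sqrt h + 32 * b ^ 3 * h\<^sup>2))"
        unfolding sq by (simp add: power2_eq_square power3_eq_cube algebra_simps)
      ultimately show ?thesis unfolding step_error_def c3_def[symmetric] by (simp add: distrib_left)
    qed
    finally show ?thesis .
  qed
  have pointwise: "?D \<omega>
      \<le> (\<Sum>p\<in>pairs N. ?Q p \<omega>)"
    if \<omega>: "\<omega> \<in> space M" for \<omega>
  proof (cases "\<omega> \<in> A")
    case False
    \<comment> \<open>\<open>E\<close> carries no indicator, so off \<open>A\<close> the claim is
      just that the error is nonnegative.\<close>
    have "E p \<omega> \<ge> 0" for p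
      unfolding E_def drift_error_def using \<sigma>_nonneg b(2) sh e c3
      by (intro add_nonneg_nonneg mult_nonneg_nonneg divide_nonneg_nonneg sum_nonneg) auto
    then show ?thesis using False by (simp add: Y1_def Y2_def Y3_def sum_nonneg)
  next
    case True
    have "log_clip e K (g p \<omega>) - log_clip e K (X r (s + h) \<omega> (snd p) - X r (s + h) \<omega> (fst p))
        \<le> ?Q p \<omega>"
      if p: "p \<in> pairs N" for p
    proof -
      define D where "D i = integral {s..s + h} (\<lambda>u. drift r (X r u \<omega>) i)" for i
      let ?t = "drift r (X r s \<omega>)"
      have D: "X r (s + h) \<omega> i = X r s \<omega> i + \<sigma> * (B (s + h) \<omega> i - B s \<omega> i) + D i" if "i \<in> {1..N}" for i
        using X_increment[OF r \<omega> that st(1), of "s + h"] sh unfolding D_def by simp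
      have "X r (s + h) \<omega> (snd p) - X r (s + h) \<omega> (fst p) = g p \<omega> + (\<sigma> * P p \<omega> + (D (snd p) - D (fst p)))"
        using p1[OF p] p2[OF p] unfolding D[OF p1[OF p]] D[OF p2[OF p]]
          P_def gap_increment_def[OF st]
        by (simp add: g_def increment_def algebra_simps)
      moreover have "\<bar>D (snd p) - D (fst p)\<bar> \<le> 2 * b * h"
        using drift_integral_bounded[OF r b(1) sh(1) less_imp_le[OF sh(2)] \<omega> p1[OF p]]
          drift_integral_bounded[OF r b(1) sh(1) less_imp_le[OF sh(2)] \<omega> p2[OF p]] unfolding D_def by linarith
      moreover have "\<bar>(D (snd p) - D (fst p)) - h * a p \<omega>\<bar> \<le> drift_error r s h \<omega>"
      proof -
        have neq: "fst p \<noteq> snd p" using p by (auto simp: pairs_def)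
        have "\<bar>(D (snd p) - D (fst p)) - h * a p \<omega>\<bar> \<le> \<bar>D (fst p) - h * ?t (fst p)\<bar> + \<bar>D (snd p) - h * ?t (snd p)\<bar>"
          unfolding a_def right_diff_distrib by linarith
        also have "\<dots> = (\<Sum>i\<in>{fst p, snd p}. \<bar>D i - h * ?t i\<bar>)" using neq by simp
        also have "\<dots> \<le> (\<Sum>i\<in>{1..N}. \<bar>D i - h * ?t i\<bar>)"
          using p1[OF p] p2[OF p] by (intro sum_mono2) auto
        finally show ?thesis unfolding drift_error_def D_def .
      qed
      ultimately have "log_clip e K (g p \<omega>) - log_clip e K (X r (s + h) \<omega> (snd p) - X r (s + h) \<omega> (fst p))
        \<le> - (\<sigma> * (P p \<omega> / g p \<omega>)) + \<sigma>\<^sup>2 / 2 * ((P p \<omega>)\<^sup>2 / (g p \<omega>)\<^sup>2) - h * (a p \<omega> / g p \<omega>) + E p \<omega>"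
        using log_gap_step[OF e(1) gA[OF True p] gK[OF True p] \<sigma>_nonneg less_imp_le[OF sh(2)] b(2)]
        unfolding E_def c3_def by simp
      then show ?thesis using True by (simp add: Y1_def Y2_def Y3_def)
    qed
    then have "(\<Sum>p\<in>pairs N. log_clip e K (g p \<omega>) - log_clip e K (X r (s + h) \<omega> (snd p) - X r (s + h) \<omega> (fst p)))
      \<le> (\<Sum>p\<in>pairs N. ?Q p \<omega>)"
      by (rule sum_mono)
    then show ?thesis using True by (simp add: potential_def sum_subtractf g_def case_prod_unfold)
  qed
  \<comment> \<open>On \<open>A\<close> the state is in the good region of level \<open>r\<close>,
    so the truncated drift is the Dyson drift, and
    \<open>\<sigma>\<^sup>2 = 2 / (\<beta> * real N)\<close> gives exactly the generator
    expression.\<close>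
  have gen: "(\<Sum>p\<in>pairs N. \<sigma>\<^sup>2 * Y2 p \<omega> - Y3 p \<omega>) \<le> C / 2 * real (card (pairs N))" for \<omega>
  proof (cases "\<omega> \<in> A")
    case False
    then show ?thesis using C(1) by (simp add: Y2_def Y3_def)
  next
    case True
    let ?x = "X r s \<omega>"
    have safe: "safe (1 / r) R ?x" by (rule A(2)[OF True])
    have gap: "2 * (1 / r) \<le> ?x j - ?x i" if "(i, j) \<in> pairs N" for i j
      using safe that unfolding safe_def by blast
    have bd: "\<bar>?x i\<bar> \<le> R" if "i \<in> {1..N}" for i
      using safe that unfolding safe_def by blast
    have "1 / r > 0" using r by simp
    then have gap': "1 / r \<le> ?x j - ?x i" "?x i < ?x j" if "(i, j) \<in> pairs N" for i j
      using gap[OF that] by linarith+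
    have good: "good_region N r ?x"
      unfolding good_region_def using gap' bd R by fastforce
    have "(\<Sum>(i, j)\<in>pairs N. 2 / (\<beta> * real N) / (?x j - ?x i)\<^sup>2
      - (dyson_drift N V ?x j - dyson_drift N V ?x i) / (?x j - ?x i)) \<le> C / 2 * real (card (pairs N))"
    proof (rule generator_log_gap_le[OF N \<beta>])
      fix i j assume ij: "(i, j) \<in> pairs N"
      show "?x i < ?x j" by (rule gap'(2)[OF ij])
      have "\<bar>deriv V (?x j) - deriv V (?x i)\<bar> \<le> C * \<bar>?x j - ?x i\<bar>"
        by (intro C bd pairsD(1)[OF ij] pairsD(2)[OF ij])
      then show "\<bar>deriv V (?x j) - deriv V (?x i)\<bar> \<le> C * (?x j - ?x i)" using gap'(2)[OF ij] by simp
    qed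
    also have "(\<Sum>(i, j)\<in>pairs N. 2 / (\<beta> * real N) / (?x j - ?x i)\<^sup>2
      - (dyson_drift N V ?x j - dyson_drift N V ?x i) / (?x j - ?x i)) = (\<Sum>p\<in>pairs N. \<sigma>\<^sup>2 * Y2 p \<omega> - Y3 p \<omega>)"
      using True trunc_drift_eq_dyson_drift[OF good] p1 p2
      by (intro sum.cong refl) (simp add: case_prod_unfold Y2_def Y3_def g_def a_def \<sigma>_square)
    finally show ?thesis .
  qed
  have bounded_pot: "\<bar>potential e K x\<bar> \<le> real (card (pairs N)) * (\<bar>ln e\<bar> + \<bar>ln K\<bar>)" for x
    by (rule potential_bounded[OF e])
  have "expectation (\<lambda>\<omega>. ?D \<omega>)
     \<le> expectation (\<lambda>\<omega>. \<Sum>p\<in>pairs N. ?Q p \<omega>)"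
  proof (rule integral_mono[OF _ _ pointwise])
    show "integrable M (\<lambda>\<omega>. ?D \<omega>)"
    proof (rule integrable_const_bound[where B="2 * (real (card (pairs N)) * (\<bar>ln e\<bar> + \<bar>ln K\<bar>))"])
      show "AE \<omega> in M. norm (?D \<omega>)
          \<le> 2 * (real (card (pairs N)) * (\<bar>ln e\<bar> + \<bar>ln K\<bar>))"
      proof (intro AE_I2)
        fix \<omega>
        show "norm (?D \<omega>)
          \<le> 2 * (real (card (pairs N)) * (\<bar>ln e\<bar> + \<bar>ln K\<bar>))"
        proof (cases "\<omega> \<in> A")
          case True
          then show ?thesis
            using bounded_pot[of "X r (s + h) \<omega>"] bounded_pot[of "X r s \<omega>"]
            unfolding indicator_simps(1)[OF True] mult_1_left real_norm_def by linarith
        qed simp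
      qed
      show "(\<lambda>\<omega>. ?D \<omega>) \<in> borel_measurable M"
        using sh by (intro borel_measurable_times borel_measurable_diff potential_measurable X_measurable_M r toM[OF indm]) auto
    qed
    show "integrable M (\<lambda>\<omega>. \<Sum>p\<in>pairs N. ?Q p \<omega>)"
      using int1P int2P int3 Eint by (intro Bochner_Integration.integrable_sum) auto
  qed
  also have "\<dots> = (\<Sum>p\<in>pairs N. h * expectation (\<lambda>\<omega>. \<sigma>\<^sup>2 * Y2 p \<omega> - Y3 p \<omega>) + expectation (E p))"
  proof (subst Bochner_Integration.integral_sum)
    show "(\<Sum>p\<in>pairs N. expectation (\<lambda>\<omega>. ?Q p \<omega>))
        = (\<Sum>p\<in>pairs N. h * expectation (\<lambda>\<omega>. \<sigma>\<^sup>2 * Y2 p \<omega> - Y3 p \<omega>) + expectation (E p))"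
    proof (rule sum.cong[OF refl])
      fix p assume p: "p \<in> pairs N"
      show "expectation (\<lambda>\<omega>. ?Q p \<omega>)
        = h * expectation (\<lambda>\<omega>. \<sigma>\<^sup>2 * Y2 p \<omega> - Y3 p \<omega>) + expectation (E p)"
        using int1P[OF p] int2P[OF p] int2[OF p] int3[OF p] Eint[OF p] by (simp, simp add: algebra_simps)
    qed
    show "integrable M (\<lambda>\<omega>. ?Q p \<omega>)"
      if "p \<in> pairs N" for p
      using int1P[OF that] int2P[OF that] int3[OF that] Eint[OF that] by auto
  qed
  also have "\<dots> = h * expectation (\<lambda>\<omega>. \<Sum>p\<in>pairs N. \<sigma>\<^sup>2 * Y2 p \<omega> - Y3 p \<omega>) + (\<Sum>p\<in>pairs N. expectation (E p))"
    using int2 int3 by (subst Bochner_Integration.integral_sum) (auto simp: sum.distrib sum_distrib_left)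
  also have "\<dots> \<le> h * (C / 2 * real (card (pairs N)))
      + (\<Sum>p\<in>pairs N. expectation (drift_error r s h) / (2 * e) + h * step_error e K b h)"
  proof (intro add_mono mult_left_mono sum_mono Eexp)
    show "expectation (\<lambda>\<omega>. \<Sum>p\<in>pairs N. \<sigma>\<^sup>2 * Y2 p \<omega> - Y3 p \<omega>) \<le> C / 2 * real (card (pairs N))"
      using int2 int3 gen by (intro integral_le_const Bochner_Integration.integrable_sum) auto
  qed (use sh in auto)
  also have "\<dots> = real (card (pairs N)) * (h * (C / 2) + h * step_error e K b h + expectation (drift_error r s h) / (2 * e))"
    by (simp add: algebra_simps)
  finally show ?thesis unfolding e_def .
qed

end

section \<open>Absence of collisions\<close>

context dyson_setup
begin

text \<open>At a fixed level the drift is bounded and continuous along each path, so the Riemann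
  errors vanish path by path and dominated convergence applies. No rate, and hence no modulus of
  continuity of Brownian paths, is required.\<close>

lemma drift_error_sum_tendsto_zero:
  assumes r: "r > 0" and T: "T \<ge> 0"
  shows "(\<lambda>n. expectation (\<lambda>\<omega>. \<Sum>k<Suc n. drift_error r (real k * (T / real (Suc n))) (T / real (Suc n)) \<omega>)) \<longlonglongrightarrow> 0"
proof -
  obtain L b where b: "trunc_lipschitz N V r L b" "b \<ge> 0" using lipschitz_trunc_drift[OF r] .
  let ?h = "\<lambda>n. T / real (Suc n)"
  let ?u = "\<lambda>n \<omega>. \<Sum>k<Suc n. drift_error r (real k * ?h n) (?h n) \<omega>"
  have h: "?h n \<ge> 0" for n using T by simp
  have "(\<lambda>n. expectation (?u n)) \<longlonglongrightarrow> expectation (\<lambda>\<omega>. 0)"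
  proof (rule integral_dominated_convergence[where w="\<lambda>_. real N * (2 * b * T)"])
    show "?u n \<in> borel_measurable M" for n
      using T by (intro borel_measurable_sum drift_error_measurable[OF r b(1)]) auto
    show "AE \<omega> in M. norm (?u n \<omega>) \<le> real N * (2 * b * T)" for n
    proof (rule AE_I2)
      fix \<omega> assume \<omega>: "\<omega> \<in> space M"
      have "\<bar>?u n \<omega>\<bar> \<le> real (card {..<Suc n}) * (real N * (2 * b * ?h n))"
        using drift_error_bounded[OF r b(1) _ h \<omega>] T
        by (intro order_trans[OF sum_abs] sum_bounded_above) auto
      also have "\<dots> = real N * (2 * b * T)" by simp
      finally show "norm (?u n \<omega>) \<le> real N * (2 * b * T)" by simp
    qed
    show "AE \<omega> in M. (\<lambda>n. ?u n \<omega>) \<longlonglongrightarrow> 0"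
    proof (rule AE_I2)
      fix \<omega> assume \<omega>: "\<omega> \<in> space M"
      let ?g = "\<lambda>i s. drift r (X r s \<omega>) i"
      let ?v = "\<lambda>n i. \<Sum>k<Suc n. \<bar>integral {real k * ?h n..real (Suc k) * ?h n} (?g i) - ?h n * ?g i (real k * ?h n)\<bar>"
      have "(\<lambda>n. \<Sum>i\<in>{1..N}. ?v n i) \<longlonglongrightarrow> (\<Sum>i\<in>{1..N}. 0)"
        by (intro tendsto_sum riemann_error_tendsto_zero[OF T] continuous_on_drift_X[OF r \<omega>])
      moreover have "(\<Sum>i\<in>{1..N}. ?v n i) = ?u n \<omega>" for n
      proof -
        have "real (Suc k) * ?h n = real k * ?h n + ?h n" for k by (simp only: of_nat_Suc distrib_right mult_1_left)
        then show ?thesis unfolding drift_error_def by (subst sum.swap) (simp only:)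
      qed
      ultimately show "(\<lambda>n. ?u n \<omega>) \<longlonglongrightarrow> 0" by simp
    qed
  qed auto
  then show ?thesis by simp
qed

text \<open>Every pair can lower the potential by at most \<open>ln K\<close>, so a single gap below
  \<open>2 * e\<close> already lifts it to the order of \<open>- ln (2 * e)\<close>; other pairs
  cannot compensate.\<close>

lemma potential_ge:
  assumes e: "0 < e" "2 * e \<le> 1" and K: "1 \<le> K"
  shows "- real (card (pairs N)) * ln K \<le> potential e K x"
    and "p \<in> pairs N \<Longrightarrow> x (snd p) - x (fst p) < 2 * e \<Longrightarrow> - real (card (pairs N)) * ln K - ln (2 * e) \<le> potential e K x"
proof -
  have eK: "e \<le> K" using assms by linarith
  have le: "log_clip e K y \<le> ln K" for y by (rule log_clip_bounds(2)[OF e(1) eK])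
  have "(\<Sum>p\<in>pairs N. log_clip e K (x (snd p) - x (fst p))) \<le> real (card (pairs N)) * ln K"
    by (intro sum_bounded_above le)
  then show "- real (card (pairs N)) * ln K \<le> potential e K x"
    unfolding potential_def case_prod_unfold by simp
  assume p: "p \<in> pairs N" and gap: "x (snd p) - x (fst p) < 2 * e"
  have "log_clip e K (x (snd p) - x (fst p)) \<le> ln (2 * e)"
    using gap e by (simp add: log_clip_def)
  moreover have "(\<Sum>p\<in>pairs N - {p}. log_clip e K (x (snd p) - x (fst p))) \<le> real (card (pairs N - {p})) * ln K"
    by (intro sum_bounded_above le)
  moreover have "real (card (pairs N - {p})) * ln K \<le> real (card (pairs N)) * ln K"
    using K by (intro mult_right_mono) (auto intro!: card_mono)
  ultimately have "(\<Sum>p\<in>pairs N. log_clip e K (x (snd p) - x (fst p))) \<le> real (card (pairs N)) * ln K + ln (2 * e)"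
    unfolding sum.remove[OF finite_pairs p] by linarith
  then show "- real (card (pairs N)) * ln K - ln (2 * e) \<le> potential e K x"
    unfolding potential_def case_prod_unfold by simp
qed

text \<open>The lower cutoff only increases the logarithm. The bound is therefore free of
  \<open>e\<close>, and the initial energy stays bounded as the level grows.\<close>

lemma potential_initial_le:
  assumes "0 < e" "1 \<le> K"
  shows "potential e K x\<^sub>0 \<le> - (\<Sum>p\<in>pairs N. ln (min (x\<^sub>0 (snd p) - x\<^sub>0 (fst p)) K))"
  unfolding potential_def case_prod_unfold neg_le_iff_le
proof (rule sum_mono)
  fix p assume "p \<in> pairs N"
  then have "x\<^sub>0 (fst p) < x\<^sub>0 (snd p)" by (intro x0) simp
  then show "ln (min (x\<^sub>0 (snd p) - x\<^sub>0 (fst p)) K) \<le> log_clip e K (x\<^sub>0 (snd p) - x\<^sub>0 (fst p))"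
    unfolding log_clip_def using assms by (intro ln_mono) auto
qed

text \<open>Positions are bounded at all grid times up to \<open>m\<close>, so that the safe region
  can be left only through a short gap.\<close>

definition grid_collision :: "real \<Rightarrow> real \<Rightarrow> real \<Rightarrow> nat \<Rightarrow> 'a set" where
  "grid_collision r R T m = {\<omega> \<in> space M.
     (\<forall>k\<in>{..m}. \<forall>i\<in>{1..N}. \<bar>X r (real k * (T / real m)) \<omega> i\<bar> \<le> R) \<and>
     (\<exists>k\<in>{..m}. \<exists>p\<in>pairs N. X r (real k * (T / real m)) \<omega> (snd p) - X r (real k * (T / real m)) \<omega> (fst p) < 2 / r)}"

lemma grid_collision_sets:
  assumes "r > 0" "T \<ge> 0"
  shows "grid_collision r R T m \<in> sets M"
  unfolding grid_collision_def using assms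
  by (intro sets.sets_Collect_conj sets.sets_Collect_finite_All sets.sets_Collect_finite_Ex borel_measurable_le
      borel_measurable_less borel_measurable_diff borel_measurable_abs borel_measurable_const X_measurable_M
      pairs_mem finite_pairs finite_atMost finite_atLeastAtMost) auto

text \<open>
  Optional stopping, at the first grid time at which the process leaves the safe region.
\<close>

lemma prob_grid_collision_le:
  assumes R: "R \<ge> 1" "R \<le> r" and r: "r > 2" and T: "T > 0" and K: "K = 2 * R + 1"
    and b: "trunc_lipschitz N V r L b" "b \<ge> 0"
    and C: "C \<ge> 0" "\<And>a b. \<bar>a\<bar> \<le> R \<Longrightarrow> \<bar>b\<bar> \<le> R \<Longrightarrow> \<bar>deriv V a - deriv V b\<bar> \<le> C * \<bar>a - b\<bar>"
    and m: "m > 0" and h: "h = T / real m"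
  shows "prob (grid_collision r R T m) * ln (r / 2)
    \<le> potential (1 / r) K x\<^sub>0 + real (card (pairs N)) * ln K + real (card (pairs N)) *
       (T * (C / 2) + T * step_error (1 / r) K b h
          + expectation (\<lambda>\<omega>. \<Sum>k<m. drift_error r (real k * h) h \<omega>) / (2 * (1 / r)))"
proof -
  define e where "e = 1 / r"
  have e: "0 < e" "2 * e \<le> 1" using r by (auto simp: e_def field_simps)
  have K1: "K \<ge> 1" "e \<le> K" using K R e by auto
  have r0: "r > 0" using r by simp
  have h0: "h > 0" using h T m by simp
  have mh: "real m * h = T" using h m by simp
  define f where "f k \<omega> = potential e K (X r (real k * h) \<omega>)" for k \<omega>
  define A where "A k = {\<omega> \<in> space M. \<forall>l\<in>{..k}. safe e R (X r (real l * h) \<omega>)}" for k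
  \<comment> \<open>The potential stopped at the first unsafe grid time. Since \<open>A k\<close> is
    known at the \<open>k\<close>-th grid time, \<open>potential_step\<close> bounds each summand in
    expectation.\<close>
  define S where "S \<omega> = f 0 \<omega> + (\<Sum>k<m. indicator (A k) \<omega> * (f (Suc k) \<omega> - f k \<omega>))" for \<omega>
  let ?P = "real (card (pairs N))" and ?B = "grid_collision r R T m"
  have Suc: "real (Suc k) * h = real k * h + h" for k by (simp add: algebra_simps)
  have A_sets: "A k \<in> sets (G (real k * h))" for k
  proof -
    have "{\<omega> \<in> space (G (real k * h)). safe e R (X r (real l * h) \<omega>)} \<in> sets (G (real k * h))" if l: "l \<in> {..k}" for l
    proof (rule safe_measurable)
      fix i assume i: "i \<in> {1..N}"
      have "real l * h \<le> real k * h" using l h0 by (intro mult_right_mono) auto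
      then show "(\<lambda>\<omega>. X r (real l * h) \<omega> i) \<in> borel_measurable (G (real k * h))"
        using h0 by (intro measurable_G_mono[of "real l * h" "real k * h"] X_measurable r0 i) auto
    qed
    then have "{\<omega> \<in> space (G (real k * h)). \<forall>l\<in>{..k}. safe e R (X r (real l * h) \<omega>)} \<in> sets (G (real k * h))"
      by (intro sets.sets_Collect_finite_All) auto
    then show ?thesis unfolding A_def using space_G[of "real k * h"] h0 by simp
  qed
  have f_measurable: "f k \<in> borel_measurable M" for k
    unfolding f_def using h0 by (intro potential_measurable X_measurable_M r0) auto
  have f_bounded: "\<bar>f k \<omega>\<bar> \<le> ?P * (\<bar>ln e\<bar> + \<bar>ln K\<bar>)" for k \<omega>
    unfolding f_def by (rule potential_bounded[OF e(1) K1(2)])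
  have f_int: "integrable M (f k)" for k
    using f_bounded f_measurable by (intro integrable_const_bound[where B="?P * (\<bar>ln e\<bar> + \<bar>ln K\<bar>)"]) auto
  have A_M: "A k \<in> sets M" for k
    using A_sets[of k] subalgebra_G[of "real k * h"] h0 by (auto simp: subalgebra_def)
  have step_int: "integrable M (\<lambda>\<omega>. indicator (A k) \<omega> * (f (Suc k) \<omega> - f k \<omega>))" for k
    using integrable_mult_indicator[OF A_M Bochner_Integration.integrable_diff[OF f_int f_int]] by simp
  have S_int: "integrable M S"
    unfolding S_def by (intro Bochner_Integration.integrable_add f_int Bochner_Integration.integrable_sum step_int)
  have f0: "f 0 \<omega> = potential e K x\<^sub>0" if "\<omega> \<in> space M" for \<omega>
    unfolding f_def potential_def using X_0[OF r0 that]
    by (intro arg_cong[of _ _ uminus] sum.cong refl) (auto simp: pairs_def)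
  have ES: "expectation S = expectation (f 0) + (\<Sum>k<m. expectation (\<lambda>\<omega>. indicator (A k) \<omega> * (f (Suc k) \<omega> - f k \<omega>)))"
    unfolding S_def
    by (subst Bochner_Integration.integral_add[OF f_int Bochner_Integration.integrable_sum[OF step_int]],
        subst Bochner_Integration.integral_sum[OF step_int], rule refl)
  have "expectation (f 0) = expectation (\<lambda>_. potential e K x\<^sub>0)"
    by (intro Bochner_Integration.integral_cong refl f0)
  then have Ef0: "expectation (f 0) = potential e K x\<^sub>0" by (simp add: prob_space)
  have "(\<Sum>k<m. expectation (drift_error r (real k * h) h)) = expectation (\<lambda>\<omega>. \<Sum>k<m. drift_error r (real k * h) h \<omega>)"
  proof (rule Bochner_Integration.integral_sum[symmetric])
    fix k
    show "integrable M (drift_error r (real k * h) h)"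
      using drift_error_measurable[OF r0 b(1), of "real k * h" h] drift_error_bounded[OF r0 b(1), of "real k * h" h] h0
      by (intro integrable_const_bound[where B="real N * (2 * b * h)"]) auto
  qed
  note ED = this
  have "(\<Sum>k<m. expectation (\<lambda>\<omega>. indicator (A k) \<omega> * (f (Suc k) \<omega> - f k \<omega>)))
      \<le> (\<Sum>k<m. ?P * (h * (C / 2) + h * step_error e K b h + expectation (drift_error r (real k * h) h) / (2 * e)))"
  proof (rule sum_mono)
    fix k
    show "expectation (\<lambda>\<omega>. indicator (A k) \<omega> * (f (Suc k) \<omega> - f k \<omega>))
      \<le> ?P * (h * (C / 2) + h * step_error e K b h + expectation (drift_error r (real k * h) h) / (2 * e))"
      unfolding f_def Suc e_def
      by (rule potential_step[OF r0 _ R(2) K _ _ h0 b C])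
        (use R K1 h0 A_sets[of k] in \<open>auto simp: e_def A_def\<close>)
  qed
  also have "\<dots> = ?P * (T * (C / 2) + T * step_error e K b h + (\<Sum>k<m. expectation (drift_error r (real k * h) h)) / (2 * e))"
    unfolding sum_distrib_left[symmetric] sum.distrib sum_divide_distrib[symmetric]
    by (simp add: mh[symmetric])
  finally have upper: "expectation S \<le> potential e K x\<^sub>0 + ?P * (T * (C / 2) + T * step_error e K b h
      + expectation (\<lambda>\<omega>. \<Sum>k<m. drift_error r (real k * h) h \<omega>) / (2 * e))"
    unfolding ES Ef0 ED by linarith
  have lower: "- ?P * ln K + indicator ?B \<omega> * ln (r / 2) \<le> S \<omega>" if \<omega>: "\<omega> \<in> space M" for \<omega>
  proof -
    have "S \<omega> = f 0 \<omega> + (\<Sum>k<m. if \<forall>l\<le>k. safe e R (X r (real l * h) \<omega>) then f (Suc k) \<omega> - f k \<omega> else 0)"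
      unfolding S_def A_def using \<omega>
      by (intro arg_cong2[of _ _ _ _ "(+)"] sum.cong refl) (auto simp: indicator_def)
    then obtain n where n: "n \<le> m" "S \<omega> = f n \<omega>" "\<forall>l<n. safe e R (X r (real l * h) \<omega>)"
        "n < m \<longrightarrow> \<not> safe e R (X r (real n * h) \<omega>)"
      using stopped_sum[of m "\<lambda>k. f k \<omega>" "\<lambda>l. safe e R (X r (real l * h) \<omega>)"] by auto
    show ?thesis
    proof (cases "\<omega> \<in> ?B")
      case False
      then show ?thesis using potential_ge(1)[OF e K1(1)] n(2) by (simp add: f_def)
    next
      case True
      have bd: "\<bar>X r (real k * h) \<omega> i\<bar> \<le> R" if "k \<le> m" "i \<in> {1..N}" for k i
        using True that unfolding grid_collision_def h[symmetric] by blast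
      have "\<exists>k\<in>{..m}. \<exists>p\<in>pairs N. X r (real k * h) \<omega> (snd p) - X r (real k * h) \<omega> (fst p) < 2 / r"
        using True unfolding grid_collision_def h[symmetric] by blast
      then obtain k p where k: "k \<le> m" "p \<in> pairs N" "X r (real k * h) \<omega> (snd p) - X r (real k * h) \<omega> (fst p) < 2 * e"
        unfolding e_def by auto
      then have "\<not> safe e R (X r (real k * h) \<omega>)" unfolding safe_def by fastforce
      then have "k \<ge> n" using n(3) by (meson not_le)
      \<comment> \<open>The stopped state itself has a short gap. Before the last grid time it is
        unsafe while its positions are bounded; if stopping occurs at \<open>m\<close>, the
        collision time \<open>k \<ge> n\<close> can only be \<open>m\<close>.\<close>
      have "\<exists>p\<in>pairs N. X r (real n * h) \<omega> (snd p) - X r (real n * h) \<omega> (fst p) < 2 * e"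
      proof (cases "n < m")
        case True
        then have "\<not> safe e R (X r (real n * h) \<omega>)" using n(4) by simp
        then show ?thesis using bd[OF n(1)] unfolding safe_def by (force simp: not_le)
      next
        case False
        then have "k = n" using n(1) k(1) \<open>k \<ge> n\<close> by simp
        then show ?thesis using k by blast
      qed
      then have "- ?P * ln K - ln (2 * e) \<le> f n \<omega>"
        unfolding f_def using potential_ge(2)[OF e K1(1)] by blast
      moreover have "- ln (2 * e) = ln (r / 2)" using r by (simp add: e_def ln_div)
      ultimately show ?thesis using True n(2) by simp
    qed
  qed
  have B_sets: "?B \<in> sets M" using r0 T by (intro grid_collision_sets) auto
  have "expectation (\<lambda>\<omega>. - ?P * ln K + indicator ?B \<omega> * ln (r / 2)) \<le> expectation S"
    by (rule integral_mono[OF _ S_int lower])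
      (use B_sets in \<open>auto intro!: Bochner_Integration.integrable_add integrable_mult_left integrable_real_indicator simp: emeasure_eq_measure\<close>)
  also have "expectation (\<lambda>\<omega>. - ?P * ln K + indicator ?B \<omega> * ln (r / 2)) = - ?P * ln K + prob ?B * ln (r / 2)"
    using B_sets by (subst Bochner_Integration.integral_add) (auto simp: prob_space emeasure_eq_measure)
  finally show ?thesis using upper unfolding e_def by linarith
qed

section \<open>From grid times to all times, and from small probability to almost sure
  absence\<close>

definition bounded_upto :: "real \<Rightarrow> real \<Rightarrow> real \<Rightarrow> 'a \<Rightarrow> bool" where
  "bounded_upto r R T \<omega> \<longleftrightarrow> (\<forall>t\<in>{0..T}. \<forall>i\<in>{1..N}. \<bar>X r t \<omega> i\<bar> \<le> R)"

definition collision_upto :: "real \<Rightarrow> real \<Rightarrow> 'a \<Rightarrow> bool" where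
  "collision_upto r T \<omega> \<longleftrightarrow> (\<exists>t\<in>{0..T}. \<exists>p\<in>pairs N. X r t \<omega> (snd p) - X r t \<omega> (fst p) < 2 / r)"

abbreviation bounded_collision :: "real \<Rightarrow> real \<Rightarrow> real \<Rightarrow> 'a set" where
  "bounded_collision r R T \<equiv> {\<omega> \<in> space M. bounded_upto r R T \<omega> \<and> collision_upto r T \<omega>}"

text \<open>The gap condition is a strict inequality, hence open in time along a continuous path,
  and every sufficiently fine grid detects it.\<close>

lemma collision_upto_grid:
  assumes r: "r > 0" and T: "T > 0" and \<omega>: "\<omega> \<in> space M"
    and bd: "bounded_upto r R T \<omega>" and col: "collision_upto r T \<omega>"
  shows "\<exists>n0. \<forall>n\<ge>n0. \<omega> \<in> grid_collision r R T (Suc n)"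
proof -
  obtain t p where t: "t \<in> {0..T}" and p: "p \<in> pairs N" and gap: "X r t \<omega> (snd p) - X r t \<omega> (fst p) < 2 / r"
    using col unfolding collision_upto_def by blast
  let ?g = "\<lambda>t. X r t \<omega> (snd p) - X r t \<omega> (fst p)"
  have "continuous_on {0..T} ?g" by (intro continuous_intros continuous_on_X[OF r \<omega>] pairs_mem p)
  then obtain \<delta> where \<delta>: "\<delta> > 0" "\<And>s. s \<in> {0..T} \<Longrightarrow> dist s t < \<delta> \<Longrightarrow> dist (?g s) (?g t) < 2 / r - ?g t"
    using t gap unfolding continuous_on_iff by (metis diff_gt_0_iff_gt)
  obtain n0 where n0: "T / \<delta> < real n0" using reals_Archimedean2 by blast
  show ?thesis
  proof (intro exI allI impI)
    fix n assume n: "n \<ge> n0"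
    define h where "h = T / real (Suc n)"
    have h: "h > 0" using T by (simp add: h_def)
    have "T / \<delta> < real (Suc n)" using n n0 by linarith
    then have h\<delta>: "h < \<delta>" using \<delta>(1) unfolding h_def by (simp add: field_simps)
    have Th: "real (Suc n) * h = T" by (simp add: h_def)
    have grid: "real k * h \<in> {0..T}" if "k \<in> {..Suc n}" for k
    proof -
      have "real k * h \<le> real (Suc n) * h" using that h by (intro mult_right_mono) auto
      then show ?thesis using h unfolding Th by auto
    qed
    define k where "k = nat \<lfloor>t / h\<rfloor>"
    have "t / h \<ge> 0" using t h by simp
    then have k: "real k \<le> t / h" "t / h < real k + 1" unfolding k_def by linarith+
    have "t / h \<le> T / h" using t h by (intro divide_right_mono) auto
    also have "T / h = real (Suc n)" using T by (simp add: h_def)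
    finally have "k \<in> {..Suc n}" using k(1) by simp
    moreover have "dist (real k * h) t < \<delta>"
    proof -
      have "real k * h \<le> t" "t < real k * h + h" using k h by (auto simp: field_simps)
      then show ?thesis using h\<delta> by (simp add: dist_real_def)
    qed
    then have "dist (?g (real k * h)) (?g t) < 2 / r - ?g t"
      using grid[OF \<open>k \<in> {..Suc n}\<close>] by (intro \<delta>(2))
    then have "?g (real k * h) < 2 / r" unfolding dist_real_def by linarith
    ultimately have "\<exists>k\<in>{..Suc n}. \<exists>p\<in>pairs N. X r (real k * h) \<omega> (snd p) - X r (real k * h) \<omega> (fst p) < 2 / r"
      using p by blast
    moreover have "\<forall>k\<in>{..Suc n}. \<forall>i\<in>{1..N}. \<bar>X r (real k * h) \<omega> i\<bar> \<le> R"
      using bd grid unfolding bounded_upto_def by blast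
    ultimately show "\<omega> \<in> grid_collision r R T (Suc n)"
      using \<omega> unfolding grid_collision_def h_def by blast
  qed
qed

text \<open>At fixed \<open>r\<close> the mesh is sent to 0 first, which removes every error
  depending on \<open>r\<close>; what remains is \<open>c\<close>, determined by \<open>R\<close>,
  \<open>T\<close>, \<open>V\<close>, \<open>N\<close> and the initial value. The set
  \<open>H\<close> encloses a condition on uncountably many times in a measurable event.\<close>

lemma collision_bound:
  assumes R: "R \<ge> 1" and T: "T > 0"
  shows "\<exists>c. \<forall>r. R \<le> r \<and> 2 < r \<longrightarrow> (\<exists>H\<in>sets M. prob H * ln (r / 2) \<le> c \<and>
           bounded_collision r R T \<subseteq> H)"
proof -
  obtain C where C: "C \<ge> 0" "\<And>a b. \<bar>a\<bar> \<le> R \<Longrightarrow> \<bar>b\<bar> \<le> R \<Longrightarrow> \<bar>deriv V a - deriv V b\<bar> \<le> C * \<bar>a - b\<bar>"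
    using lipschitz_V'[of R] R by force
  \<comment> \<open>Particles within \<open>R\<close> of the origin have gaps at most
    \<open>2 * R\<close>; the extra 1 is the room above that \<open>log_clip_taylor\<close> asks
    for.\<close>
  define K where "K = 2 * R + 1"
  let ?P = "real (card (pairs N))"
  define c where "c = - (\<Sum>p\<in>pairs N. ln (min (x\<^sub>0 (snd p) - x\<^sub>0 (fst p)) K)) + ?P * ln K + ?P * (T * (C / 2))"
  have "\<exists>H\<in>sets M. prob H * ln (r / 2) \<le> c \<and> bounded_collision r R T \<subseteq> H"
    if r: "R \<le> r" "2 < r" for r
  proof -
    have r0: "r > 0" using r by simp
    obtain L b where b: "trunc_lipschitz N V r L b" "b \<ge> 0" using lipschitz_trunc_drift[OF r0] .
    let ?h = "\<lambda>n. T / real (Suc n)"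
    let ?err = "\<lambda>n. expectation (\<lambda>\<omega>. \<Sum>k<Suc n. drift_error r (real k * ?h n) (?h n) \<omega>)"
    let ?B = "\<lambda>n. grid_collision r R T (Suc n)"
    \<comment> \<open>Tail intersections of the grid events: \<open>H0\<close> increases to their
      limit inferior, and each \<open>H0 n\<close> inherits the probability bound from the single
      event \<open>?B n\<close>.\<close>
    define H0 where "H0 n = (\<Inter>k\<in>{n..}. ?B k)" for n
    have B_sets: "?B n \<in> sets M" for n using r0 T by (intro grid_collision_sets) auto
    have H0_sets: "H0 n \<in> sets M" for n
      unfolding H0_def using B_sets by (intro sets.countable_INT') auto
    have "(\<lambda>n. prob (H0 n)) \<longlonglongrightarrow> prob (\<Union>n. H0 n)"
    proof (rule finite_Lim_measure_incseq)
      show "range H0 \<subseteq> sets M" using H0_sets by blast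
      show "incseq H0" by (auto simp: incseq_def H0_def)
    qed
    then have lim: "(\<lambda>n. prob (H0 n) * ln (r / 2)) \<longlonglongrightarrow> prob (\<Union>n. H0 n) * ln (r / 2)"
      by (intro tendsto_mult tendsto_const)
    have h: "?h \<longlonglongrightarrow> 0"
      using tendsto_mult[OF tendsto_const[of T] LIMSEQ_inverse_real_of_nat] by (simp add: divide_inverse)
    have "(\<lambda>n. step_error (1 / r) K b (?h n)) \<longlonglongrightarrow> (8 * \<sigma> * b * sqrt 0 + 4 * b\<^sup>2 * 0) / (8 * (1 / r)\<^sup>2)
        + (1 / (1 / r) ^ 3 + 1 / (1 / r) + (ln K - ln (1 / r)) / (1 / r) ^ 3) * (64 * \<sigma> ^ 3 * sqrt 0 + 32 * b ^ 3 * 0\<^sup>2)"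
      unfolding step_error_def using r0 by (intro tendsto_intros h) auto
    then have step: "(\<lambda>n. step_error (1 / r) K b (?h n)) \<longlonglongrightarrow> 0" by simp
    have "(\<lambda>n. c + ?P * (T * step_error (1 / r) K b (?h n) + ?err n / (2 * (1 / r)))) \<longlonglongrightarrow> c + ?P * (T * 0 + 0 / (2 * (1 / r)))"
      using r0 T by (intro tendsto_intros step drift_error_sum_tendsto_zero) auto
    then have "(\<lambda>n. c + ?P * (T * step_error (1 / r) K b (?h n) + ?err n / (2 * (1 / r)))) \<longlonglongrightarrow> c" by simp
    moreover have "prob (H0 n) * ln (r / 2) \<le> c + ?P * (T * step_error (1 / r) K b (?h n) + ?err n / (2 * (1 / r)))" for n
    proof -
      have "prob (H0 n) \<le> prob (?B n)"
        using B_sets by (intro finite_measure_mono) (auto simp: H0_def)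
      then have "prob (H0 n) * ln (r / 2) \<le> prob (?B n) * ln (r / 2)"
        using r by (intro mult_right_mono) auto
      also have "\<dots> \<le> potential (1 / r) K x\<^sub>0 + ?P * ln K + ?P * (T * (C / 2) + T * step_error (1 / r) K b (?h n) + ?err n / (2 * (1 / r)))"
        by (rule prob_grid_collision_le[OF R r(1,2) T K_def b C]) auto
      also have "\<dots> \<le> c + ?P * (T * step_error (1 / r) K b (?h n) + ?err n / (2 * (1 / r)))"
        using potential_initial_le[of "1 / r" K] r0 R unfolding c_def by (simp add: K_def distrib_left)
      finally show ?thesis .
    qed
    ultimately have "prob (\<Union>n. H0 n) * ln (r / 2) \<le> c"
      using lim by (intro LIMSEQ_le) auto
    moreover have "bounded_collision r R T \<subseteq> (\<Union>n. H0 n)"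
      using collision_upto_grid[OF r0 T] unfolding H0_def by fastforce
    moreover have "(\<Union>n. H0 n) \<in> sets M" using H0_sets by auto
    ultimately show ?thesis by blast
  qed
  then show ?thesis by blast
qed

text \<open>If all large levels failed, the path would lie in every \<open>H n\<close>, whose
  probabilities decay like \<open>c / ln (n / 2)\<close>; so intersecting suffices and the slow
  decay need not be summable.\<close>

lemma AE_no_bounded_collision:
  assumes R: "R \<ge> 1" and T: "T > 0"
  shows "AE \<omega> in M. \<exists>n::nat. R \<le> real n \<and> \<not> (bounded_upto (real n) R T \<omega> \<and> collision_upto (real n) T \<omega>)"
proof -
  obtain c where c: "\<forall>r. R \<le> r \<and> 2 < r \<longrightarrow> (\<exists>H\<in>sets M. prob H * ln (r / 2) \<le> c \<and>
           bounded_collision r R T \<subseteq> H)"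
    using collision_bound[OF R T] by blast
  obtain n0 :: nat where n0: "R + 2 < real n0" using reals_Archimedean2 by blast
  have "\<exists>H\<in>sets M. prob H * ln (real n / 2) \<le> c \<and>
     bounded_collision (real n) R T \<subseteq> H" if "n \<in> {n0..}" for n
  proof -
    have "R \<le> real n \<and> 2 < real n" using that n0 R by simp
    then show ?thesis using c by blast
  qed
  then have "\<forall>n\<in>{n0..}. \<exists>H. H \<in> sets M \<and> prob H * ln (real n / 2) \<le> c \<and>
     bounded_collision (real n) R T \<subseteq> H" by blast
  from bchoice[OF this] obtain H where H': "\<forall>n\<in>{n0..}. H n \<in> sets M \<and> prob (H n) * ln (real n / 2) \<le> c \<and>
      bounded_collision (real n) R T \<subseteq> H n" by blast
  have H: "H n \<in> sets M" "prob (H n) * ln (real n / 2) \<le> c"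
      "bounded_collision (real n) R T \<subseteq> H n" if "n \<ge> n0" for n
    using H' that by simp_all
  define Z where "Z = (\<Inter>n\<in>{n0..}. H n)"
  have Z: "Z \<in> sets M" unfolding Z_def using H(1) by (intro sets.countable_INT') auto
  have "prob Z = 0"
  proof (rule ccontr)
    assume "prob Z \<noteq> 0"
    then have pos: "prob Z > 0" by (simp add: zero_less_measure_iff)
    \<comment> \<open>Chosen so that \<open>ln (n / 2)\<close> is at least
      \<open>c / prob Z + 1\<close>, which makes \<open>prob Z * ln (n / 2)\<close> exceed
      \<open>c\<close>.\<close>
    obtain n1 :: nat where n1: "2 * exp (c / prob Z + 1) < real n1" using reals_Archimedean2 by blast
    define n where "n = max n0 n1"
    have n: "n \<ge> n0" "2 * exp (c / prob Z + 1) < real n" using n1 by (auto simp: n_def)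
    have "c / prob Z + 1 = ln (exp (c / prob Z + 1))" by simp
    also have "\<dots> \<le> ln (real n / 2)" using n(2) by (intro ln_mono) auto
    finally have "prob Z * (c / prob Z + 1) \<le> prob Z * ln (real n / 2)" using pos by (intro mult_left_mono) auto
    moreover have "prob Z * ln (real n / 2) \<le> prob (H n) * ln (real n / 2)"
    proof (rule mult_right_mono)
      show "prob Z \<le> prob (H n)" using H(1)[OF n(1)] n(1) by (intro finite_measure_mono) (auto simp: Z_def)
      have "real n > 2" using n(1) n0 R by linarith
      then show "ln (real n / 2) \<ge> 0" by simp
    qed
    moreover have "prob Z * (c / prob Z + 1) = c + prob Z" using pos by (simp add: distrib_left)
    ultimately show False using H(2)[OF n(1)] pos by linarith
  qed
  then have "Z \<in> null_sets M" using Z by (simp add: null_sets_def emeasure_eq_measure)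
  then show ?thesis
  proof (rule AE_I')
    have "R \<le> real n" if "n \<ge> n0" for n using that n0 by linarith
    then show "{\<omega> \<in> space M. \<not> (\<exists>n::nat. R \<le> real n \<and> \<not> (bounded_upto (real n) R T \<omega> \<and> collision_upto (real n) T \<omega>))} \<subseteq> Z"
      unfolding Z_def using H(3) by blast
  qed
qed

abbreviation noncolliding :: "'a \<Rightarrow> bool" where
  "noncolliding \<omega> \<equiv> \<forall>T\<ge>0. \<exists>r\<ge>1. \<forall>t\<in>{0..T}. good_region N r (X r t \<omega>)"

text \<open>The bound of \<open>no_explosion\<close> depends on the path, so the null sets are
  collected over all integer bounds and horizons first, and integers above the path's own
  \<open>R\<close> and \<open>T\<close> are picked afterwards.\<close>

theorem AE_good_region:
  "AE \<omega> in M. noncolliding \<omega>"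
proof -
  have "AE \<omega> in M. \<forall>R T :: nat. \<exists>n::nat. real (Suc R) \<le> real n \<and>
      \<not> (bounded_upto (real n) (real (Suc R)) (real (Suc T)) \<omega> \<and> collision_upto (real n) (real (Suc T)) \<omega>)"
    unfolding AE_all_countable by (intro allI AE_no_bounded_collision) auto
  with AE_space show ?thesis
  proof eventually_elim
    case (elim \<omega>)
    show ?case
    proof (intro allI impI)
      fix T :: real assume T: "T \<ge> 0"
      obtain T' :: nat where "T < real T'" using reals_Archimedean2 by blast
      then have T': "T \<le> real (Suc T')" by simp
      have w: "continuous_on {0..real (Suc T')} (\<lambda>t. noise \<omega> t i)" if "i \<in> {1..N}" for i
        using continuous_on_noise[OF elim(1) that] by (rule continuous_on_subset) auto
      have "\<exists>R. \<forall>r x t i. r \<ge> 1 \<longrightarrow> trunc_solves N V r (noise \<omega>) (real (Suc T')) x \<longrightarrow>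
           t \<in> {0..real (Suc T')} \<longrightarrow> i \<in> {1..N} \<longrightarrow> \<bar>x t i\<bar> \<le> R"
        by (rule no_explosion[OF confining \<gamma> N _ lipschitz_V' w]) simp_all
      then obtain R where R: "\<And>r x t i. r \<ge> 1 \<Longrightarrow> trunc_solves N V r (noise \<omega>) (real (Suc T')) x \<Longrightarrow>
           t \<in> {0..real (Suc T')} \<Longrightarrow> i \<in> {1..N} \<Longrightarrow> \<bar>x t i\<bar> \<le> R" by blast
      obtain R' :: nat where R': "R < real R'" using reals_Archimedean2 by blast
      obtain n :: nat where n: "real (Suc R') \<le> real n"
        and nc: "\<not> (bounded_upto (real n) (real (Suc R')) (real (Suc T')) \<omega> \<and> collision_upto (real n) (real (Suc T')) \<omega>)"
        using elim(2) by blast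
      have n1: "real n \<ge> 1" using n by simp
      have bd: "\<bar>X (real n) t \<omega> i\<bar> \<le> real (Suc R')" if "t \<in> {0..real (Suc T')}" "i \<in> {1..N}" for t i
      proof -
        have "\<bar>X (real n) t \<omega> i\<bar> \<le> R"
          using n1 by (intro R[OF n1 X_solves[OF _ elim(1)] that]) simp
        then show ?thesis using R' by simp
      qed
      then have "\<not> collision_upto (real n) (real (Suc T')) \<omega>" using nc unfolding bounded_upto_def by blast
      then have gap: "2 / real n \<le> X (real n) t \<omega> (snd p) - X (real n) t \<omega> (fst p)"
        if "t \<in> {0..real (Suc T')}" "p \<in> pairs N" for t p
        using that unfolding collision_upto_def by (meson not_le)
      have half: "1 / real n \<le> 2 / real n" by (intro divide_right_mono) auto
      have "good_region N (real n) (X (real n) t \<omega>)" if "t \<in> {0..T}" for t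
      proof -
        have t: "t \<in> {0..real (Suc T')}" using that T' by auto
        have "\<forall>i\<in>{1..N}. \<bar>X (real n) t \<omega> i\<bar> \<le> real n" using bd[OF t] n by (meson order_trans)
        moreover have "\<forall>p\<in>pairs N. 1 / real n \<le> X (real n) t \<omega> (snd p) - X (real n) t \<omega> (fst p)"
          using gap[OF t] half by (meson order_trans)
        ultimately show ?thesis unfolding good_region_def case_prod_unfold by blast
      qed
      then show "\<exists>r\<ge>1. \<forall>t\<in>{0..T}. good_region N r (X r t \<omega>)" using n1 by blast
    qed
  qed
qed

end

section \<open>Strong solution and uniqueness\<close>

lemma good_region_mono:
  assumes "good_region N r x" "0 < r" "r \<le> r'"
  shows "good_region N r' x"
proof -
  have "1 / r' \<le> 1 / r" using assms by (intro divide_left_mono) auto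
  then show ?thesis using assms unfolding good_region_def by fastforce
qed

text \<open>On a compact interval a continuous path keeps a positive distance from the boundary of
  the chamber. The sum of all positions and inverse gaps is one continuous function whose maximum
  controls both conditions at once.\<close>

lemma chamber_path_good_region:
  fixes y :: "real \<Rightarrow> nat \<Rightarrow> real"
  assumes T: "T \<ge> 0" and cont: "\<And>i. i \<in> {1..N} \<Longrightarrow> continuous_on {0..T} (\<lambda>t. y t i)"
    and chamber: "\<And>t. t \<in> {0..T} \<Longrightarrow> y t \<in> ordered_chamber N"
  shows "\<exists>r\<ge>1. \<forall>t\<in>{0..T}. good_region N r (y t)"
proof -
  let ?s = "\<lambda>t. (\<Sum>i\<in>{1..N}. \<bar>y t i\<bar>) + (\<Sum>p\<in>pairs N. 1 / (y t (snd p) - y t (fst p)))"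
  have pos: "y t (snd p) - y t (fst p) > 0" if "t \<in> {0..T}" "p \<in> pairs N" for t p
    using chamber[OF that(1)] that(2) by (auto simp: ordered_chamber_def pairs_def)
  have "continuous_on {0..T} ?s"
  proof (intro continuous_intros cont)
    fix p assume p: "p \<in> pairs N"
    show "fst p \<in> {1..N}" "snd p \<in> {1..N}" using p by (auto simp: pairs_def)
    show "\<forall>t\<in>{0..T}. y t (snd p) - y t (fst p) \<noteq> 0" using pos[OF _ p] by force
  qed
  then obtain D where D: "\<forall>t\<in>{0..T}. ?s t \<le> D" by (rule continuous_on_Icc_upper_bound)
  have "good_region N (max 1 D) (y t)" if t: "t \<in> {0..T}" for t
  proof -
    have n1: "(\<Sum>i\<in>{1..N}. \<bar>y t i\<bar>) \<ge> 0" by (intro sum_nonneg) auto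
    have n2: "(\<Sum>p\<in>pairs N. 1 / (y t (snd p) - y t (fst p))) \<ge> 0"
      using pos[OF t] by (intro sum_nonneg) (auto simp: less_imp_le)
    have "\<bar>y t i\<bar> \<le> max 1 D" if i: "i \<in> {1..N}" for i
    proof -
      have "\<bar>y t i\<bar> \<le> (\<Sum>i\<in>{1..N}. \<bar>y t i\<bar>)" using i by (intro member_le_sum) auto
      also have "\<dots> \<le> max 1 D" using bspec[OF D t] n2 by linarith
      finally show ?thesis .
    qed
    moreover have "1 / max 1 D \<le> y t (snd p) - y t (fst p)" if p: "p \<in> pairs N" for p
    proof -
      have "1 / (y t (snd p) - y t (fst p)) \<le> (\<Sum>p\<in>pairs N. 1 / (y t (snd p) - y t (fst p)))"
        using p pos[OF t]
        by (intro member_le_sum[of p "pairs N" "\<lambda>p. 1 / (y t (snd p) - y t (fst p))"]) (auto simp: less_imp_le)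
      also have "\<dots> \<le> max 1 D" using bspec[OF D t] n1 by linarith
      finally show ?thesis using pos[OF t p] by (simp add: divide_le_eq mult.commute)
    qed
    ultimately show ?thesis unfolding good_region_def case_prod_unfold by blast
  qed
  then show ?thesis by (intro exI[of _ "max 1 D"]) auto
qed

lemma dyson_drift_cong:
  assumes "\<And>j. j \<in> {1..N} \<Longrightarrow> x j = y j" "i \<in> {1..N}"
  shows "dyson_drift N V x i = dyson_drift N V y i"
  unfolding dyson_drift_def using assms by (intro arg_cong2[of _ _ _ _ "(-)"] arg_cong2[of _ _ _ _ "(*)"] sum.cong) auto

context dyson_setup
begin

lemma solves_trunc_drift_cong:
  assumes "0 < r" "r \<le> r'" and x: "trunc_solves N V r w T x"
    and good: "\<And>t. t \<in> {0..T} \<Longrightarrow> good_region N r (x t)"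
  shows "trunc_solves N V r' w T x"
proof -
  obtain L b where 1: "trunc_lipschitz N V r L b" using lipschitz_trunc_drift[OF assms(1)] .
  have "0 < r'" using assms by simp
  then obtain L' b' where 2: "trunc_lipschitz N V r' L' b'" using lipschitz_trunc_drift by blast
  have eq: "drift r (x s) i = drift r' (x s) i" if "s \<in> {0..T}" "i \<in> {1..N}" for s i
    using good[OF that(1)] good_region_mono[OF good[OF that(1)] assms(1,2)] that(2)
    by (simp add: trunc_drift_eq_dyson_drift)
  have "integral {0..t} (\<lambda>s. drift r (x s) i) = integral {0..t} (\<lambda>s. drift r' (x s) i)"
    if "t \<in> {0..T}" "i \<in> {1..N}" for t i
    using that by (intro Henstock_Kurzweil_Integration.integral_cong eq) auto
  then show ?thesis
    using x unfolding lipschitz_drift.solves_def[OF 1] lipschitz_drift.solves_def[OF 2] by simp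
qed

text \<open>Both paths are lifted to the larger of the two levels, where uniqueness holds. A path
  that already solves at the larger level needs no lifting, hence the disjunction in the assumption
  on \<open>y\<close>: it admits a process at a higher level whose goodness is not yet known, as
  well as an arbitrary chamber path at its own level.\<close>

lemma X_unique:
  assumes \<omega>: "\<omega> \<in> space M" and r: "0 < r" "0 < r'"
    and good: "\<And>t. t \<in> {0..T} \<Longrightarrow> good_region N r (X r t \<omega>)"
    and y: "trunc_solves N V r' (noise \<omega>) T y"
    and good': "\<And>t. t \<in> {0..T} \<Longrightarrow> good_region N r' (y t) \<or> r \<le> r'"
    and t: "t \<in> {0..T}" and i: "i \<in> {1..N}"
  shows "y t i = X r t \<omega> i"
proof -
  let ?r = "max r r'"
  have "0 < ?r" using r by simp
  then obtain L b where l: "trunc_lipschitz N V ?r L b" using lipschitz_trunc_drift by blast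
  have "trunc_solves N V ?r (noise \<omega>) T (\<lambda>t. X r t \<omega>)"
    by (rule solves_trunc_drift_cong[OF r(1) _ X_solves[OF r(1) \<omega>] good]) auto
  moreover have "trunc_solves N V ?r (noise \<omega>) T y"
  proof (cases "r \<le> r'")
    case True
    then show ?thesis using y by (simp add: max_absorb2)
  next
    case False
    then show ?thesis using good' by (intro solves_trunc_drift_cong[OF r(2) _ y]) auto
  qed
  ultimately show ?thesis using lipschitz_drift.solves_unique[OF l _ _ t i] by metis
qed

text \<open>On noncolliding paths the sequence is eventually constant. Elsewhere \<open>lim\<close>
  still returns a value, so the process is defined everywhere and adapted; the restriction makes its
  values extensional, as elements of the chamber must be.\<close>

definition dyson_process :: "real \<Rightarrow> 'a \<Rightarrow> nat \<Rightarrow> real" where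
  "dyson_process t \<omega> = (\<lambda>i\<in>{1..N}. lim (\<lambda>n. X (real (Suc n)) t \<omega> i))"

lemma dyson_process_measurable:
  assumes "t \<ge> 0"
  shows "dyson_process t \<in> measurable (G t) (borel_vec N)"
  unfolding dyson_process_def
  by (intro measurable_restrict borel_measurable_lim_metric X_measurable assms) auto

lemma dyson_process_eq_X:
  assumes \<omega>: "\<omega> \<in> space M" and r: "r \<ge> 1"
    and good: "\<And>t. t \<in> {0..T} \<Longrightarrow> good_region N r (X r t \<omega>)" and t: "t \<in> {0..T}" and i: "i \<in> {1..N}"
  shows "dyson_process t \<omega> i = X r t \<omega> i"
proof -
  obtain n0 :: nat where n0: "r < real n0" using reals_Archimedean2 by blast
  have "X (real (Suc n)) t \<omega> i = X r t \<omega> i" if "n \<ge> n0" for n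
    by (rule X_unique[OF \<omega> _ _ good X_solves[OF _ \<omega>] _ t i]) (use r n0 that in auto)
  then have "(\<lambda>n. X (real (Suc n)) t \<omega> i) \<longlonglongrightarrow> X r t \<omega> i"
    by (intro tendsto_eventually) (auto simp: eventually_sequentially)
  then show ?thesis unfolding dyson_process_def using i by (simp add: limI)
qed

lemma dyson_process_properties:
  assumes \<omega>: "\<omega> \<in> space M" and good: "noncolliding \<omega>"
  shows "i \<in> {1..N} \<Longrightarrow> dyson_process 0 \<omega> i = x\<^sub>0 i"
    and "i \<in> {1..N} \<Longrightarrow> continuous_on {0..} (\<lambda>t. dyson_process t \<omega> i)"
    and "t \<ge> 0 \<Longrightarrow> dyson_process t \<omega> \<in> ordered_chamber N"
    and "i \<in> {1..N} \<Longrightarrow> t \<ge> 0 \<Longrightarrow> set_integrable lborel {0..t} (\<lambda>s. dyson_drift N V (dyson_process s \<omega>) i)"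
    and "i \<in> {1..N} \<Longrightarrow> t \<ge> 0 \<Longrightarrow> dyson_process t \<omega> i = x\<^sub>0 i + \<sigma> * B t \<omega> i
          + (LINT s:{0..t}|lborel. dyson_drift N V (dyson_process s \<omega>) i)"
proof -
  let ?d = "\<lambda>s i. dyson_drift N V (dyson_process s \<omega>) i"
  have ex: "\<exists>r\<ge>1. (\<forall>t\<in>{0..T}. good_region N r (X r t \<omega>)) \<and> (\<forall>t\<in>{0..T}. \<forall>i\<in>{1..N}. dyson_process t \<omega> i = X r t \<omega> i)"
    if T: "T \<ge> 0" for T
  proof -
    obtain r where r: "r \<ge> 1" "\<forall>t\<in>{0..T}. good_region N r (X r t \<omega>)" using good T by blast
    have "\<forall>t\<in>{0..T}. \<forall>i\<in>{1..N}. dyson_process t \<omega> i = X r t \<omega> i"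
      using dyson_process_eq_X[OF \<omega> r(1)] r(2) by blast
    then show ?thesis using r by blast
  qed
  show "dyson_process 0 \<omega> i = x\<^sub>0 i" if i: "i \<in> {1..N}"
  proof -
    obtain r where "r \<ge> 1" "\<forall>t\<in>{0..0}. \<forall>i\<in>{1..N}. dyson_process t \<omega> i = X r t \<omega> i" using ex[of 0] by blast
    then show ?thesis using X_0[of r \<omega> i] \<omega> i by simp
  qed
  have cT: "continuous_on {0..T} (\<lambda>t. dyson_process t \<omega> i)" if T: "T \<ge> 0" and i: "i \<in> {1..N}" for T i
  proof -
    obtain r where r: "r \<ge> 1" "\<forall>t\<in>{0..T}. \<forall>i\<in>{1..N}. dyson_process t \<omega> i = X r t \<omega> i" using ex[OF T] by blast
    have "continuous_on {0..T} (\<lambda>t. X r t \<omega> i)" using r by (intro continuous_on_X \<omega> i) auto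
    then show ?thesis using r(2) i by (subst continuous_on_cong[OF refl, of _ _ "\<lambda>t. X r t \<omega> i"]) auto
  qed
  show "continuous_on {0..} (\<lambda>t. dyson_process t \<omega> i)" if i: "i \<in> {1..N}"
    unfolding continuous_on_eq_continuous_within
  proof
    fix t :: real assume t: "t \<in> {0..}"
    then have "continuous (at t within {0..t + 1}) (\<lambda>t. dyson_process t \<omega> i)"
      using cT[of "t + 1", OF _ i] by (auto simp: continuous_on_eq_continuous_within)
    \<comment> \<open>Continuity is local in time, and \<open>{0..t + 1}\<close> is a neighbourhood
      of \<open>t\<close> in the half-line, including \<open>t = 0\<close>.\<close>
    moreover have "at t within {0..t + 1} = at t within {0..}"
      by (rule at_within_nhd[of _ "{..<t + 1}"]) auto
    ultimately show "continuous (at t within {0..}) (\<lambda>t. dyson_process t \<omega> i)" by simp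
  qed
  show "dyson_process t \<omega> \<in> ordered_chamber N" if t: "t \<ge> 0"
  proof -
    obtain r where r: "r \<ge> 1" "good_region N r (X r t \<omega>)" "\<forall>i\<in>{1..N}. dyson_process t \<omega> i = X r t \<omega> i"
      using ex[OF t] t by (meson atLeastAtMost_iff order_refl)
    have "dyson_process t \<omega> i < dyson_process t \<omega> j" if "i \<in> {1..N}" "j \<in> {1..N}" "i < j" for i j
    proof -
      have "(i, j) \<in> pairs N" using that by (auto simp: pairs_def)
      then have "1 / r \<le> X r t \<omega> j - X r t \<omega> i" using r(2) unfolding good_region_def by blast
      moreover have "1 / r > 0" using r(1) by simp
      ultimately have "X r t \<omega> i < X r t \<omega> j" by linarith
      then show ?thesis using r(3) that by simp
    qed
    moreover have "dyson_process t \<omega> \<in> {1..N} \<rightarrow>\<^sub>E UNIV" unfolding dyson_process_def by auto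
    ultimately show ?thesis unfolding ordered_chamber_def by blast
  qed
  have drift: "set_integrable lborel {0..t} (\<lambda>s. ?d s i) \<and>
      dyson_process t \<omega> i = x\<^sub>0 i + \<sigma> * B t \<omega> i + (LINT s:{0..t}|lborel. ?d s i)"
    if i: "i \<in> {1..N}" and t: "t \<ge> 0"
  proof -
    obtain r where r: "r \<ge> 1" "\<forall>t\<in>{0..t}. good_region N r (X r t \<omega>)"
        "\<forall>s\<in>{0..t}. \<forall>i\<in>{1..N}. dyson_process s \<omega> i = X r s \<omega> i"
      using ex[OF t] by blast
    have r0: "r > 0" using r(1) by simp
    have eq: "?d s i = drift r (X r s \<omega>) i" if s: "s \<in> {0..t}" for s
    proof -
      have "?d s i = dyson_drift N V (X r s \<omega>) i"
        using r(3) s i by (intro dyson_drift_cong) auto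
      then show ?thesis using trunc_drift_eq_dyson_drift[of N r "X r s \<omega>" i V] r(2) s i by auto
    qed
    have int: "set_integrable lborel {0..t} (\<lambda>s. drift r (X r s \<omega>) i)"
      by (rule borel_integrable_atLeastAtMost'[OF continuous_on_drift_X[OF r0 \<omega> i]])
    also have "?this \<longleftrightarrow> set_integrable lborel {0..t} (\<lambda>s. ?d s i)"
      by (rule set_integrable_cong) (auto simp: eq)
    finally have 1: "set_integrable lborel {0..t} (\<lambda>s. ?d s i)" .
    have "(LINT s:{0..t}|lborel. ?d s i) = (LINT s:{0..t}|lborel. drift r (X r s \<omega>) i)"
      by (rule set_lebesgue_integral_cong) (auto simp: eq)
    also have "\<dots> = integral {0..t} (\<lambda>s. drift r (X r s \<omega>) i)"
      by (rule set_borel_integral_eq_integral(2)[OF int])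
    finally show ?thesis
      using X_eq[OF r0 \<omega> i t] 1 r(3) i t by (simp add: noise_def)
  qed
  show "set_integrable lborel {0..t} (\<lambda>s. ?d s i)"
    "dyson_process t \<omega> i = x\<^sub>0 i + \<sigma> * B t \<omega> i + (LINT s:{0..t}|lborel. ?d s i)"
    if "i \<in> {1..N}" "t \<ge> 0"
    using drift[OF that] by auto
qed

text \<open>Here \<open>y\<close> is a single path at a fixed \<open>\<omega>\<close>: it stays in
  some good region on \<open>{0..t}\<close>, hence solves a truncated equation there, and
  \<open>X_unique\<close> applies.\<close>

lemma pathwise_unique:
  assumes \<omega>: "\<omega> \<in> space M" and good: "noncolliding \<omega>"
    and cont: "\<And>i. i \<in> {1..N} \<Longrightarrow> continuous_on {0..} (\<lambda>t. y t i)"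
    and chamber: "\<And>t. t \<ge> 0 \<Longrightarrow> y t \<in> ordered_chamber N"
    and int: "\<And>i t. i \<in> {1..N} \<Longrightarrow> t \<ge> 0 \<Longrightarrow> set_integrable lborel {0..t} (\<lambda>s. dyson_drift N V (y s) i)"
    and eq: "\<And>i t. i \<in> {1..N} \<Longrightarrow> t \<ge> 0 \<Longrightarrow>
      y t i = x\<^sub>0 i + \<sigma> * B t \<omega> i + (LINT s:{0..t}|lborel. dyson_drift N V (y s) i)"
    and t: "t \<ge> 0"
  shows "y t = dyson_process t \<omega>"
proof -
  have cont_t: "continuous_on {0..t} (\<lambda>s. y s i)" if "i \<in> {1..N}" for i
    using cont[OF that] by (rule continuous_on_subset) auto
  obtain r where r: "r \<ge> 1" "\<forall>s\<in>{0..t}. good_region N r (X r s \<omega>)" using good t by blast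
  obtain r' where r': "r' \<ge> 1" "\<forall>s\<in>{0..t}. good_region N r' (y s)"
    using chamber_path_good_region[OF t cont_t chamber] by auto
  have pos: "0 < r" "0 < r'" using r(1) r'(1) by auto
  obtain L b where l: "trunc_lipschitz N V r' L b" using lipschitz_trunc_drift[OF pos(2)] .
  have "trunc_solves N V r' (noise \<omega>) t y"
    unfolding lipschitz_drift.solves_def[OF l]
  proof (intro conjI ballI cont_t)
    fix i s assume i: "i \<in> {1..N}" and s: "s \<in> {0..t}"
    then have s0: "s \<ge> 0" by simp
    have "(LINT u:{0..s}|lborel. dyson_drift N V (y u) i) = integral {0..s} (\<lambda>u. dyson_drift N V (y u) i)"
      by (rule set_borel_integral_eq_integral(2)[OF int[OF i s0]])
    also have "\<dots> = integral {0..s} (\<lambda>u. drift r' (y u) i)"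
      using r'(2) s i by (intro Henstock_Kurzweil_Integration.integral_cong trunc_drift_eq_dyson_drift[symmetric]) auto
    finally show "y s i = noise \<omega> s i + integral {0..s} (\<lambda>u. drift r' (y u) i)"
      using eq[OF i s0] by (simp add: noise_def)
  qed
  then have "y t i = X r t \<omega> i" if "i \<in> {1..N}" for i
    using r(2) r'(2) t that by (intro X_unique[OF \<omega> pos]) auto
  moreover have "dyson_process t \<omega> i = X r t \<omega> i" if "i \<in> {1..N}" for i
    using r(2) t that by (intro dyson_process_eq_X[OF \<omega> r(1)]) auto
  moreover have "y t \<in> extensional {1..N}"
    using chamber[OF t] by (auto simp: ordered_chamber_def PiE_def)
  moreover have "dyson_process t \<omega> \<in> extensional {1..N}" by (simp add: dyson_process_def)
  ultimately show ?thesis by (intro extensionalityI[of _ "{1..N}"]) auto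
qed

end

section \<open>Null sets and a continuous version of the Brownian motion\<close>

lemma (in prob_space) null_augmentation_approx:
  assumes F: "subalgebra M F" and a: "a \<in> sigma_sets (space M) (sets F \<union> null_sets M)"
  shows "\<exists>a'\<in>sets F. AE \<omega> in M. \<omega> \<in> a \<longleftrightarrow> \<omega> \<in> a'"
  \<comment> \<open>The sets with such an approximation form a sigma-algebra that contains both
    generating families.\<close>
  using a
proof induction
  case (Basic a)
  then show ?case
  proof
    assume "a \<in> null_sets M"
    then have "AE \<omega> in M. \<omega> \<in> a \<longleftrightarrow> \<omega> \<in> {}" using AE_not_in by force
    then show ?thesis by (intro bexI[of _ "{}"]) auto
  qed auto
next
  case Empty
  then show ?case by (intro bexI[of _ "{}"]) auto
next
  case (Compl a)
  then obtain a' where a': "a' \<in> sets F" "AE \<omega> in M. \<omega> \<in> a \<longleftrightarrow> \<omega> \<in> a'" by blast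
  have "space M - a' \<in> sets F" using a'(1) F by (metis sets.compl_sets subalgebra_def)
  moreover have "AE \<omega> in M. \<omega> \<in> space M - a \<longleftrightarrow> \<omega> \<in> space M - a'" using a'(2) by eventually_elim auto
  ultimately show ?case by blast
next
  case (Union a)
  then have "\<forall>n. \<exists>a'. a' \<in> sets F \<and> (AE \<omega> in M. \<omega> \<in> a n \<longleftrightarrow> \<omega> \<in> a')" by blast
  then obtain a' where a': "\<forall>n. a' n \<in> sets F \<and> (AE \<omega> in M. \<omega> \<in> a n \<longleftrightarrow> \<omega> \<in> a' n)"
    using choice[of "\<lambda>n a'. a' \<in> sets F \<and> (AE \<omega> in M. \<omega> \<in> a n \<longleftrightarrow> \<omega> \<in> a')"] by blast
  then have "AE \<omega> in M. \<forall>n. \<omega> \<in> a n \<longleftrightarrow> \<omega> \<in> a' n" by (simp add: AE_all_countable)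
  then have "AE \<omega> in M. \<omega> \<in> (\<Union>n. a n) \<longleftrightarrow> \<omega> \<in> (\<Union>n. a' n)" by eventually_elim auto
  moreover have "(\<Union>n. a' n) \<in> sets F" using a' by auto
  ultimately show ?case by blast
qed

lemma increment_measurable_borel_vec:
  assumes "W s \<in> measurable A (borel_vec N)" "W t \<in> measurable A (borel_vec N)"
  shows "increment N W s t \<in> measurable A (borel_vec N)"
  unfolding increment_def
proof (rule measurable_restrict)
  fix i assume i: "i \<in> {1..N}"
  show "(\<lambda>\<omega>. W t \<omega> i - W s \<omega> i) \<in> borel_measurable A"
    by (intro borel_measurable_diff
        measurable_compose[where g="\<lambda>x. x i", OF assms(1) measurable_component_singleton[OF i]]
        measurable_compose[where g="\<lambda>x. x i", OF assms(2) measurable_component_singleton[OF i]])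
qed

lemma
  assumes F: "is_filtration M F" and W: "\<And>t. t \<ge> 0 \<Longrightarrow> W t \<in> measurable (F t) (borel_vec N)"
  shows space_natural_filtration: "space (natural_filtration M N W t) = space M"
    and natural_filtration_subset: "t \<ge> 0 \<Longrightarrow> sets (natural_filtration M N W t) \<subseteq> sets (F t)"
    and natural_filtration_mono: "s \<le> t \<Longrightarrow> sets (natural_filtration M N W s) \<subseteq> sets (natural_filtration M N W t)"
    and natural_filtration_adapted: "t \<ge> 0 \<Longrightarrow> W t \<in> measurable (natural_filtration M N W t) (borel_vec N)"
proof -
  let ?g = "\<lambda>t. {W s -` A \<inter> space M | s A. 0 \<le> s \<and> s \<le> t \<and> A \<in> sets (borel_vec N)}"
  have Pow: "?g t \<subseteq> Pow (space M)" for t by auto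
  show sp: "space (natural_filtration M N W t) = space M" for t
    unfolding natural_filtration_def by (rule space_measure_of[OF Pow])
  have sets: "sets (natural_filtration M N W t) = sigma_sets (space M) (?g t)" for t
    unfolding natural_filtration_def by (rule sets_measure_of[OF Pow])
  have FM: "space (F t) = space M" if "t \<ge> 0" for t using F that by (simp add: is_filtration_def subalgebra_def)
  show "sets (natural_filtration M N W t) \<subseteq> sets (F t)" if t: "t \<ge> 0"
  proof -
    have "?g t \<subseteq> sets (F t)"
    proof clarify
      fix s A assume s: "0 \<le> s" "s \<le> t" and A: "A \<in> sets (borel_vec N)"
      have "W s -` A \<inter> space (F s) \<in> sets (F s)" by (rule measurable_sets[OF W[OF s(1)] A])
      moreover have "sets (F s) \<subseteq> sets (F t)" using F s by (simp add: is_filtration_def)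
      ultimately show "W s -` A \<inter> space M \<in> sets (F t)" using FM[OF s(1)] by auto
    qed
    then show ?thesis unfolding sets FM[OF t, symmetric] by (rule sets.sigma_sets_subset)
  qed
  show "sets (natural_filtration M N W s) \<subseteq> sets (natural_filtration M N W t)" if "s \<le> t"
    unfolding sets by (rule sigma_sets_mono') (use that in force)
  show "W t \<in> measurable (natural_filtration M N W t) (borel_vec N)" if t: "t \<ge> 0"
  proof (rule measurableI)
    fix \<omega> assume "\<omega> \<in> space (natural_filtration M N W t)"
    then show "W t \<omega> \<in> space (borel_vec N)"
      using measurable_space[OF W[OF t]] FM[OF t] sp by simp
  next
    fix A assume "A \<in> sets (borel_vec N)"
    then have "W t -` A \<inter> space M \<in> ?g t" using t by blast
    then show "W t -` A \<inter> space (natural_filtration M N W t) \<in> sets (natural_filtration M N W t)"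
      unfolding sp unfolding sets by (rule sigma_sets.Basic)
  qed
qed

text \<open>Only null sets of \<open>M\<close> itself are adjoined, so the result is still a
  filtration of sub-sigma-algebras of \<open>M\<close>; it is contained in
  \<open>augmentation\<close>, which uses the completion.\<close>

definition null_augmentation :: "'a measure \<Rightarrow> (real \<Rightarrow> 'a measure) \<Rightarrow> real \<Rightarrow> 'a measure" where
  "null_augmentation M F t = sigma (space M) (sets (F t) \<union> null_sets M)"

text \<open>
  Resetting the Brownian motion to \<open>0\<close> on a null set makes all of its paths continuous. It stays
  adapted and keeps independent increments once the null sets are adjoined to the filtration.
\<close>

lemma (in prob_space) continuous_brownian_version:
  assumes F: "is_filtration M F" and bm: "brownian_motion M F N W"
  obtains Z where "Z \<in> null_sets M" "\<And>\<omega> i. \<omega> \<in> space M - Z \<Longrightarrow> i \<in> {1..N} \<Longrightarrow> W 0 \<omega> i = 0"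
    "filtered_brownian M (null_augmentation M (natural_filtration M N W)) N
       (\<lambda>t \<omega>. if \<omega> \<in> Z then (\<lambda>i\<in>{1..N}. 0) else W t \<omega>)"
proof -
  have W: "W t \<in> measurable (F t) (borel_vec N)" if "t \<ge> 0" for t
    using bm that by (simp add: brownian_motion_def)
  have sub: "subalgebra M (F t)" if "t \<ge> 0" for t using F that by (simp add: is_filtration_def)
  have WM: "W t \<in> measurable M (borel_vec N)" if "t \<ge> 0" for t
    using that by (intro measurable_from_subalg[OF sub W])
  note nat = space_natural_filtration[OF F W] natural_filtration_subset[OF F W]
    natural_filtration_mono[OF F W] natural_filtration_adapted[OF F W]
  let ?v = "\<lambda>B s t. vimage_algebra (space M) (increment N B s t) (borel_vec N)"
  let ?n = "natural_filtration M N W"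
  let ?G = "null_augmentation M ?n"
  have "AE \<omega> in M. (\<forall>i\<in>{1..N}. W 0 \<omega> i = 0) \<and> (\<forall>i\<in>{1..N}. continuous_on {0..} (\<lambda>t. W t \<omega> i))"
    using bm by (auto simp: brownian_motion_def)
  then obtain Z where Zsub: "{\<omega> \<in> space M. \<not> ((\<forall>i\<in>{1..N}. W 0 \<omega> i = 0) \<and> (\<forall>i\<in>{1..N}. continuous_on {0..} (\<lambda>t. W t \<omega> i)))} \<subseteq> Z"
    and "emeasure M Z = 0" "Z \<in> sets M" by (rule AE_E)
  then have Z: "Z \<in> null_sets M" by auto
  have good: "W 0 \<omega> i = 0" "continuous_on {0..} (\<lambda>t. W t \<omega> i)" if "\<omega> \<in> space M - Z" "i \<in> {1..N}" for \<omega> i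
    using Zsub that by blast+
  define B where "B t \<omega> = (if \<omega> \<in> Z then (\<lambda>i\<in>{1..N}. 0) else W t \<omega>)" for t \<omega>
  have AE_B: "AE \<omega> in M. \<forall>t. B t \<omega> = W t \<omega>"
    using AE_not_in[OF Z] by eventually_elim (auto simp: B_def)
  have subn: "subalgebra M (?n t)" if "t \<ge> 0" for t
    using nat(1)[of t] nat(2)[OF _ that] sub[OF that] that by (auto simp: subalgebra_def)
  have Pow: "sets (?n t) \<union> null_sets M \<subseteq> Pow (space M)" for t
    using sets.space_closed[of "?n t"] nat(1)[of t] sets.sets_into_space[of _ M] by (auto simp: null_sets_def)
  have spG: "space (?G t) = space M" for t unfolding null_augmentation_def by (rule space_measure_of[OF Pow])
  have setsG: "sets (?G t) = sigma_sets (space M) (sets (?n t) \<union> null_sets M)" for t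
    unfolding null_augmentation_def by (rule sets_measure_of[OF Pow])
  have subG: "subalgebra M (?G t)" if "t \<ge> 0" for t
  proof -
    have "sets (?n t) \<union> null_sets M \<subseteq> sets M" using subn[OF that] by (auto simp: subalgebra_def)
    then show ?thesis unfolding subalgebra_def spG setsG using sets.sigma_sets_subset by blast
  qed
  have nG: "subalgebra (?G t) (?n t)" for t
    unfolding subalgebra_def spG setsG by (auto simp: nat(1))
  have BG: "B t \<in> measurable (?G t) (borel_vec N)" if t: "t \<ge> 0" for t
    unfolding B_def
  proof (rule measurable_If_set)
    show "(\<lambda>\<omega>. \<lambda>i\<in>{1..N}. 0) \<in> measurable (?G t) (borel_vec N)" by (intro measurable_restrict) auto
    show "W t \<in> measurable (?G t) (borel_vec N)" by (rule measurable_from_subalg[OF nG nat(4)]) (use t in auto)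
    have "Z \<in> sets (?G t)" unfolding setsG using Z by auto
    then show "Z \<inter> space (?G t) \<in> sets (?G t)" by auto
  qed
  have BM: "B t \<in> measurable M (borel_vec N)" if "t \<ge> 0" for t
    using that by (intro measurable_from_subalg[OF subG BG])
  have incB: "increment N B s t \<in> measurable M (borel_vec N)" and incW: "increment N W s t \<in> measurable M (borel_vec N)"
    if "0 \<le> s" "s < t" for s t
    by (rule increment_measurable_borel_vec; use that in \<open>intro BM WM, linarith\<close>)+
  have AE_inc: "AE \<omega> in M. increment N B s t \<omega> = increment N W s t \<omega>" for s t
    using AE_B by eventually_elim (simp add: increment_def)
  have B_cont: "continuous_on {0..} (\<lambda>t. B t \<omega> i)" and B_0: "B 0 \<omega> i = 0"
    if "\<omega> \<in> space M" "i \<in> {1..N}" for \<omega> i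
    using that good by (cases "\<omega> \<in> Z"; simp add: B_def)+
  have "filtered_brownian M ?G N B"
  proof
    show "is_filtration M ?G"
      unfolding is_filtration_def
    proof (intro conjI allI impI subG)
      fix s t :: real assume "0 \<le> s \<and> s \<le> t"
      then show "sets (?G s) \<subseteq> sets (?G t)"
        unfolding setsG using nat(3)[of s t] by (intro sigma_sets_mono') auto
    qed
    show "brownian_motion M ?G N B"
      unfolding brownian_motion_def
    proof (intro conjI allI impI BG)
      show "AE \<omega> in M. \<forall>i\<in>{1..N}. B 0 \<omega> i = 0"
        by (intro AE_I2 ballI B_0)
      show "AE \<omega> in M. \<forall>i\<in>{1..N}. continuous_on {0..} (\<lambda>t. B t \<omega> i)"
        by (intro AE_I2 ballI B_cont)
      fix s t :: real assume st: "0 \<le> s \<and> s < t"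
      then have s: "s \<ge> 0" and st': "0 \<le> s" "s < t" by auto
      have "distr M (borel_vec N) (increment N B s t) = distr M (borel_vec N) (increment N W s t)"
        by (rule distr_cong_AE[OF refl refl AE_inc incB[OF st'] incW[OF st']])
      then show "distr M (borel_vec N) (increment N B s t) =
          PiM {1..N} (\<lambda>_. density lborel (\<lambda>x. ennreal (normal_density 0 (sqrt (t - s)) x)))"
        using bm st by (simp add: brownian_motion_def)
      have ind: "indep_set (sets (F s)) (sets (?v W s t))"
        using bm st by (simp add: brownian_motion_def)
      have vB: "sets (?v B s t)
          = {increment N B s t -` C \<inter> space M | C. C \<in> sets (borel_vec N)}"
        using measurable_space[OF incB[OF st']] by (intro sets_vimage_algebra2) auto
      show "indep_set (sets (?G s)) (sets (?v B s t))"
        unfolding indep_sets2_eq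
      proof (intro conjI ballI)
        show "sets (?G s) \<subseteq> events" using subG[OF s] by (simp add: subalgebra_def)
        show "sets (?v B s t) \<subseteq> events"
          unfolding vB using measurable_sets[OF incB[OF st']] by blast
        fix a b assume a: "a \<in> sets (?G s)" and b: "b \<in> sets (?v B s t)"
        \<comment> \<open>Independence is inherited: \<open>a\<close> and \<open>b\<close> agree
          almost surely with an event of \<open>F s\<close> and with the corresponding event for the
          increment of \<open>W\<close>.\<close>
        obtain a' where a': "a' \<in> sets (?n s)" "AE \<omega> in M. \<omega> \<in> a \<longleftrightarrow> \<omega> \<in> a'"
          using null_augmentation_approx[OF subn[OF s]] a unfolding setsG by blast
        obtain C where C: "C \<in> sets (borel_vec N)" "b = increment N B s t -` C \<inter> space M" using b unfolding vB by blast
        define b' where "b' = increment N W s t -` C \<inter> space M"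
        have b': "b' \<in> sets (?v W s t)"
          unfolding b'_def by (rule in_vimage_algebra[OF C(1)])
        have AEb: "AE \<omega> in M. \<omega> \<in> b \<longleftrightarrow> \<omega> \<in> b'"
          using AE_inc[of s t] by eventually_elim (auto simp: C b'_def)
        have a'F: "a' \<in> sets (F s)" using a'(1) nat(2)[of s] s by auto
        have ev: "a \<in> events" "a' \<in> events" "b \<in> events" "b' \<in> events"
          using a subG[OF s] a'F sub[OF s] measurable_sets[OF incB[OF st'] C(1)] measurable_sets[OF incW[OF st'] C(1)]
          by (auto simp: subalgebra_def C b'_def)
        have "AE \<omega> in M. \<omega> \<in> a \<inter> b \<longleftrightarrow> \<omega> \<in> a' \<inter> b'" using a'(2) AEb by eventually_elim auto
        then have "prob (a \<inter> b) = prob (a' \<inter> b')" using ev by (intro finite_measure_eq_AE) auto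
        also have "\<dots> = prob a' * prob b'" using ind a'F b' unfolding indep_sets2_eq by blast
        also have "prob a' = prob a" using a'(2) ev by (intro finite_measure_eq_AE) auto
        also have "prob b' = prob b" using AEb ev by (intro finite_measure_eq_AE) auto
        finally show "prob (a \<inter> b) = prob a * prob b" .
      qed
    qed
  qed (fact B_cont B_0)+
  then show ?thesis using that[OF Z good(1)] unfolding B_def by blast
qed

lemma C1_differentiable_on_locally_lipschitz:
  fixes f :: "real \<Rightarrow> real"
  assumes "f C1_differentiable_on UNIV"
  shows "\<exists>K\<ge>0. \<forall>a b. \<bar>a\<bar> \<le> r \<and> \<bar>b\<bar> \<le> r \<longrightarrow> \<bar>f a - f b\<bar> \<le> K * \<bar>a - b\<bar>"
proof -
  obtain D where D: "\<And>x. (f has_vector_derivative D x) (at x)" "continuous_on UNIV D"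
    using assms unfolding C1_differentiable_on_def by auto
  have "compact (D ` {-r..r})"
    by (intro compact_continuous_image continuous_on_subset[OF D(2)]) auto
  then obtain K where K: "\<forall>x\<in>{-r..r}. \<bar>D x\<bar> \<le> K" by (auto dest!: compact_imp_bounded simp: bounded_iff)
  \<comment> \<open>For \<open>r < 0\<close> the interval is empty and \<open>K\<close> may be
    negative, hence the absolute value.\<close>
  have "\<bar>f a - f b\<bar> \<le> \<bar>K\<bar> * \<bar>a - b\<bar>" if "\<bar>a\<bar> \<le> r" "\<bar>b\<bar> \<le> r" for a b
  proof -
    have "norm (f a - f b) \<le> \<bar>K\<bar> * norm (a - b)"
    proof (rule field_differentiable_bound[of "{-r..r}"])
      show "(f has_field_derivative D z) (at z within {-r..r})" for z
        using D(1)[of z] by (auto simp: has_real_derivative_iff_has_vector_derivative intro: has_vector_derivative_at_within)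
      show "norm (D z) \<le> \<bar>K\<bar>" if "z \<in> {-r..r}" for z using K that by fastforce
    qed (use that in auto)
    then show ?thesis by simp
  qed
  then show ?thesis by (intro exI[of _ "\<bar>K\<bar>"]) auto
qed

theorem theorem1p2:
  fixes M :: "'a measure" and F :: "real \<Rightarrow> 'a measure"
    and N :: nat and W :: "real \<Rightarrow> 'a \<Rightarrow> nat \<Rightarrow> real"
    and V :: "real \<Rightarrow> real" and \<delta> \<gamma> \<beta> :: real and x\<^sub>0 :: "nat \<Rightarrow> real"
  assumes "N \<ge> 1"
    and "prob_space M" and "is_filtration M F" and "brownian_motion M F N W"
    and "V differentiable_on UNIV" and "deriv V C1_differentiable_on UNIV"
    and "\<delta> > 0" and "\<And>x. V x \<ge> (1 + \<delta>) * ln (x\<^sup>2 + 1)"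
    and "\<And>R. R > 0 \<Longrightarrow> \<exists>K>0. \<forall>x y. \<bar>x\<bar> \<le> R \<and> \<bar>y\<bar> \<le> R \<longrightarrow>
           (x - y) * (deriv V x - deriv V y) \<ge> - K * \<bar>x - y\<bar>\<^sup>2"
    and "\<gamma> > 0" and "\<And>x. - x * deriv V x \<le> \<gamma> * (1 + \<bar>x\<bar>\<^sup>2)"
    and "\<beta> \<ge> 1" and "x\<^sub>0 \<in> ordered_chamber N"
  shows "\<exists>X. strong_dyson_solution M N W V \<beta> x\<^sub>0 X \<and>
           (\<forall>Y. dyson_solution M (augmentation M F) N W V \<beta> x\<^sub>0 Y \<longrightarrow>
              (AE \<omega> in M. \<forall>t\<ge>0. Y t \<omega> = X t \<omega>))"
proof -
  interpret prob_space M by fact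
  let ?G = "null_augmentation M (natural_filtration M N W)"
  obtain Z where Z: "Z \<in> null_sets M" and W0: "\<And>\<omega> i. \<omega> \<in> space M - Z \<Longrightarrow> i \<in> {1..N} \<Longrightarrow> W 0 \<omega> i = 0"
    and fb: "filtered_brownian M ?G N (\<lambda>t \<omega>. if \<omega> \<in> Z then (\<lambda>i\<in>{1..N}. 0) else W t \<omega>)"
    by (rule continuous_brownian_version[OF assms(3,4)], rule that, assumption, blast, assumption)
  define B where "B = (\<lambda>t \<omega>. if \<omega> \<in> Z then (\<lambda>i\<in>{1..N}. 0) else W t \<omega>)"
  interpret filtered_brownian M ?G N B using fb unfolding B_def .
  interpret dyson_setup M ?G N B V \<beta> \<gamma> x\<^sub>0
  proof
    show "x\<^sub>0 i < x\<^sub>0 j" if "(i, j) \<in> pairs N" for i j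
      using assms(13) that by (auto simp: ordered_chamber_def pairs_def)
    show "continuous_on UNIV (deriv V)" by (rule C1_differentiable_imp_continuous_on[OF assms(6)])
    show "\<exists>K\<ge>0. \<forall>a b. \<bar>a\<bar> \<le> r \<and> \<bar>b\<bar> \<le> r \<longrightarrow> \<bar>deriv V a - deriv V b\<bar> \<le> K * \<bar>a - b\<bar>" for r
      by (rule C1_differentiable_on_locally_lipschitz[OF assms(6)])
  qed (use assms in auto)
  have ext: "x\<^sub>0 \<in> extensional {1..N}" using assms(13) by (auto simp: ordered_chamber_def PiE_def)
  \<comment> \<open>One almost sure event carries everything that follows. Off \<open>Z\<close> the
    modified motion \<open>B\<close> coincides with \<open>W\<close> and \<open>W 0\<close>
    vanishes, so \<open>B\<close> is the increment of \<open>W\<close> that drives the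
    equation.\<close>
  have AE_path: "AE \<omega> in M. \<omega> \<in> space M \<and> noncolliding \<omega>
      \<and> (\<forall>t i. i \<in> {1..N} \<longrightarrow> B t \<omega> i = W t \<omega> i - W 0 \<omega> i)"
    using AE_space AE_good_region AE_not_in[OF Z]
  proof eventually_elim
    case (elim \<omega>)
    then show ?case using W0[of \<omega>] by (simp add: B_def)
  qed
  have "strong_dyson_solution M N W V \<beta> x\<^sub>0 dyson_process"
    unfolding strong_dyson_solution_def dyson_solution_def
  proof (intro conjI allI impI)
    fix t :: real assume t: "t \<ge> 0"
    let ?A = "augmentation M (natural_filtration M N W) t"
    have W: "W t \<in> measurable (F t) (borel_vec N)" if "t \<ge> 0" for t
      using assms(4) that by (simp add: brownian_motion_def)
    have sub_space: "sets (natural_filtration M N W t) \<subseteq> Pow (space M)"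
      using sets.space_closed[of "natural_filtration M N W t"] space_natural_filtration[OF assms(3) W] by simp
    have Pow1: "sets (natural_filtration M N W t) \<union> null_sets (completion M) \<subseteq> Pow (space M)"
      using sub_space sets.sets_into_space[of _ "completion M"] by (auto simp: null_sets_def)
    have Pow2: "sets (natural_filtration M N W t) \<union> null_sets M \<subseteq> Pow (space M)"
      using sub_space sets.sets_into_space[of _ M] by (auto simp: null_sets_def)
    \<comment> \<open>The process is adapted to the smaller augmentation by null sets of
      \<open>M\<close>, hence to the one by null sets of the completion.\<close>
    have "subalgebra ?A (?G t)"
      unfolding subalgebra_def augmentation_def null_augmentation_def
        space_measure_of[OF Pow1] space_measure_of[OF Pow2] sets_measure_of[OF Pow1] sets_measure_of[OF Pow2]
      by (intro conjI refl sigma_sets_mono') (auto intro: null_sets_completionI)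
    then show "dyson_process t \<in> measurable ?A (borel_vec N)"
      by (rule measurable_from_subalg[OF _ dyson_process_measurable[OF t]])
  next
    show "AE \<omega> in M. dyson_process 0 \<omega> = x\<^sub>0"
      using AE_path
    proof eventually_elim
      case (elim \<omega>)
      then show ?case
        using ext dyson_process_properties(1)[of \<omega>]
        by (intro extensionalityI[of _ "{1..N}"]) (auto simp: dyson_process_def)
    qed
    show "AE \<omega> in M. \<forall>i\<in>{1..N}. continuous_on {0..} (\<lambda>t. dyson_process t \<omega> i)"
      using AE_path by eventually_elim (blast intro: dyson_process_properties(2))
    show "AE \<omega> in M. \<forall>t\<ge>0. dyson_process t \<omega> \<in> ordered_chamber N"
      using AE_path by eventually_elim (blast intro: dyson_process_properties(3))
    show "AE \<omega> in M. \<forall>i\<in>{1..N}. \<forall>t\<ge>0.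
        set_integrable lborel {0..t} (\<lambda>s. dyson_drift N V (dyson_process s \<omega>) i) \<and>
        dyson_process t \<omega> i = dyson_process 0 \<omega> i + sqrt (2 / (\<beta> * real N)) * (W t \<omega> i - W 0 \<omega> i)
          + (LINT s:{0..t}|lborel. dyson_drift N V (dyson_process s \<omega>) i)"
      using AE_path
    proof eventually_elim
      case (elim \<omega>)
      then have \<omega>: "\<omega> \<in> space M" and good: "noncolliding \<omega>"
        and BW: "\<And>t i. i \<in> {1..N} \<Longrightarrow> B t \<omega> i = W t \<omega> i - W 0 \<omega> i" by blast+
      show ?case
      proof (intro ballI allI impI conjI)
        fix i and t :: real assume i: "i \<in> {1..N}" and t: "t \<ge> 0"
        show "set_integrable lborel {0..t} (\<lambda>s. dyson_drift N V (dyson_process s \<omega>) i)"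
          by (rule dyson_process_properties(4)[OF \<omega> good i t])
        show "dyson_process t \<omega> i = dyson_process 0 \<omega> i + sqrt (2 / (\<beta> * real N)) * (W t \<omega> i - W 0 \<omega> i)
          + (LINT s:{0..t}|lborel. dyson_drift N V (dyson_process s \<omega>) i)"
          using dyson_process_properties(5)[OF \<omega> good i t]
          unfolding dyson_process_properties(1)[OF \<omega> good i] BW[OF i] \<sigma>_def .
      qed
    qed
  qed
  \<comment> \<open>The comparison is made path by path outside one null set, so it covers
    competitors adapted to the augmentation of \<open>F\<close>.\<close>
  moreover have "AE \<omega> in M. \<forall>t\<ge>0. Y t \<omega> = dyson_process t \<omega>"
    if Y: "dyson_solution M (augmentation M F) N W V \<beta> x\<^sub>0 Y" for Y
  proof -
    note Y' = Y[unfolded dyson_solution_def]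
    from AE_path Y'[THEN conjunct2, THEN conjunct1] Y'[THEN conjunct2, THEN conjunct2, THEN conjunct1]
      Y'[THEN conjunct2, THEN conjunct2, THEN conjunct2, THEN conjunct1]
      Y'[THEN conjunct2, THEN conjunct2, THEN conjunct2, THEN conjunct2]
    show ?thesis
    proof eventually_elim
      case (elim \<omega>)
      then have \<omega>: "\<omega> \<in> space M" and good: "noncolliding \<omega>"
        and BW: "\<And>t i. i \<in> {1..N} \<Longrightarrow> B t \<omega> i = W t \<omega> i - W 0 \<omega> i" by blast+
      show ?case
      proof (intro allI impI)
        fix t :: real assume t: "t \<ge> 0"
        show "Y t \<omega> = dyson_process t \<omega>"
        proof (rule pathwise_unique[OF \<omega> good _ _ _ _ t])
          show "Y t \<omega> i = x\<^sub>0 i + \<sigma> * B t \<omega> i + (LINT s:{0..t}|lborel. dyson_drift N V (Y s \<omega>) i)"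
            if "i \<in> {1..N}" "t \<ge> 0" for i t
            using elim(2,5) that unfolding BW[OF that(1)] \<sigma>_def by simp
        qed (use elim(3-5) in blast)+
      qed
    qed
  qed
  ultimately show ?thesis by blast
qed

end
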